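(* For the planar four-vortex problem with circulations $\Gamma_1=\Gamma_2=1$ and $\Gamma_3=\Gamma_4=m$, the Hamiltonian $H$ restricted to the quotient manifold ${\cal M}$ is a Morse function (i.e. all of its critical points are nondegenerate) for each $m$ satisfying $0<m<1$.
   Context: Four vortices at positions $z_i=(x_i,y_i)\in\mathbb{R}^2$; $z=(z_1,\dots,z_4)\in\mathbb{R}^{8}$, $r_{ij}=\|z_i-z_j\|$, $\Gamma=\sum_i\Gamma_i$. Hamiltonian $H(z)=-\sum_{i<j}\Gamma_i\Gamma_j\ln r_{ij}$; center of vorticity $c=\frac1\Gamma\sum_i\Gamma_iz_i$; angular impulse $I(z)=\sum_i\Gamma_i\|z_i-c\|^2$; $L=\sum_{i<j}\Gamma_i\Gamma_j$. Normalized configuration space: ${\cal N}=\{z\in\mathbb{R}^{8}: c=0,\ I(z)=1\}$. Collision set: $\Delta=\{z: z_i=z_j\text{ for some }i\ne j\}$. Quotient manifold: ${\cal M}=({\cal N}-\Delta)/\mathrm{SO}(2)$, where $A\in\mathrm{SO}(2)$ acts by $(z_1,\dots,z_4)\mapsto(Az_1,\dots,Az_4)$ (a free action), of dimension $4$. $H$ is SO(2)-invariant and so descends to a smooth function on ${\cal M}$; its critical points are the classes of relative equilibria $z\in{\cal N}$, i.e. of those $z\in{\cal N}-\Delta$ with $\nabla H(z)=-LMz$, where $M=\mathrm{diag}\{\Gamma_1,\Gamma_1,\dots,\Gamma_4,\Gamma_4\}$. Equivalently, nondegeneracy of such a critical point means that the modified Hessian $M^{-1}D^2H(z)+L\,\mathrm{Id}$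 ($\mathrm{Id}$ the $8\times 8$ identity), which always has the four trivial eigenvalues $L,L,2L,0$, has its remaining four eigenvalues nonzero. *)

theory Defs
  imports "HOL-Analysis.Analysis"
begin

section \<open>The planar four-vortex problem\<close>

type_synonym config = "real^2^4"

definition total_circulation :: "real^4 \<Rightarrow> real" where
  "total_circulation \<Gamma> = (\<Sum>i\<in>UNIV. \<Gamma> $ i)"

definition vorticity_center :: "real^4 \<Rightarrow> config \<Rightarrow> real^2" where
  "vorticity_center \<Gamma> z = (1 / total_circulation \<Gamma>) *\<^sub>R (\<Sum>i\<in>UNIV. \<Gamma> $ i *\<^sub>R z $ i)"

definition angular_impulse :: "real^4 \<Rightarrow> config \<Rightarrow> real" where
  "angular_impulse \<Gamma> z = (\<Sum>i\<in>UNIV. \<Gamma> $ i * (norm (z $ i - vorticity_center \<Gamma> z))\<^sup>2)"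

(* In the index type 4 the numeral 4 equals 0, so the order on indices is 4 < 1 < 2 < 3.
   The summand is symmetric, so every unordered pair is still counted exactly once. *)
definition hamiltonian :: "real^4 \<Rightarrow> config \<Rightarrow> real" where
  "hamiltonian \<Gamma> z = - (\<Sum>i\<in>UNIV. \<Sum>j\<in>{j. i < j}. \<Gamma> $ i * \<Gamma> $ j * ln (norm (z $ i - z $ j)))"

definition normalized_configs :: "real^4 \<Rightarrow> config set" where
  "normalized_configs \<Gamma> = {z. vorticity_center \<Gamma> z = 0 \<and> angular_impulse \<Gamma> z = 1}"

definition collision_set :: "config set" where
  "collision_set = {z. \<exists>i j. i \<noteq> j \<and> z $ i = z $ j}"


section \<open>The quotient by SO(2)\<close>

definition rotate_config :: "real^2^2 \<Rightarrow> config \<Rightarrow> config" where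
  "rotate_config A z = (\<chi> i. A *v z $ i)"

definition orbit :: "config \<Rightarrow> config set" where
  "orbit z = {rotate_config A z | A. rotation_matrix A}"

definition quotient_space :: "real^4 \<Rightarrow> config set set" where
  "quotient_space \<Gamma> = orbit ` (normalized_configs \<Gamma> - collision_set)"

(* The value on an orbit is the common value of the Hamiltonian on its points. *)
definition reduced_hamiltonian :: "real^4 \<Rightarrow> config set \<Rightarrow> real" where
  "reduced_hamiltonian \<Gamma> p = the_elem (hamiltonian \<Gamma> ` p)"

lemma hamiltonian_rotate:
  assumes "rotation_matrix A"
  shows "hamiltonian \<Gamma> (rotate_config A z) = hamiltonian \<Gamma> z"
proof -
  have "orthogonal_transformation ((*v) A)"
    using assms by (simp add: rotation_matrix_def orthogonal_transformation_matrix)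
  then have "norm (A *v x - A *v y) = norm (x - y)" for x y
    by (metis matrix_vector_mult_diff_distrib orthogonal_transformation_norm)
  then show ?thesis
    by (simp add: hamiltonian_def rotate_config_def)
qed

lemma reduced_hamiltonian_orbit: "reduced_hamiltonian \<Gamma> (orbit z) = hamiltonian \<Gamma> z"
proof -
  have "rotation_matrix (mat 1 :: real^2^2)"
    by (simp add: rotation_matrix_def orthogonal_matrix_id)
  then have "rotate_config (mat 1) z \<in> orbit z"
    unfolding orbit_def by blast
  moreover have "\<forall>w\<in>orbit z. hamiltonian \<Gamma> w = hamiltonian \<Gamma> z"
    unfolding orbit_def by (clarify, rule hamiltonian_rotate)
  ultimately have "hamiltonian \<Gamma> ` orbit z = {hamiltonian \<Gamma> z}"
    by (intro equalityI subsetI) (auto simp: image_iff)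
  then show ?thesis
    by (simp add: reduced_hamiltonian_def)
qed


section \<open>Smooth functions and Hessians\<close>

primrec times_cont_differentiable_on ::
    "nat \<Rightarrow> ('a::euclidean_space \<Rightarrow> 'b::real_normed_vector) \<Rightarrow> 'a set \<Rightarrow> bool" where
  "times_cont_differentiable_on 0 f S \<longleftrightarrow> continuous_on S f"
| "times_cont_differentiable_on (Suc k) f S \<longleftrightarrow>
     (\<forall>x\<in>S. f differentiable (at x)) \<and>
     (\<forall>v. times_cont_differentiable_on k (\<lambda>x. frechet_derivative f (at x) v) S)"

(* Used on open sets only. *)
definition smooth_on :: "'a::euclidean_space set \<Rightarrow> ('a \<Rightarrow> 'b::real_normed_vector) \<Rightarrow> bool" where
  "smooth_on S f \<longleftrightarrow> (\<forall>k. times_cont_differentiable_on k f S)"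

definition partial_deriv :: "'n::finite \<Rightarrow> (real^'n \<Rightarrow> real) \<Rightarrow> real^'n \<Rightarrow> real" where
  "partial_deriv i g x = frechet_derivative g (at x) (axis i 1)"

definition hessian :: "(real^'n::finite \<Rightarrow> real) \<Rightarrow> real^'n \<Rightarrow> real^'n^'n" where
  "hessian g x = (\<chi> i j. partial_deriv i (partial_deriv j g) x)"


section \<open>The smooth structure of the quotient and Morse functions on it\<close>

(* The velocity at z of the SO(2)-action, d/dt of the rotation by the angle t at t = 0;
   it spans the tangent space at z of the orbit of z. *)
definition rotation_field :: "config \<Rightarrow> config" where
  "rotation_field z = (\<chi> i. (vector [vector [0, -1], vector [1, 0]] :: real^2^2) *v z $ i)"

(* The quotient manifold is 4-dimensional and its smooth structure is the one for which the
   projection (orbit) is a submersion. The kernel of the derivative of the projection at z is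
   spanned by rotation_field z. Hence, for a smooth map phi into the normalized collision-free
   configurations, the composition of phi with the projection has injective derivative,
   i.e. is a local diffeomorphism, exactly if no nonzero vector is mapped by the derivative
   of phi into that span. If the composition is moreover injective, it is (the inverse of)
   a chart. These charts form an atlas, since the projection has smooth local sections. *)
definition quotient_param :: "real^4 \<Rightarrow> (real^4) set \<Rightarrow> (real^4 \<Rightarrow> config) \<Rightarrow> bool" where
  "quotient_param \<Gamma> U \<phi> \<longleftrightarrow>
     open U \<and> smooth_on U \<phi> \<and>
     \<phi> ` U \<subseteq> normalized_configs \<Gamma> - collision_set \<and>
     inj_on (orbit \<circ> \<phi>) U \<and>
     (\<forall>u\<in>U. \<forall>v. frechet_derivative \<phi> (at u) v \<in> span {rotation_field (\<phi> u)} \<longrightarrow> v = 0)"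

definition smooth_on_quotient :: "real^4 \<Rightarrow> (config set \<Rightarrow> real) \<Rightarrow> bool" where
  "smooth_on_quotient \<Gamma> f \<longleftrightarrow> (\<forall>U \<phi>. quotient_param \<Gamma> U \<phi> \<longrightarrow> smooth_on U (f \<circ> orbit \<circ> \<phi>))"

(* For smooth f, neither being critical nor nondegeneracy of a critical point depends on the
   chart. The quantifiers over charts (all for critical, some for nondegenerate) are chosen so
   that a point without a chart would be critical and degenerate: the Morse property below
   cannot hold for lack of charts. *)
definition critical_point :: "real^4 \<Rightarrow> (config set \<Rightarrow> real) \<Rightarrow> config set \<Rightarrow> bool" where
  "critical_point \<Gamma> f p \<longleftrightarrow>
     p \<in> quotient_space \<Gamma> \<and>
     (\<forall>U \<phi> u. quotient_param \<Gamma> U \<phi> \<and> u \<in> U \<and> orbit (\<phi> u) = p \<longrightarrow>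
        ((f \<circ> orbit \<circ> \<phi>) has_derivative (\<lambda>_. 0)) (at u))"

definition nondegenerate_at :: "real^4 \<Rightarrow> (config set \<Rightarrow> real) \<Rightarrow> config set \<Rightarrow> bool" where
  "nondegenerate_at \<Gamma> f p \<longleftrightarrow>
     (\<exists>U \<phi> u. quotient_param \<Gamma> U \<phi> \<and> u \<in> U \<and> orbit (\<phi> u) = p \<and>
        det (hessian (f \<circ> orbit \<circ> \<phi>) u) \<noteq> 0)"

definition morse_on_quotient :: "real^4 \<Rightarrow> (config set \<Rightarrow> real) \<Rightarrow> bool" where
  "morse_on_quotient \<Gamma> f \<longleftrightarrow>
     smooth_on_quotient \<Gamma> f \<and> (\<forall>p. critical_point \<Gamma> f p \<longrightarrow> nondegenerate_at \<Gamma> f p)"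

end

theory Submission
  imports Defs
begin

text \<open>
  Fix the first two vortices at 0 and 1; this is a global chart of the quotient, and a kernel vector
  of the Hessian is a first-order motion of the other two vortices that solves the linearised
  equations of a relative equilibrium.

  If the vortices are collinear, the linearised equations split into a definite part along the line
  and a part across the line that is treated by a maximal slope argument.

  Otherwise let \<open>A\<^sub>i\<close> be the affine dependency of the four points, \<open>a\<^sub>i = A\<^sub>i / \<Gamma>\<^sub>i\<close>, and \<open>l\<close> the Lagrange
  multiplier. The equations say that \<open>1/(l s\<^sub>i\<^sub>j) - 1 = k a\<^sub>i a\<^sub>j\<close> for the squared distances \<open>s\<^sub>i\<^sub>j\<close>. After
  scaling, \<open>k = -1\<close> (\<open>k = 0\<close> and \<open>k > 0\<close> are impossible), and since \<open>\<Sum>\<^sub>j A\<^sub>j s\<^sub>i\<^sub>j\<close> does not depend on \<open>i\<close>,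
  everything reduces to three equations for the \<open>a\<^sub>i\<close>. By the symmetry of the circulations two of them
  have the factors \<open>a\<^sub>2 - a\<^sub>1\<close> and \<open>a\<^sub>4 - a\<^sub>3\<close>, and the third one factors modulo these two as
  \<open>(a\<^sub>3 + a\<^sub>4) (1 + m a\<^sub>3 a\<^sub>4) (a\<^sub>1 a\<^sub>2 + m)\<close>. This leaves rhombi, kites, isosceles trapezoids and
  one asymmetric family. The same factorisations hold to first order, and in each family the
  linearised equations have only the trivial solution, because a discriminant or a small
  determinant does not vanish for \<open>0 < m < 1\<close>.
\<close>

section \<open>Polynomial form of the equilibrium equations\<close>

text \<open>Rank one arises as follows. At vortex \<open>i\<close> the numbers
  \<open>\<Gamma>_j (1/(l s_ij) - 1)\<close>, completed at \<open>i\<close> so that they sum to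
  zero, form an affine dependency of the four points, hence are proportional to \<open>A_j\<close>;
  symmetry in \<open>i\<close> and \<open>j\<close> gives \<open>k a_i a_j\<close>. No
  \<open>A_i\<close> vanishes: otherwise three collinear vortices would lie on a circle around the
  fourth. The sum of \<open>A_j s_ij\<close> over \<open>j\<close> is independent of
  \<open>i\<close> because \<open>A\<close> annihilates affine functions, so that only the sum of
  \<open>A_j |z_j|^2\<close> survives. The obstacle is that a kernel vector need not respect the
  symmetry of the equilibrium and also moves \<open>k\<close> and \<open>l\<close>. The variation of
  \<open>k\<close> is absorbed by rescaling the weights. The symmetry is recovered by cancelling
  factors that are nonzero at the equilibrium, which is why the cases are split according to
  coincidences among the unperturbed weights. The bound \<open>m < 1\<close> is a real barrier: at
  \<open>m = 1\<close> the equilateral triangle with a vortex in its centre is a double root of the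
  kite equation.\<close>

text \<open>
  For points spanning the plane, \<open>1/(l s\<^sub>i\<^sub>j) - 1 = - a\<^sub>i a\<^sub>j\<close>, so that the normalised squared distances are
  \<open>1/(1 - a\<^sub>i a\<^sub>j)\<close>. The variables \<open>p, q\<close> and \<open>P, Q\<close> below are sum and product of the weights
  \<open>a\<^sub>1, a\<^sub>2\<close> and \<open>a\<^sub>3, a\<^sub>4\<close>.
\<close>

definition cross_den :: "real \<Rightarrow> real \<Rightarrow> real \<Rightarrow> real \<Rightarrow> real" where
  "cross_den p q P Q = 1 - p*P + p\<^sup>2*Q + q*(P\<^sup>2 - 2*Q) - p*q*P*Q + q\<^sup>2*Q\<^sup>2"

lemma cross_den_eq:
  "cross_den (a+b) (a*b) (c+d) (c*d) = (1-a*c)*(1-b*c)*(1-a*d)*(1-b*d)"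
  unfolding cross_den_def by algebra

text \<open>What remains of the equation of a pair after clearing denominators and dividing by the
  difference of its weights. Here \<open>k\<close> is the circulation of the pair itself, whose sum
  and product are \<open>p\<close> and \<open>q\<close>, and \<open>m\<close> is that of the other
  pair.\<close>

definition pair_eq :: "real \<Rightarrow> real \<Rightarrow> real \<Rightarrow> real \<Rightarrow> real \<Rightarrow> real \<Rightarrow> real" where
  "pair_eq k m p q P Q = k * cross_den p q P Q - m*(1-q)*(P\<^sup>2 - 2*Q - p*P*Q + 2*q*Q\<^sup>2)"

lemma three_fractions_clear:
  fixes x y :: real
  assumes "x \<noteq> 0" "y \<noteq> 0" "z \<noteq> 0" "u \<noteq> 0" "r \<noteq> 0"
  shows "(k/x + A/(y*z) + B/(u*r)) * (x*(y*z*u*r)) = k*(y*z*u*r) + A*x*(u*r) + B*x*(y*z)"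
proof -
  define k' A' B' where "k' = k/x" and "A' = A/(y*z)" and "B' = B/(u*r)"
  then have "k = k'*x" "A = A'*(y*z)" "B = B'*(u*r)" using assms by auto
  then show ?thesis unfolding k'_def[symmetric] A'_def[symmetric] B'_def[symmetric] by algebra
qed

lemma balance_fractions_clear:
  fixes x w :: real
  assumes "x \<noteq> 0" "w \<noteq> 0" "y \<noteq> 0" "z \<noteq> 0" "u \<noteq> 0" "r \<noteq> 0"
  shows "((b/x + m*c/y + m*d/u) + (a/x + m*c/z + m*d/r)
       - (m*d/w + a/y + b/z) - (m*c/w + a/u + b/r)) * (x*w*(y*z*u*r))
    = ((a+b)*w - m*(c+d)*x)*(y*z*u*r)
       + x*w*((m*c-a)*(z*u*r) + (m*c-b)*(y*u*r) + (m*d-a)*(y*z*r) + (m*d-b)*(y*z*u))"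
proof -
  have "((b*e + m*c*g + m*d*h) + (a*e + m*c*k + m*d*l)
       - (m*d*f + a*g + b*k) - (m*c*f + a*h + b*l)) * (x*w*(y*z*u*r))
    = ((a+b)*(e*x)*w - m*(c+d)*(f*w)*x)*(y*z*u*r)
       + x*w*((m*c-a)*(g*y)*(z*u*r) + (m*c-b)*(k*z)*(y*u*r) + (m*d-a)*(h*u)*(y*z*r) + (m*d-b)*(l*r)*(y*z*u))" for e f g h k l
    by (simp add: algebra_simps)
  from this[of "inverse x" "inverse y" "inverse u" "inverse z" "inverse r" "inverse w"] assms
  show ?thesis unfolding divide_inverse by simp
qed

text \<open>The brackets are the sums of \<open>A_j s_ij\<close> seen from the two vortices of a
  pair. Exchanging \<open>a\<close> and \<open>b\<close> exchanges the brackets, so their difference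
  carries the factor \<open>b - a\<close>, and the quotient is symmetric in each pair.\<close>

lemma pair_diff:
  fixes a b c d k m :: real
  assumes "a*b \<noteq> 1" "a*c \<noteq> 1" "b*c \<noteq> 1" "a*d \<noteq> 1" "b*d \<noteq> 1"
  shows "((k*b/(1-a*b) + m*c/(1-a*c) + m*d/(1-a*d)) - (k*a/(1-a*b) + m*c/(1-b*c) + m*d/(1-b*d)))
          * ((1-a*b) * cross_den (a+b) (a*b) (c+d) (c*d))
       = (b-a) * pair_eq k m (a+b) (a*b) (c+d) (c*d)"
proof -
  have nz: "1-a*b \<noteq> 0" "1-a*c \<noteq> 0" "1-b*c \<noteq> 0" "1-a*d \<noteq> 0" "1-b*d \<noteq> 0" using assms by auto
  have c: "m*c/(1-a*c) - m*c/(1-b*c) = (a-b)*m*c\<^sup>2/((1-a*c)*(1-b*c))"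
    using nz by (simp add: divide_simps) algebra
  have d: "m*d/(1-a*d) - m*d/(1-b*d) = (a-b)*m*d\<^sup>2/((1-a*d)*(1-b*d))"
    using nz by (simp add: divide_simps) algebra
  have "((k*b/(1-a*b) + m*c/(1-a*c) + m*d/(1-a*d)) - (k*a/(1-a*b) + m*c/(1-b*c) + m*d/(1-b*d)))
     = k*(b-a)/(1-a*b) + (a-b)*m*c\<^sup>2/((1-a*c)*(1-b*c)) + (a-b)*m*d\<^sup>2/((1-a*d)*(1-b*d))"
    using c d by (simp add: diff_divide_distrib algebra_simps)
  also have "\<dots> * ((1-a*b) * cross_den (a+b) (a*b) (c+d) (c*d))
     = k*(b-a)* ((1-a*c)*(1-b*c)*(1-a*d)*(1-b*d))
       + (a-b)*m*c\<^sup>2*(1-a*b)*((1-a*d)*(1-b*d)) + (a-b)*m*d\<^sup>2*(1-a*b)*((1-a*c)*(1-b*c))"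
    unfolding cross_den_eq using three_fractions_clear[OF nz] .
  also have "\<dots> = (b-a) * pair_eq k m (a+b) (a*b) (c+d) (c*d)"
    unfolding pair_eq_def cross_den_def by algebra
  finally show ?thesis .
qed

text \<open>This is \<open>cross_den\<close> times
  \<open>c/(1-a*c) + c/(1-b*c) + d/(1-a*d) + d/(1-b*d)\<close>; exchanging the two pairs of
  arguments gives the corresponding sum with numerators \<open>a\<close> and
  \<open>b\<close>.\<close>

definition cross_sum :: "real \<Rightarrow> real \<Rightarrow> real \<Rightarrow> real \<Rightarrow> real" where
  "cross_sum p q P Q = 2*P - 2*p*Q + 2*q*Q*P - p*P\<^sup>2 + p\<^sup>2*Q*P - 2*p*q*Q\<^sup>2"

text \<open>The sums seen from vortices 1 and 2 against those seen from 3 and 4; the relation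
  \<open>p = - m*P\<close> produces the common factor \<open>P\<close>. The \<open>pair_eq\<close>
  terms are kept because a pair with equal weights satisfies its equation without
  \<open>pair_eq\<close> being zero.\<close>

lemma balance_diff:
  fixes a b c d m :: real
  assumes "a*b \<noteq> 1" "c*d \<noteq> 1" "a*c \<noteq> 1" "b*c \<noteq> 1" "a*d \<noteq> 1" "b*d \<noteq> 1"
    and "a + b + m*(c+d) = 0"
  defines "p \<equiv> a+b" and "q \<equiv> a*b" and "P \<equiv> c+d" and "Q \<equiv> c*d"
  shows "((b/(1-a*b) + m*c/(1-a*c) + m*d/(1-a*d)) + (a/(1-a*b) + m*c/(1-b*c) + m*d/(1-b*d))
       - (m*d/(1-c*d) + a/(1-a*c) + b/(1-b*c)) - (m*c/(1-c*d) + a/(1-a*d) + b/(1-b*d)))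
          * ((1-q) * (1-Q) * cross_den p q P Q)
       = P * (4*(1+m*Q)*(q+m)*(1-q)*(1-Q) - m*(1-Q)*pair_eq 1 m p q P Q - (1-q)*pair_eq m 1 P Q p q)"
proof -
  have nz: "1-a*b \<noteq> 0" "1-c*d \<noteq> 0" "1-a*c \<noteq> 0" "1-b*c \<noteq> 0" "1-a*d \<noteq> 0" "1-b*d \<noteq> 0" using assms by auto
  have "((b/(1-a*b) + m*c/(1-a*c) + m*d/(1-a*d)) + (a/(1-a*b) + m*c/(1-b*c) + m*d/(1-b*d))
       - (m*d/(1-c*d) + a/(1-a*c) + b/(1-b*c)) - (m*c/(1-c*d) + a/(1-a*d) + b/(1-b*d)))
     * ((1-a*b) * (1-c*d) * cross_den (a+b) (a*b) (c+d) (c*d)) =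
     ((a+b)*(1-c*d) - m*(c+d)*(1-a*b)) * ((1-a*c)*(1-b*c)*(1-a*d)*(1-b*d))
     + (1-a*b)*(1-c*d)*((m*c-a)*((1-b*c)*(1-a*d)*(1-b*d)) + (m*c-b)*((1-a*c)*(1-a*d)*(1-b*d))
        + (m*d-a)*((1-a*c)*(1-b*c)*(1-b*d)) + (m*d-b)*((1-a*c)*(1-b*c)*(1-a*d)))"
    unfolding cross_den_eq by (rule balance_fractions_clear[OF nz])
  also have "\<dots> = (p*(1-Q) - m*P*(1-q)) * cross_den p q P Q
      + (1-q)*(1-Q)*(m * cross_sum p q P Q - cross_sum P Q p q)"
  proof -
    have "cross_sum p q P Q = c*((1-b*c)*(1-a*d)*(1-b*d)) + c*((1-a*c)*(1-a*d)*(1-b*d))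
        + d*((1-a*c)*(1-b*c)*(1-b*d)) + d*((1-a*c)*(1-b*c)*(1-a*d))"
      unfolding cross_sum_def p_def q_def P_def Q_def by algebra
    moreover have "cross_sum P Q p q = a*((1-b*c)*(1-a*d)*(1-b*d)) + b*((1-a*c)*(1-a*d)*(1-b*d))
        + a*((1-a*c)*(1-b*c)*(1-b*d)) + b*((1-a*c)*(1-b*c)*(1-a*d))"
      unfolding cross_sum_def p_def q_def P_def Q_def by algebra
    ultimately show ?thesis
      unfolding p_def q_def P_def Q_def cross_den_eq by algebra
  qed
  also have "\<dots> = P * (4*(1+m*Q)*(q+m)*(1-q)*(1-Q) - m*(1-Q)*pair_eq 1 m p q P Q - (1-q)*pair_eq m 1 P Q p q)"
  proof -
    have p: "p = - m*P" using assms by simp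
    have sw: "cross_den P Q p q = cross_den p q P Q" unfolding cross_den_def by algebra
    show ?thesis unfolding pair_eq_def sw unfolding cross_den_def cross_sum_def p by algebra
  qed
  finally show ?thesis unfolding p_def q_def P_def Q_def .
qed

section \<open>First-order perturbations\<close>

text \<open>
  Working modulo flat functions is computing with dual numbers: a perturbation of first order that
  solves the linearised equations satisfies the equations up to a flat function, so the algebra
  used for the equations applies to their linearisation as well.
\<close>

definition flat :: "(real \<Rightarrow> real) \<Rightarrow> bool" where
  "flat f \<longleftrightarrow> f 0 = 0 \<and> (f has_real_derivative 0) (at 0)"

lemma flat_derivD: "flat f \<Longrightarrow> (f has_real_derivative D) (at 0) \<Longrightarrow> D = 0"
  unfolding flat_def using DERIV_unique by blast

lemma flat_valD: "flat f \<Longrightarrow> f 0 = 0"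
  unfolding flat_def by blast

lemma flat_cong:
  assumes "flat f" "\<forall>\<^sub>F e in nhds 0. g e = f e"
  shows "flat g"
  using assms DERIV_cong_ev[of 0 0 g f 0 0] eventually_nhds_x_imp_x[OF assms(2)]
  unfolding flat_def by auto

lemma flat_mult:
  assumes "flat f" "g differentiable (at 0)"
  shows "flat (\<lambda>e. f e * g e)"
proof -
  obtain g' where "(g has_real_derivative g') (at 0)"
    using assms(2) real_differentiable_def by blast
  then show ?thesis
    using assms(1) unfolding flat_def by (auto intro!: derivative_eq_intros)
qed

lemma flat_diff: "flat f \<Longrightarrow> flat g \<Longrightarrow> flat (\<lambda>e. f e - g e)"
  unfolding flat_def by (auto intro!: derivative_eq_intros)

text \<open>A function that is nonzero at 0 is a unit among the dual numbers: by the product rule,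
  factors that do not vanish at the equilibrium can be cancelled from linearised equations.\<close>

lemma flat_cancel:
  assumes "flat (\<lambda>e. f e * g e)" "f differentiable (at 0)" "g differentiable (at 0)" "g 0 \<noteq> 0"
  shows "flat f"
proof -
  obtain g' f' where g: "(g has_real_derivative g') (at 0)" and f: "(f has_real_derivative f') (at 0)"
    using assms(2,3) real_differentiable_def by blast
  have f0: "f 0 = 0" using flat_valD[OF assms(1)] assms(4) by simp
  have "f' * g 0 + g' * f 0 = 0"
    by (rule flat_derivD[OF assms(1)]) (rule DERIV_mult[OF f g])
  then show ?thesis using f0 f assms(4) unfolding flat_def by auto
qed

lemma flat_cancel_left:
  assumes "flat (\<lambda>e. g e * f e)" "f differentiable (at 0)" "g differentiable (at 0)" "g 0 \<noteq> 0"
  shows "flat f"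
  using flat_cancel[of f g] assms by (simp add: mult.commute)

lemma pair_eq_differentiable [derivative_intros]:
  assumes "p differentiable (at x)" "q differentiable (at x)" "P differentiable (at x)" "Q differentiable (at x)"
  shows "(\<lambda>e. pair_eq k m (p e) (q e) (P e) (Q e)) differentiable (at x)"
  unfolding pair_eq_def cross_den_def using assms by (auto intro!: derivative_intros)

lemma pair_eq_DERIV:
  assumes "(p has_real_derivative p') (at 0)" "(q has_real_derivative q') (at 0)"
    "(P has_real_derivative P') (at 0)" "(Q has_real_derivative Q') (at 0)"
    "p 0 = p0" "q 0 = q0" "P 0 = P0" "Q 0 = Q0"
  shows "((\<lambda>e. pair_eq k m (p e) (q e) (P e) (Q e)) has_real_derivative
     k * (- (p'*P0 + p0*P') + 2*p0*p'*Q0 + p0\<^sup>2*Q' + q'*(P0\<^sup>2 - 2*Q0) + q0*(2*P0*P' - 2*Q')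
        - (p'*q0*P0*Q0 + p0*q'*P0*Q0 + p0*q0*P'*Q0 + p0*q0*P0*Q') + 2*q0*q'*Q0\<^sup>2 + 2*q0\<^sup>2*Q0*Q')
     + m*q'*(P0\<^sup>2 - 2*Q0 - p0*P0*Q0 + 2*q0*Q0\<^sup>2)
     - m*(1-q0)*(2*P0*P' - 2*Q' - (p'*P0*Q0 + p0*P'*Q0 + p0*P0*Q') + 2*q'*Q0\<^sup>2 + 4*q0*Q0*Q')) (at 0)"
  unfolding pair_eq_def cross_den_def
  by (rule derivative_eq_intros assms refl)+ (simp add: assms, algebra)

section \<open>The quadratic equations of rhombi and kites\<close>

text \<open>In \<open>y = b\<^sup>2\<close> the expression is a quadratic
  \<open>A*y\<^sup>2 - B*y + 2\<close>, and a nonzero \<open>\<beta>\<close> would make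
  \<open>y\<close> a double root. A quadratic with a double root and \<open>A > 0\<close> is nowhere
  negative, but at 1 its value is \<open>(m\<^sup>2-1)*(m+1)\<close>.\<close>

lemma rhombus_nondegenerate:
  fixes m b \<beta> :: real
  assumes m: "0 < m" "m < 1" and b: "b \<noteq> 0" "b\<^sup>2 < 1"
    and fl: "flat (\<lambda>e. 4*(1-(b+e*\<beta>)\<^sup>2)*(1-m\<^sup>2*(b+e*\<beta>)\<^sup>2) - (1+m*(b+e*\<beta>)\<^sup>2)*(2-(1+m\<^sup>2)*(b+e*\<beta>)\<^sup>2))"
  shows "\<beta> = 0"
proof -
  define y where "y = b\<^sup>2"
  have y: "0 < y" "y < 1" using b unfolding y_def by auto
  define A B where "A = 4*m\<^sup>2 + m + m^3" and "B = 3 + 3*m\<^sup>2 + 2*m"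
  have v: "A*y\<^sup>2 - B*y + 2 = 0"
    using flat_valD[OF fl] unfolding A_def B_def y_def by (simp add: algebra_simps power2_eq_square power3_eq_cube)
  have "(2*A*y - B) * (2*b*\<beta>) = 0"
    unfolding A_def B_def y_def
    by (rule flat_derivD[OF fl], (rule derivative_eq_intros refl)+) (simp add: algebra_simps power2_eq_square power3_eq_cube)
  moreover have "2*A*y - B \<noteq> 0"
  proof
    assume z: "2*A*y - B = 0"
    have "A - B + 2 = A*(1-y)\<^sup>2" using v z by algebra
    moreover have "A > 0" using m unfolding A_def by (simp add: add_pos_pos)
    ultimately have "A - B + 2 \<ge> 0" by simp
    moreover have "A - B + 2 = (m\<^sup>2-1)*(m+1)" unfolding A_def B_def by algebra
    moreover have "m\<^sup>2 < 1" using m by (simp add: abs_square_less_1)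
    ultimately show False using m by (simp add: mult_neg_pos zero_le_mult_iff)
  qed
  ultimately show ?thesis using b by simp
qed

text \<open>The discriminant is \<open>m\<^sup>2*(m-1)*(m+1)*(m\<^sup>2-4*m-9)\<close>. At
  \<open>m = 1\<close> the quadratic is \<open>(3*x-1)\<^sup>2\<close>; its root belongs to weights
  proportional to 1, 1, 1, -3, the equilateral triangle with its centre.\<close>

lemma kite_double_root_free:
  fixes m x :: real
  assumes "0 < m" "m < 1" "(m+2)*(2*m+1)*x\<^sup>2 - m*(m\<^sup>2+2*m+3)*x + m^3 = 0"
  shows "2*(m+2)*(2*m+1)*x - m*(m\<^sup>2+2*m+3) \<noteq> 0"
proof
  assume z: "2*(m+2)*(2*m+1)*x - m*(m\<^sup>2+2*m+3) = 0"
  have "m\<^sup>2 * ((m-1)*(m+1)*(m\<^sup>2-4*m-9)) = 0" using assms(3) z by algebra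
  moreover have "m\<^sup>2 < 1" using assms by (simp add: abs_square_less_1)
  ultimately show False using assms by auto
qed

text \<open>The discriminant is \<open>- (1-m)*(1+m)*(9*m\<^sup>2+4*m-1)\<close>. If it is negative
  there is no real root. Otherwise the vertex lies at or beyond 1, so the quadratic decreases on the
  unit interval, and its value at 1 is \<open>2*m\<^sup>2 + 2*m^3 > 0\<close>.\<close>

lemma kite_excluded:
  fixes m y :: real
  assumes m: "0 < m" "m < 1" and y: "0 < y" "y < 1"
  shows "(1+2*m)*(2+m)*m*y\<^sup>2 - (1+2*m+3*m\<^sup>2)*y + 1 \<noteq> 0"
proof (cases "9*m\<^sup>2 + 4*m \<le> 1")
  case True
  define A B where "A = (1+2*m)*(2+m)*m" and "B = 1+2*m+3*m\<^sup>2"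
  have m3: "m^3 < m\<^sup>2" using m by (simp add: power_strict_decreasing)
  have A: "A > 0" using m unfolding A_def by simp
  have "m^3 < m" using m power_strict_decreasing[of 1 3 m] by simp
  then have "4*m^3 \<le> 2*m + 2*m\<^sup>2" using m3 by simp
  then have "2*A \<le> B"
    using True unfolding A_def B_def by (simp add: algebra_simps power2_eq_square power3_eq_cube)
  moreover have "A*(1+y) < A*2" using A y by simp
  ultimately have "A*(1+y) < B" by simp
  then have "(B - A*(1+y))*(1-y) > 0" using y by simp
  moreover have "A - B + 1 > 0" using m3 m unfolding A_def B_def
    by (simp add: algebra_simps power2_eq_square power3_eq_cube add_pos_pos)
  moreover have "A*y\<^sup>2 - B*y + 1 = (B - A*(1+y))*(1-y) + (A - B + 1)" by algebra
  ultimately show ?thesis unfolding A_def B_def by linarith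
next
  case False
  define A B where "A = (1+2*m)*(2+m)*m" and "B = 1+2*m+3*m\<^sup>2"
  have A: "A > 0" using m unfolding A_def by simp
  have "4*A - B\<^sup>2 = (1-m)*(1+m)*(9*m\<^sup>2+4*m-1)" unfolding A_def B_def by algebra
  then have "4*A - B\<^sup>2 > 0" using m False by simp
  moreover have "4*A*(A*y\<^sup>2 - B*y + 1) = (2*A*y-B)\<^sup>2 + (4*A - B\<^sup>2)" by algebra
  ultimately have "4*A*(A*y\<^sup>2 - B*y + 1) > 0" by (simp add: add_nonneg_pos)
  then show ?thesis using A unfolding A_def B_def by auto
qed

section \<open>Non-collinear equilibria in the weight coordinates\<close>

text \<open>For weights \<open>a, -a, c, -c\<close> put \<open>x = a\<^sup>2\<close> and
  \<open>y = c\<^sup>2\<close>; the last two hypotheses are the linearised pair equations. Up to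
  sign, their determinant is a sum of positive terms.\<close>

lemma trapezoid_nondegenerate:
  fixes m x y q' Q' :: real
  assumes m: "0 < m" and x: "0 < x" and y: "0 < y"
    and "- (q'*(-y) + (-x)*Q') + 2*m*Q'*(1+x) - 2*m*(-y)*q' = 0"
    and "- m*(q'*(-y) + (-x)*Q') + 2*q'*(1+y) - 2*(-x)*Q' = 0"
  shows "q' = 0 \<and> Q' = 0"
proof -
  have 1: "q'*(y*(1+2*m)) + Q'*(x + 2*m*(1+x)) = 0" using assms(4) by (simp add: algebra_simps)
  have 2: "q'*(m*y + 2 + 2*y) + Q'*(x*(m+2)) = 0" using assms(5) by (simp add: algebra_simps)
  have e: "(x + 2*m*(1+x))*(m*y + 2 + 2*y) - (y*(1+2*m))*(x*(m+2)) = 2*x + 2*m\<^sup>2*y + 4*m + 4*m*y + 4*m*x"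
    by algebra
  have pos: "2*x + 2*m\<^sup>2*y + 4*m + 4*m*y + 4*m*x > 0" using m x y by (simp add: add_pos_pos)
  have "q' * ((x + 2*m*(1+x))*(m*y + 2 + 2*y) - (y*(1+2*m))*(x*(m+2))) = 0" using 1 2 by algebra
  then have q: "q' = 0" using e pos by (metis less_irrefl mult_eq_0_iff)
  have "x*(m+2) > 0" using m x by simp
  then show ?thesis using 2 q by auto
qed

text \<open>On the branch \<open>1 + m*Q = 0\<close> the pair equations determine \<open>q\<close>
  and \<open>p\<^sup>2\<close>, and the resulting discriminant \<open>p\<^sup>2 - 4*q\<close> is
  negative for \<open>m < 1\<close>. This is incompatible with two distinct real weights of sum
  \<open>p\<close> and product \<open>q\<close>.\<close>

lemma asymmetric_excluded:
  fixes m p q P Q :: real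
  assumes m: "0 < m" "m < 1" and p: "p = - m*P" and Q: "1 + m*Q = 0"
    and e1: "pair_eq 1 m p q P Q = 0" and e2: "pair_eq m 1 P Q p q = 0"
    and D: "cross_den p q P Q \<noteq> 0" and d: "4*q < p\<^sup>2"
  shows False
proof -
  have "m\<^sup>2 * cross_den p q P Q = (m+q)\<^sup>2"
    using Q unfolding cross_den_def p by algebra
  then have nz: "m + q \<noteq> 0" using D m by (metis mult_eq_0_iff power_not_zero less_irrefl zero_power2)
  have "(m+q) * (m + q - (2*m - 2*m*q)) = 0"
    using e1 Q m unfolding pair_eq_def cross_den_def p by algebra
  then have "m + q - (2*m - 2*m*q) = 0" using nz by (simp only: mult_eq_0_iff) simp
  then have q: "q*(1+2*m) = m" by (simp add: algebra_simps)
  have "(m+q) * (m*(m+q) - (1+m)*(p\<^sup>2-2*q)) = 0"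
    using e2 Q m unfolding pair_eq_def cross_den_def p by algebra
  then have "m*(m+q) = (1+m)*(p\<^sup>2-2*q)" using nz by simp
  then have "(1+2*m)*(1+m)*(p\<^sup>2 - 4*q) = 2*m*(1+m)*(m-1)" using q by algebra
  moreover have "(1+2*m)*(1+m)*(p\<^sup>2 - 4*q) > 0" using m d by simp
  moreover have "2*m*(1+m)*(m-1) < 0" using m by (simp add: mult_pos_neg)
  ultimately show False by linarith
qed

text \<open>On the branch \<open>q = - m\<close> the second equation factors and fixes
  \<open>Q\<close>; the first one then fixes \<open>P\<^sup>2\<close>. Hence the linearised system
  is triangular with nonzero diagonal.\<close>

lemma asymmetric_nondegenerate:
  fixes m :: real and p q P Q :: "real \<Rightarrow> real"
  assumes m: "0 < m" 
    and p: "p = (\<lambda>e. - m*P e)"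
    and P: "(P has_real_derivative P') (at 0)" and q: "(q has_real_derivative 0) (at 0)"
    and Q: "(Q has_real_derivative Q') (at 0)"
    and q0: "q 0 = - m" and nz: "P 0 \<noteq> 0" "1 + m*Q 0 \<noteq> 0"
    and e1: "flat (\<lambda>e. pair_eq 1 m (p e) (q e) (P e) (Q e))"
    and e2: "flat (\<lambda>e. pair_eq m 1 (P e) (Q e) (p e) (q e))"
  shows "P' = 0 \<and> Q' = 0"
proof -
  define P0 Q0 where "P0 = P 0" and "Q0 = Q 0"
  note nz' = nz[folded P0_def Q0_def]
  have p0: "p 0 = - m*P0" using p P0_def by simp
  have pd: "(p has_real_derivative - m*P') (at 0)" unfolding p by (rule derivative_eq_intros P refl)+ simp
  have v: "m*(1+m*Q0)*(m*Q0+2*Q0-1) = 0"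
    using flat_valD[OF e2] unfolding p0 q0 P0_def[symmetric] Q0_def[symmetric] pair_eq_def cross_den_def by algebra
  then have Q0: "m*Q0 + 2*Q0 = 1" using nz' m by simp
  have v1: "(1+m*Q0)*((1+m*Q0) - m*(1+m)*(P0\<^sup>2-2*Q0)) = 0"
    using flat_valD[OF e1] unfolding p0 q0 P0_def[symmetric] Q0_def[symmetric] pair_eq_def cross_den_def by algebra
  then have P0: "1+m*Q0 = m*(1+m)*(P0\<^sup>2-2*Q0)" using nz' by simp
  have "m*(1+m*Q0)*((m+2)*Q') = 0"
    using flat_derivD[OF e2 pair_eq_DERIV[OF P Q pd q P0_def[symmetric] Q0_def[symmetric] p0 q0]] Q0 by algebra
  then have Q': "Q' = 0" using nz' m by simp
  have "2*m*(1+m)*(1+m*Q0)*P0*P' = 0"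
    using flat_derivD[OF e1 pair_eq_DERIV[OF pd q P Q p0 q0 P0_def[symmetric] Q0_def[symmetric]]] P0 Q' by algebra
  then show ?thesis using nz' m Q' by simp
qed

definition balance_eq :: "real \<Rightarrow> real \<Rightarrow> real \<Rightarrow> real \<Rightarrow> real \<Rightarrow> real" where
  "balance_eq m p q P Q = P * (4*(1+m*Q)*(q+m)*(1-q)*(1-Q) - m*(1-Q)*pair_eq 1 m p q P Q - (1-q)*pair_eq m 1 P Q p q)"

text \<open>At a rhombus both \<open>pair_eq\<close> values are nonzero and can be cancelled, so the
  perturbation keeps the weights equal in each pair. One parameter remains, which is governed by the
  quadratic of \<open>rhombus_nondegenerate\<close>.\<close>

lemma rhombus_rigid:
  fixes m a c \<alpha> \<beta> \<gamma> \<delta> :: real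
  assumes m: "0 < m" "m < 1" and nz: "a \<noteq> 0"
    and sq: "c\<^sup>2 < 1"
    and sum0: "a + m*c = 0" and sum1: "\<alpha> + \<beta> + m*(\<gamma> + \<delta>) = 0"
  defines "p \<equiv> \<lambda>e. (a+e*\<alpha>) + (a+e*\<beta>)" and "q \<equiv> \<lambda>e. (a+e*\<alpha>) * (a+e*\<beta>)"
    and "P \<equiv> \<lambda>e. (c+e*\<gamma>) + (c+e*\<delta>)" and "Q \<equiv> \<lambda>e. (c+e*\<gamma>) * (c+e*\<delta>)"
  assumes f1: "flat (\<lambda>e. ((a+e*\<beta>) - (a+e*\<alpha>)) * pair_eq 1 m (p e) (q e) (P e) (Q e))"
    and f2: "flat (\<lambda>e. ((c+e*\<delta>) - (c+e*\<gamma>)) * pair_eq m 1 (P e) (Q e) (p e) (q e))"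
    and f3: "flat (\<lambda>e. balance_eq m (p e) (q e) (P e) (Q e))"
  shows "\<alpha> = 0 \<and> \<beta> = 0 \<and> \<gamma> = 0 \<and> \<delta> = 0"
proof -
  have a: "a = - m*c" using sum0 by simp
  have c: "c \<noteq> 0" using nz a by auto
  define y where "y = c\<^sup>2"
  have y: "0 < y" "y < 1" using c sq y_def by auto
  have m2: "m\<^sup>2 < 1" using m by (simp add: abs_square_less_1)
  have pd: "p differentiable (at 0)" "q differentiable (at 0)" "P differentiable (at 0)" "Q differentiable (at 0)"
    unfolding p_def q_def P_def Q_def by (auto intro!: derivative_intros)
  have "flat (\<lambda>e. (a+e*\<beta>) - (a+e*\<alpha>))"
  proof (rule flat_cancel[OF f1])
    have "pair_eq 1 m (p 0) (q 0) (P 0) (Q 0) = (1+m*y)\<^sup>2 * (1 + m\<^sup>2*y\<^sup>2 + 2*m^3*y\<^sup>2)"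
      unfolding p_def q_def P_def Q_def y_def pair_eq_def cross_den_def a by simp algebra
    moreover have "1+m*y > 0" "1 + m\<^sup>2*y\<^sup>2 + 2*m^3*y\<^sup>2 > 0" using m y by (auto simp: add_pos_pos)
    ultimately show "pair_eq 1 m (p 0) (q 0) (P 0) (Q 0) \<noteq> 0" by simp
  qed (auto intro!: derivative_intros pd)
  then have "\<beta> - \<alpha> = 0" by (rule flat_derivD) (rule derivative_eq_intros refl | simp)+
  then have \<beta>: "\<beta> = \<alpha>" by simp
  have "flat (\<lambda>e. (c+e*\<delta>) - (c+e*\<gamma>))"
  proof (rule flat_cancel[OF f2])
    have "pair_eq m 1 (P 0) (Q 0) (p 0) (q 0) = m * (1+m*y)\<^sup>2 * (1 + m\<^sup>2*y\<^sup>2 + 2*m*y\<^sup>2)"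
      unfolding p_def q_def P_def Q_def y_def pair_eq_def cross_den_def a by simp algebra
    moreover have "1+m*y > 0" "1 + m\<^sup>2*y\<^sup>2 + 2*m*y\<^sup>2 > 0" using m y by (auto simp: add_pos_pos)
    ultimately show "pair_eq m 1 (P 0) (Q 0) (p 0) (q 0) \<noteq> 0" using m by simp
  qed (auto intro!: derivative_intros pd)
  then have "\<delta> - \<gamma> = 0" by (rule flat_derivD) (rule derivative_eq_intros refl | simp)+
  then have \<delta>: "\<delta> = \<gamma>" by simp
  have \<alpha>: "\<alpha> = - m*\<gamma>" using sum1 \<beta> \<delta> by simp
  let ?g = "\<lambda>e. 4*(1-(c+e*\<gamma>)\<^sup>2)*(1-m\<^sup>2*(c+e*\<gamma>)\<^sup>2) - (1+m*(c+e*\<gamma>)\<^sup>2)*(2-(1+m\<^sup>2)*(c+e*\<gamma>)\<^sup>2)"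
  have "balance_eq m (p e) (q e) (P e) (Q e) = ?g e * (2*(c+e*\<gamma>)*m*(1+m*(c+e*\<gamma>)\<^sup>2)^3)" for e
  proof -
    have "balance_eq m (-m*u + -m*u) ((-m*u)*(-m*u)) (u+u) (u*u)
       = (4*(1-u\<^sup>2)*(1-m\<^sup>2*u\<^sup>2) - (1+m*u\<^sup>2)*(2-(1+m\<^sup>2)*u\<^sup>2)) * (2*u*m*(1+m*u\<^sup>2)^3)" for u
      unfolding balance_eq_def pair_eq_def cross_den_def by algebra
    from this[of "c+e*\<gamma>"] show ?thesis
      unfolding p_def q_def P_def Q_def \<beta> \<delta> \<alpha> a by (simp add: algebra_simps)
  qed
  then have "flat (\<lambda>e. ?g e * (2*(c+e*\<gamma>)*m*(1+m*(c+e*\<gamma>)\<^sup>2)^3))" using f3 by simp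
  then have "flat ?g"
  proof (rule flat_cancel)
    have "1+m*y > 0" using m y by (auto simp: add_pos_pos)
    then show "2*(c+0*\<gamma>)*m*(1+m*(c+0*\<gamma>)\<^sup>2)^3 \<noteq> 0" using c m unfolding y_def by simp
  qed (auto intro!: derivative_intros)
  then have "\<gamma> = 0" using rhombus_nondegenerate[OF m c sq] by blast
  then show ?thesis using \<alpha> \<beta> \<delta> by simp
qed

text \<open>The mirror axis passes through vortices 3 and 4. The equation of this pair fixes
  \<open>a\<^sup>2*(c*d)\<close>, also to first order; with this product fixed, the balance equation
  becomes a quadratic in \<open>a\<^sup>2\<close> without a double root.\<close>

lemma kite_rigid:
  fixes m a c d \<alpha> \<beta> \<gamma> \<delta> :: real
  assumes m: "0 < m" "m < 1" and nz: "a \<noteq> 0" and cd: "c \<noteq> d"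
    and lt: "a\<^sup>2 < 1" "c*d < 1" and D1: "(1-a*c)*(1-a*d) \<noteq> 0"
    and sum0: "2*a + m*(c+d) = 0" and sum1: "\<alpha> + \<beta> + m*(\<gamma> + \<delta>) = 0"
  defines "p \<equiv> \<lambda>e. (a+e*\<alpha>) + (a+e*\<beta>)" and "q \<equiv> \<lambda>e. (a+e*\<alpha>) * (a+e*\<beta>)"
    and "P \<equiv> \<lambda>e. (c+e*\<gamma>) + (d+e*\<delta>)" and "Q \<equiv> \<lambda>e. (c+e*\<gamma>) * (d+e*\<delta>)"
  assumes f1: "flat (\<lambda>e. ((a+e*\<beta>) - (a+e*\<alpha>)) * pair_eq 1 m (p e) (q e) (P e) (Q e))"
    and f2: "flat (\<lambda>e. ((d+e*\<delta>) - (c+e*\<gamma>)) * pair_eq m 1 (P e) (Q e) (p e) (q e))"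
    and f3: "flat (\<lambda>e. balance_eq m (p e) (q e) (P e) (Q e))"
  shows "\<alpha> = 0 \<and> \<beta> = 0 \<and> \<gamma> = 0 \<and> \<delta> = 0"
proof -
  have pd: "p differentiable (at 0)" "q differentiable (at 0)" "P differentiable (at 0)" "Q differentiable (at 0)"
    unfolding p_def q_def P_def Q_def by (auto intro!: derivative_intros)
  have P: "P e = - p e/m" for e
  proof -
    have "p e + m * P e = (2*a + m*(c+d)) + e*(\<alpha> + \<beta> + m*(\<gamma>+\<delta>))" unfolding p_def P_def by algebra
    also have "\<dots> = 0" using sum0 sum1 by simp
    finally have "m * P e = - p e" by simp
    then show ?thesis using m by (simp add: field_simps)
  qed
  define P0 Q0 x where "P0 = c+d" and "Q0 = c*d" and "x = a\<^sup>2"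
  have at0: "p 0 = 2*a" "q 0 = x" "P 0 = P0" "Q 0 = Q0" unfolding p_def q_def P_def Q_def P0_def Q0_def x_def
    by (auto simp: power2_eq_square)
  have x: "0 < x" "x < 1" using nz lt x_def by auto
  have mP: "m*P0 = -2*a" using sum0 P0_def by simp
  then have P0: "P0 \<noteq> 0" using nz by auto
  have mP2: "m\<^sup>2*P0\<^sup>2 = 4*x" using mP x_def by algebra
  have D1': "1-a*P0+x*Q0 \<noteq> 0" using D1 unfolding P0_def Q0_def x_def by (simp add: algebra_simps power2_eq_square)
  have E2: "flat (\<lambda>e. pair_eq m 1 (P e) (Q e) (p e) (q e))"
    by (rule flat_cancel_left[OF f2]) (use cd in \<open>auto intro!: derivative_intros pd\<close>)
  \<comment> \<open>For \<open>a = b\<close> the expression splits, and the first factor is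
    \<open>(1-a*c)*(1-a*d)\<close>, which is nonzero.\<close>
  have "pair_eq m 1 P0 Q0 (2*a) x = (1-a*P0+x*Q0) * (m+(m+2)*x*Q0)"
    using mP unfolding pair_eq_def cross_den_def x_def by algebra
  then have K1: "m + (m+2)*x*Q0 = 0" using flat_valD[OF E2] D1' at0 by simp
  have f3': "flat (\<lambda>e. 4*(1+m*Q e)*(q e+m)*(1-q e)*(1-Q e) - m*(1-Q e)*pair_eq 1 m (p e) (q e) (P e) (Q e)
       - (1-q e)*pair_eq m 1 (P e) (Q e) (p e) (q e))"
    by (rule flat_cancel_left[OF f3[unfolded balance_eq_def]]) (use P0 in \<open>auto intro!: derivative_intros pd simp: at0\<close>)
  have "flat (\<lambda>e. (1-q e)*pair_eq m 1 (P e) (Q e) (p e) (q e))"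
    using flat_mult[OF E2, of "\<lambda>e. 1 - q e"] pd by (auto intro!: derivative_intros simp: mult.commute)
  then have "flat (\<lambda>e. (4*(1+m*Q e)*(q e+m)*(1-q e) - m*pair_eq 1 m (p e) (q e) (P e) (Q e))*(1-Q e))"
    using flat_diff[of _ "\<lambda>e. - ((1-q e)*pair_eq m 1 (P e) (Q e) (p e) (q e))"] flat_mult[of _ "\<lambda>e. -1"] f3'
    by (auto simp: algebra_simps flat_def dest: DERIV_add)
  then have Y: "flat (\<lambda>e. 4*(1+m*Q e)*(q e+m)*(1-q e) - m*pair_eq 1 m (p e) (q e) (P e) (Q e))"
    by (rule flat_cancel) (use lt in \<open>auto intro!: derivative_intros pd simp: at0 Q0_def\<close>)
  have Y0: "4*(1+m*Q0)*(x+m)*(1-x) = m*pair_eq 1 m (2*a) x P0 Q0"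
    using flat_valD[OF Y] at0 by simp
  have "flat (\<lambda>e. (a+e*\<beta>) - (a+e*\<alpha>))"
  proof (rule flat_cancel[OF f1])
    \<comment> \<open>Were this zero, the balance equation would force \<open>1 + m*Q0 = 0\<close>,
      hence \<open>x*(m+2) = m\<^sup>2\<close> and finally \<open>m\<^sup>2 = 1\<close>.\<close>
    show "pair_eq 1 m (p 0) (q 0) (P 0) (Q 0) \<noteq> 0"
    proof
      assume "pair_eq 1 m (p 0) (q 0) (P 0) (Q 0) = 0"
      then have z: "pair_eq 1 m (2*a) x P0 Q0 = 0" using at0 by simp
      then have mQ: "1+m*Q0 = 0" using Y0 x m by auto
      have x1: "x*(m+2) = m\<^sup>2" using K1 mQ by algebra
      have "m^4 * pair_eq 1 m (2*a) x P0 Q0 = m^2 * (m+x) * (m+x - 2*m*(1-x))"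
        using mP mQ unfolding pair_eq_def cross_den_def x_def by algebra
      then have "m+x - 2*m*(1-x) = 0" using z m x by simp
      then have "m * (m\<^sup>2 - 1) = 0" using x1 m by algebra
      moreover have "m\<^sup>2 < 1" using m by (simp add: abs_square_less_1)
      ultimately show False using m by simp
    qed
  qed (auto intro!: derivative_intros pd)
  then have "\<beta> - \<alpha> = 0" by (rule flat_derivD) (rule derivative_eq_intros refl | simp)+
  then have \<beta>: "\<beta> = \<alpha>" by simp
  have mp: "m*(\<gamma>+\<delta>) = -2*\<alpha>" using sum1 \<beta> by simp
  define x' Q' where "x' = 2*a*\<alpha>" and "Q' = c*\<delta> + d*\<gamma>"
  have dp: "(p has_real_derivative 2*\<alpha>) (at 0)" unfolding p_def \<beta> by (rule derivative_eq_intros refl | simp)+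
  have dq: "(q has_real_derivative x') (at 0)" unfolding q_def \<beta> x'_def by (rule derivative_eq_intros refl | simp)+
  have dP: "(P has_real_derivative (\<gamma>+\<delta>)) (at 0)" unfolding P_def by (rule derivative_eq_intros refl | simp)+
  have dQ: "(Q has_real_derivative Q') (at 0)" unfolding Q_def Q'_def by (rule derivative_eq_intros refl | simp)+
  have v2: "(1-a*P0+x*Q0) * ((m+2)*(x'*Q0 + x*Q')) = 0"
    using flat_derivD[OF E2 pair_eq_DERIV[OF dP dQ dp dq at0(3) at0(4) at0(1) at0(2)]] mp mP K1 unfolding x_def x'_def
    by algebra
  have v2: "x'*Q0 + x*Q' = 0" using v2 D1' m by simp
  define X0 where "X0 = x*Q0"
  have X0: "(m+2)*X0 = - m" using K1 unfolding X0_def by algebra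
  have "((\<lambda>e. q e * Q e - X0) has_real_derivative 0) (at 0)"
    using v2 by (auto intro!: derivative_eq_intros dq dQ simp: at0 algebra_simps)
  then have X: "flat (\<lambda>e. q e * Q e - X0)" unfolding flat_def X0_def by (simp add: at0)
  \<comment> \<open>Multiplying by \<open>m * q\<close> and using \<open>m*P = - p\<close> and
    \<open>p\<^sup>2 = 4*q\<close> expresses the balance equation through \<open>u = q\<close> and
    \<open>X = q*Q\<close>. Since \<open>X\<close> is constant to first order it may be replaced by
    \<open>X0\<close>; up to a nonvanishing factor this leaves \<open>?f\<close>.\<close>
  let ?Z = "\<lambda>u X. 4*m*(u+m*X)*(u+m)*(1-u) - u*(m+2*u+m*X)\<^sup>2 + m*(1-u)*((2*u+m*X)\<^sup>2 + m\<^sup>2*X\<^sup>2 - 2*m\<^sup>2*X)"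
  let ?f = "\<lambda>u. (m+2)*(2*m+1)*u\<^sup>2 - m*(m\<^sup>2+2*m+3)*u + m^3"
  have "(4*(1+m*Q e)*(q e+m)*(1-q e) - m*pair_eq 1 m (p e) (q e) (P e) (Q e)) * (m * q e) = ?Z (q e) (q e * Q e)" for e
  proof -
    have *: "(4*(1+m*S)*(A*A+m)*(1-A*A) - m*pair_eq 1 m (2*A) (A*A) R S) * (m * (A*A)) = ?Z (A*A) (A*A * S)"
      if "m*R = - 2*A" for A R S using that unfolding pair_eq_def cross_den_def by algebra
    have pe: "p e = 2*(a+e*\<alpha>)" and qe: "q e = (a+e*\<alpha>)*(a+e*\<alpha>)" unfolding p_def q_def \<beta> by auto
    have "m * P e = - 2*(a+e*\<alpha>)" using P[of e] m pe by simp
    then show ?thesis unfolding pe qe by (rule *)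
  qed
  then have "flat (\<lambda>e. ?Z (q e) (q e * Q e))"
    using flat_mult[OF Y, of "\<lambda>e. m * q e"] pd by (auto intro!: derivative_intros)
  moreover have "?Z u X - ?Z u X0 = (X - X0) * (4*m\<^sup>2*(u+m)*(1-u) - u*m*(2*m+4*u+m*X+m*X0)
      + m*(1-u)*(m*(4*u+m*X+m*X0) + m\<^sup>2*(X+X0) - 2*m\<^sup>2))" for u X
    by algebra
  moreover have "flat (\<lambda>e. (q e * Q e - X0) * (4*m\<^sup>2*(q e+m)*(1-q e) - q e*m*(2*m+4*q e+m*(q e * Q e)+m*X0)
      + m*(1-q e)*(m*(4*q e+m*(q e * Q e)+m*X0) + m\<^sup>2*(q e * Q e+X0) - 2*m\<^sup>2)))"
    by (rule flat_mult[OF X]) (auto intro!: derivative_intros pd)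
  moreover have cancel: "r - (r - s) = s" for r s :: real by simp
  ultimately have "flat (\<lambda>e. ?Z (q e) (q e * Q e) - (?Z (q e) (q e * Q e) - ?Z (q e) X0))"
    using flat_diff by presburger
  then have "flat (\<lambda>e. ?Z (q e) X0)" unfolding cancel .
  from flat_mult[OF this, of "\<lambda>e. (m+2)\<^sup>2"] have "flat (\<lambda>e. ?Z (q e) X0 * (m+2)\<^sup>2)"
    by (auto intro!: derivative_intros)
  moreover have "?Z u X0 * (m+2)\<^sup>2 = ?f u * (- 4 * ((m+2)*u+m))" for u
    using X0 by algebra
  ultimately have "flat (\<lambda>e. ?f (q e) * (- 4 * ((m+2)*q e+m)))" by simp
  moreover have "(m+2)*x+m > 0" using m x by (simp add: add_pos_pos)
  ultimately have F: "flat (\<lambda>e. ?f (q e))"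
    by (elim flat_cancel) (auto intro!: derivative_intros pd simp: at0 algebra_simps)
  have "(2*(m+2)*(2*m+1)*x - m*(m\<^sup>2+2*m+3)) * x' = 0"
    by (rule flat_derivD[OF F], (rule derivative_eq_intros dq refl)+) (simp add: at0 algebra_simps)
  then have "x' = 0" using kite_double_root_free[OF m, of x] flat_valD[OF F] at0 by simp
  then have \<alpha>: "\<alpha> = 0" using nz x'_def by simp
  then have \<delta>: "\<delta> = - \<gamma>" using mp m by (simp add: add_eq_0_iff)
  have "x*Q' = 0" using v2 \<open>x' = 0\<close> by simp
  then have "\<gamma>*(d-c) = 0" using x \<delta> unfolding Q'_def by (simp add: algebra_simps)
  then show ?thesis using cd \<alpha> \<beta> \<delta> by simp
qed

text \<open>With the mirror axis through vortices 1 and 2, the equation of this pair gives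
  \<open>(1+2*m)*(q*y) = -1\<close>. The balance equation then reduces to the quadratic of
  \<open>kite_excluded\<close>, which has no admissible root.\<close>

lemma other_kite_impossible:
  fixes m a b c :: real
  assumes m: "0 < m" "m < 1" and nz: "c \<noteq> 0" and ab: "a \<noteq> b"
    and lt: "a*b < 1" "c\<^sup>2 < 1" and D1: "(1-a*c)*(1-b*c) \<noteq> 0"
    and sum0: "a + b + m*(c+c) = 0" 
    and f1: "(b - a) * pair_eq 1 m (a+b) (a*b) (c+c) (c*c) = 0"
    and f3: "balance_eq m (a+b) (a*b) (c+c) (c*c) = 0"
  shows False
proof -
  define p q y where "p = a+b" and "q = a*b" and "y = c\<^sup>2"
  have y: "0 < y" "y < 1" using nz lt y_def by auto
  have p: "p = - m*(2*c)" using sum0 p_def by simp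
  have e1: "pair_eq 1 m p q (2*c) y = 0" using f1 ab unfolding p_def q_def y_def by (simp add: power2_eq_square)
  have "pair_eq 1 m p q (2*c) y = (1-p*c+q*y)*(1+(1+2*m)*(q*y))"
    unfolding pair_eq_def cross_den_def p y_def by algebra
  moreover have "1-p*c+q*y \<noteq> 0" using D1 unfolding p_def q_def y_def by (simp add: algebra_simps power2_eq_square)
  ultimately have w: "1+(1+2*m)*(q*y) = 0" using e1 by simp
  have "2*c*((1-q)*(4*(1+m*y)*(q+m)*(1-y) - pair_eq m 1 (2*c) y p q)) = 0"
    using f3 e1 unfolding balance_eq_def p_def q_def y_def by (simp add: algebra_simps power2_eq_square)
  then have e3: "4*(1+m*y)*(q+m)*(1-y) = pair_eq m 1 (2*c) y p q" using nz lt unfolding q_def by simp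
  let ?f = "(1+2*m)*(2+m)*m*y\<^sup>2 - (1+2*m+3*m\<^sup>2)*y + 1"
  have "y*(1+2*m)^2*(4*(1+m*y)*(q+m)*(1-y) - pair_eq m 1 (2*c) y p q) = - 4*m*((1+2*m)*y+1) * ?f"
    using w unfolding pair_eq_def cross_den_def p y_def by algebra
  then have "((1+2*m)*y+1) * ?f = 0" using e3 m by simp
  moreover have "(1+2*m)*y+1 > 0" using m y by (simp add: add_pos_pos)
  ultimately show False using kite_excluded[OF m y] by simp
qed

text \<open>Distinct weights in both pairs make both \<open>pair_eq\<close> terms vanish to first
  order, so the balance equation reduces to its three factors. The factor \<open>P\<close> gives the
  trapezoids and \<open>q + m\<close> the asymmetric family.\<close>

lemma generic_rigid:
  fixes m a b c d \<alpha> \<beta> \<gamma> \<delta> :: real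
  assumes m: "0 < m" "m < 1" and nz: "a \<noteq> 0" "c \<noteq> 0" and ab: "a \<noteq> b" and cd: "c \<noteq> d"
    and lt: "a*b < 1" "c*d < 1" "a*c < 1" "b*c < 1" "a*d < 1" "b*d < 1"
    and sum0: "a + b + m*(c+d) = 0" and sum1: "\<alpha> + \<beta> + m*(\<gamma> + \<delta>) = 0"
  defines "p \<equiv> \<lambda>e. (a+e*\<alpha>) + (b+e*\<beta>)" and "q \<equiv> \<lambda>e. (a+e*\<alpha>) * (b+e*\<beta>)"
    and "P \<equiv> \<lambda>e. (c+e*\<gamma>) + (d+e*\<delta>)" and "Q \<equiv> \<lambda>e. (c+e*\<gamma>) * (d+e*\<delta>)"
  assumes f1: "flat (\<lambda>e. ((b+e*\<beta>) - (a+e*\<alpha>)) * pair_eq 1 m (p e) (q e) (P e) (Q e))"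
    and f2: "flat (\<lambda>e. ((d+e*\<delta>) - (c+e*\<gamma>)) * pair_eq m 1 (P e) (Q e) (p e) (q e))"
    and f3: "flat (\<lambda>e. balance_eq m (p e) (q e) (P e) (Q e))"
  shows "\<alpha> = 0 \<and> \<beta> = 0 \<and> \<gamma> = 0 \<and> \<delta> = 0"
proof -
  have pd: "p differentiable (at 0)" "q differentiable (at 0)" "P differentiable (at 0)" "Q differentiable (at 0)"
    unfolding p_def q_def P_def Q_def by (auto intro!: derivative_intros)
  have p: "p = (\<lambda>e. - m * P e)"
  proof
    fix e
    have "p e + m * P e = (a + b + m*(c+d)) + e*(\<alpha> + \<beta> + m*(\<gamma>+\<delta>))" unfolding p_def P_def by algebra
    also have "\<dots> = 0" using sum0 sum1 by simp
    finally show "p e = - m * P e" by simp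
  qed
  define P0 Q0 p0 q0 where "P0 = c+d" and "Q0 = c*d" and "p0 = a+b" and "q0 = a*b"
  have at0: "p 0 = p0" "q 0 = q0" "P 0 = P0" "Q 0 = Q0"
    unfolding p_def q_def P_def Q_def P0_def Q0_def p0_def q0_def by auto
  define q' Q' where "q' = a*\<beta> + b*\<alpha>" and "Q' = c*\<delta> + d*\<gamma>"
  have dp: "(p has_real_derivative \<alpha>+\<beta>) (at 0)" unfolding p_def by (rule derivative_eq_intros refl | simp)+
  have dq: "(q has_real_derivative q') (at 0)" unfolding q_def q'_def by (rule derivative_eq_intros refl | simp)+
  have dP: "(P has_real_derivative \<gamma>+\<delta>) (at 0)" unfolding P_def by (rule derivative_eq_intros refl | simp)+
  have dQ: "(Q has_real_derivative Q') (at 0)" unfolding Q_def Q'_def by (rule derivative_eq_intros refl | simp)+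
  have pp: "p0 = - m*P0" using sum0 unfolding p0_def P0_def by simp
  have E1: "flat (\<lambda>e. pair_eq 1 m (p e) (q e) (P e) (Q e))"
    by (rule flat_cancel_left[OF f1]) (use ab in \<open>auto intro!: derivative_intros pd\<close>)
  have E2: "flat (\<lambda>e. pair_eq m 1 (P e) (Q e) (p e) (q e))"
    by (rule flat_cancel_left[OF f2]) (use cd in \<open>auto intro!: derivative_intros pd\<close>)
  have D: "cross_den p0 q0 P0 Q0 > 0"
    unfolding p0_def q0_def P0_def Q0_def cross_den_eq using lt by simp
  have fin: ?thesis if "\<gamma>+\<delta> = 0" "q' = 0" "Q' = 0"
  proof -
    have \<delta>: "\<delta> = -\<gamma>" using that(1) by simp
    have \<beta>: "\<beta> = -\<alpha>" using that(1) sum1 by simp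
    have "\<alpha>*(b-a) = 0" using that(2) unfolding q'_def \<beta> by algebra
    moreover have "\<gamma>*(d-c) = 0" using that(3) unfolding Q'_def \<delta> by algebra
    ultimately show ?thesis using ab cd \<delta> \<beta> by simp
  qed
  have "flat (\<lambda>e. balance_eq m (p e) (q e) (P e) (Q e)
     - pair_eq 1 m (p e) (q e) (P e) (Q e) * (- P e*m*(1-Q e)) - pair_eq m 1 (P e) (Q e) (p e) (q e) * (- P e*(1-q e)))"
  proof (intro flat_diff f3)
    show "flat (\<lambda>e. pair_eq 1 m (p e) (q e) (P e) (Q e) * (- P e*m*(1-Q e)))"
      by (rule flat_mult[OF E1]) (auto intro!: derivative_intros pd)
    show "flat (\<lambda>e. pair_eq m 1 (P e) (Q e) (p e) (q e) * (- P e*(1-q e)))"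
      by (rule flat_mult[OF E2]) (auto intro!: derivative_intros pd)
  qed
  then have "flat (\<lambda>e. (P e * ((1+m*Q e)*(q e+m))) * (4*(1-q e)*(1-Q e)))"
    unfolding balance_eq_def by (simp add: algebra_simps)
  then have W: "flat (\<lambda>e. P e * ((1+m*Q e)*(q e+m)))"
    by (rule flat_cancel) (use lt in \<open>auto intro!: derivative_intros pd simp: at0 Q0_def q0_def\<close>)
  show ?thesis
  proof (cases "P0 = 0")
    case True
    define x y where "x = a\<^sup>2" and "y = c\<^sup>2"
    have "d = - c" using True P0_def by simp
    moreover have "b = - a" using pp True p0_def by simp
    ultimately have q0: "q0 = - x" and Q0: "Q0 = - y" unfolding q0_def Q0_def x_def y_def by (auto simp: power2_eq_square)
    have xy: "0 < x" "0 < y" using nz unfolding x_def y_def by auto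
    have p0: "p0 = 0" using pp True by simp
    define u where "u = 1 - x*y"
    have "\<bar>a*c\<bar> < 1" using lt \<open>d = - c\<close> by (simp add: abs_less_iff)
    then have "(a*c)\<^sup>2 < 1" by (simp add: abs_square_less_1)
    then have u: "u > 0" unfolding u_def x_def y_def by (simp add: power_mult_distrib)
    have "u * (u - 2*m*y*(1+x)) = 0"
      using flat_valD[OF E1] unfolding at0 p0 q0 Q0 True pair_eq_def cross_den_def u_def
      by (simp add: algebra_simps power2_eq_square)
    then have e1: "u = 2*m*y*(1+x)" using u by simp
    have "u * (m*u - 2*x*(1+y)) = 0"
      using flat_valD[OF E2] unfolding at0 p0 q0 Q0 True pair_eq_def cross_den_def u_def
      by (simp add: algebra_simps power2_eq_square)
    then have e2: "m*u = 2*x*(1+y)" using u by simp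
    \<comment> \<open>Either factor being zero would give \<open>u = 2*(1+x)\<close> or
      \<open>u = 2*(1+y)\<close>, whereas \<open>u = 1 - x*y\<close> is below 1.\<close>
    have w: "(1+m*(-y))*(-x+m) \<noteq> 0"
    proof
      assume "(1+m*(-y))*(-x+m) = 0"
      then consider "m*y = 1" | "x = m" by auto
      then show False
      proof cases
        case 1
        then have "u = 2*(1+x)" using e1 by algebra
        then show False using xy unfolding u_def by (smt (verit) mult_pos_pos)
      next
        case 2
        then have "m * (u - 2*(1+y)) = 0" using e2 by (simp add: algebra_simps)
        then have "u = 2*(1+y)" using m by simp
        then show False using xy unfolding u_def by (smt (verit) mult_pos_pos)
      qed
    qed
    have "((\<lambda>e. P e * ((1+m*Q e)*(q e+m))) has_real_derivative (\<gamma>+\<delta>)*((1+m*(-y))*(-x+m))) (at 0)"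
      by (rule derivative_eq_intros dP dQ dq refl)+ (simp add: at0 True Q0 q0)
    from flat_derivD[OF W this] have P': "\<gamma>+\<delta> = 0" using w by (simp only: mult_eq_0_iff) simp
    then have p': "\<alpha>+\<beta> = 0" using sum1 by simp
    have "2*u*(q'*y+x*Q') - 2*m*y*(1+x)*(q'*y+x*Q') + 2*m*(Q'*(1+x)+y*q')*u = 0"
      using flat_derivD[OF E1 pair_eq_DERIV[OF dp dq dP dQ at0]]
      unfolding p0 q0 Q0 True P' p' u_def by (simp add: algebra_simps power2_eq_square)
    then have "u * (- (q'*(-y) + (-x)*Q') + 2*m*Q'*(1+x) - 2*m*(-y)*q') = 0" using e1 by algebra
    then have 1: "- (q'*(-y) + (-x)*Q') + 2*m*Q'*(1+x) - 2*m*(-y)*q' = 0" using u by simp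
    have "2*m*u*(q'*y+x*Q') - 2*x*(1+y)*(q'*y+x*Q') + 2*(q'*(1+y)+x*Q')*u = 0"
      using flat_derivD[OF E2 pair_eq_DERIV[OF dP dQ dp dq at0(3) at0(4) at0(1) at0(2)]]
      unfolding p0 q0 Q0 True P' p' u_def by (simp add: algebra_simps power2_eq_square)
    then have "u * (- m*(q'*(-y) + (-x)*Q') + 2*q'*(1+y) - 2*(-x)*Q') = 0" using e2 by algebra
    then have 2: "- m*(q'*(-y) + (-x)*Q') + 2*q'*(1+y) - 2*(-x)*Q' = 0" using u by simp
    show ?thesis using fin P' trapezoid_nondegenerate[OF m(1) xy 1 2] by simp
  next
    case False
    have W': "flat (\<lambda>e. (1+m*Q e)*(q e+m))"
      by (rule flat_cancel_left[OF W]) (use False in \<open>auto intro!: derivative_intros pd simp: at0\<close>)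
    have "(a-b)\<^sup>2 > 0" using ab by simp
    then have disc: "4*q0 < p0\<^sup>2" unfolding q0_def p0_def by (simp add: power2_eq_square algebra_simps)
    have mQ: "1+m*Q0 \<noteq> 0"
      using asymmetric_excluded[OF m pp _ _ _ _ disc, of Q0] flat_valD[OF E1] flat_valD[OF E2] D unfolding at0 by auto
    have W'': "flat (\<lambda>e. q e+m)"
      by (rule flat_cancel_left[OF W']) (use mQ in \<open>auto intro!: derivative_intros pd simp: at0\<close>)
    have "q' = 0" by (rule flat_derivD[OF W'']) (rule derivative_eq_intros dq refl | simp)+
    moreover have "\<gamma>+\<delta> = 0 \<and> Q' = 0"
      using asymmetric_nondegenerate[OF m(1) p dP _ dQ _ _ _ E1 E2] dq \<open>q' = 0\<close> flat_valD[OF W''] False mQ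
      unfolding at0 by simp
    ultimately show ?thesis using fin by simp
  qed
qed

text \<open>Equal weights in a pair put the other two vortices at equal distances from both its
  members, so coincidences among the weights distinguish the symmetric families.\<close>

lemma weights_rigid:
  fixes m a b c d \<alpha> \<beta> \<gamma> \<delta> :: real
  assumes m: "0 < m" "m < 1" and nz: "a \<noteq> 0" "b \<noteq> 0" "c \<noteq> 0" "d \<noteq> 0"
    and lt: "a*b < 1" "c*d < 1" "a*c < 1" "b*c < 1" "a*d < 1" "b*d < 1"
    and sum0: "a + b + m*(c+d) = 0" and sum1: "\<alpha> + \<beta> + m*(\<gamma> + \<delta>) = 0"
    and f1: "flat (\<lambda>e. ((b+e*\<beta>) - (a+e*\<alpha>)) * pair_eq 1 m ((a+e*\<alpha>) + (b+e*\<beta>)) ((a+e*\<alpha>) * (b+e*\<beta>)) ((c+e*\<gamma>) + (d+e*\<delta>)) ((c+e*\<gamma>) * (d+e*\<delta>)))"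
    and f2: "flat (\<lambda>e. ((d+e*\<delta>) - (c+e*\<gamma>)) * pair_eq m 1 ((c+e*\<gamma>) + (d+e*\<delta>)) ((c+e*\<gamma>) * (d+e*\<delta>)) ((a+e*\<alpha>) + (b+e*\<beta>)) ((a+e*\<alpha>) * (b+e*\<beta>)))"
    and f3: "flat (\<lambda>e. balance_eq m ((a+e*\<alpha>) + (b+e*\<beta>)) ((a+e*\<alpha>) * (b+e*\<beta>)) ((c+e*\<gamma>) + (d+e*\<delta>)) ((c+e*\<gamma>) * (d+e*\<delta>)))"
  shows "\<alpha> = 0 \<and> \<beta> = 0 \<and> \<gamma> = 0 \<and> \<delta> = 0"
proof (cases "a = b")
  case ab: True
  show ?thesis
  proof (cases "c = d")
    case cd: True
    show ?thesis
      using rhombus_rigid[OF m nz(1), of c \<alpha> \<beta> \<gamma> \<delta>] lt sum0 sum1 f1 f2 f3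
      unfolding ab[symmetric] cd[symmetric] by (simp add: power2_eq_square)
  next
    case False
    show ?thesis
      using kite_rigid[OF m nz(1) False, of \<alpha> \<beta> \<gamma> \<delta>] lt sum0 sum1 f1 f2 f3
      unfolding ab[symmetric] by (simp add: power2_eq_square)
  qed
next
  case ab: False
  show ?thesis
  proof (cases "c = d")
    case cd: True
    show ?thesis
      using other_kite_impossible[OF m nz(3) ab] lt sum0 flat_valD[OF f1] flat_valD[OF f3]
      unfolding cd[symmetric] by (simp add: power2_eq_square)
  next
    case False
    show ?thesis
      using generic_rigid[OF m nz(1) nz(3) ab False lt sum0 sum1 f1 f2 f3] .
  qed
qed

section \<open>From squared distances to the polynomial equations\<close>

lemma weighted_side_DERIV:
  fixes a b \<alpha> \<beta> T S k :: real
  assumes "T*(1-a*b) = 1" "S = T\<^sup>2*(a*\<beta>+\<alpha>*b)"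
  shows "((\<lambda>e. k*(b+e*\<beta>)/(1-(a+e*\<alpha>)*(b+e*\<beta>))) has_real_derivative k*(\<beta>*T + b*S)) (at 0)"
proof -
  have nz: "1-a*b \<noteq> 0" using assms(1) by auto
  have T: "inverse (1-a*b) = T" using assms(1) by (simp add: inverse_unique mult.commute)
  have "((\<lambda>e. k*(b+e*\<beta>)) has_real_derivative k*\<beta>) (at 0)"
    by (rule derivative_eq_intros refl | simp)+
  moreover have "((\<lambda>e. 1-(a+e*\<alpha>)*(b+e*\<beta>)) has_real_derivative -(\<alpha>*b+a*\<beta>)) (at 0)"
    by (rule derivative_eq_intros refl | simp)+
  ultimately have "((\<lambda>e. k*(b+e*\<beta>)/(1-(a+e*\<alpha>)*(b+e*\<beta>))) has_real_derivative
     (k*\<beta>*(1-a*b) - k*b*(-(\<alpha>*b+a*\<beta>)))/((1-a*b)*(1-a*b))) (at 0)"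
    using DERIV_divide[of "\<lambda>e. k*(b+e*\<beta>)" "k*\<beta>" 0 UNIV "\<lambda>e. 1-(a+e*\<alpha>)*(b+e*\<beta>)"] nz by simp
  moreover have "(k*\<beta>*(1-a*b) - k*b*(-(\<alpha>*b+a*\<beta>)))/((1-a*b)*(1-a*b)) = k*(\<beta>*T + b*S)"
    unfolding divide_inverse inverse_mult_distrib T using assms by algebra
  ultimately show ?thesis by simp
qed

text \<open>\<open>T_ij\<close> is \<open>l * s_ij\<close> and \<open>S_ij\<close> its first
  variation. The groups \<open>g\<close> and \<open>g'\<close> say that the sum of
  \<open>A_j T_ij\<close> is independent of \<open>i\<close>, exactly and to first order;
  differences of these sums yield the three flat polynomial equations.\<close>

lemma sides_rigid:
  fixes m a b c d \<alpha> \<beta> \<gamma> \<delta> :: real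
  assumes m: "0 < m" "m < 1" and nz: "a \<noteq> 0" "b \<noteq> 0" "c \<noteq> 0" "d \<noteq> 0"
    and T: "T12*(1-a*b) = 1" "T34*(1-c*d) = 1" "T13*(1-a*c) = 1" "T23*(1-b*c) = 1" "T14*(1-a*d) = 1" "T24*(1-b*d) = 1"
    and Tp: "0 < T12" "0 < T34" "0 < T13" "0 < T23" "0 < T14" "0 < T24"
    and S: "S12 = T12\<^sup>2*(a*\<beta>+\<alpha>*b)" "S34 = T34\<^sup>2*(c*\<delta>+\<gamma>*d)" "S13 = T13\<^sup>2*(a*\<gamma>+\<alpha>*c)"
       "S23 = T23\<^sup>2*(b*\<gamma>+\<beta>*c)" "S14 = T14\<^sup>2*(a*\<delta>+\<alpha>*d)" "S24 = T24\<^sup>2*(b*\<delta>+\<beta>*d)"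
    and sum0: "a + b + m*(c+d) = 0" and sum1: "\<alpha> + \<beta> + m*(\<gamma> + \<delta>) = 0"
    and g: "b*T12 + m*c*T13 + m*d*T14 = g" "a*T12 + m*c*T23 + m*d*T24 = g"
       "m*d*T34 + a*T13 + b*T23 = g" "m*c*T34 + a*T14 + b*T24 = g"
    and g': "(\<beta>*T12 + b*S12) + m*(\<gamma>*T13 + c*S13) + m*(\<delta>*T14 + d*S14) = g'"
       "(\<alpha>*T12 + a*S12) + m*(\<gamma>*T23 + c*S23) + m*(\<delta>*T24 + d*S24) = g'"
       "m*(\<delta>*T34 + d*S34) + (\<alpha>*T13 + a*S13) + (\<beta>*T23 + b*S23) = g'"
       "m*(\<gamma>*T34 + c*S34) + (\<alpha>*T14 + a*S14) + (\<beta>*T24 + b*S24) = g'"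
  shows "\<alpha> = 0 \<and> \<beta> = 0 \<and> \<gamma> = 0 \<and> \<delta> = 0"
proof -
  define A B C D where "A = (\<lambda>e. a+e*\<alpha>)" and "B = (\<lambda>e. b+e*\<beta>)" and "C = (\<lambda>e. c+e*\<gamma>)" and "D = (\<lambda>e. d+e*\<delta>)"
  note ABCD = A_def B_def C_def D_def
  have lt: "a*b < 1" "c*d < 1" "a*c < 1" "b*c < 1" "a*d < 1" "b*d < 1"
    using T Tp by (smt (verit) mult_nonneg_nonpos)+
  have T': "T12 = 1/(1-a*b)" "T34 = 1/(1-c*d)" "T13 = 1/(1-a*c)" "T23 = 1/(1-b*c)" "T14 = 1/(1-a*d)" "T24 = 1/(1-b*d)"
    using T lt by (auto simp: field_simps)
  define G1 where "G1 = (\<lambda>e. 1*B e/(1-A e*B e) + m*C e/(1-A e*C e) + m*D e/(1-A e*D e))"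
  define G2 where "G2 = (\<lambda>e. 1*A e/(1-A e*B e) + m*C e/(1-B e*C e) + m*D e/(1-B e*D e))"
  define G3 where "G3 = (\<lambda>e. m*D e/(1-C e*D e) + 1*A e/(1-A e*C e) + 1*B e/(1-B e*C e))"
  define G4 where "G4 = (\<lambda>e. m*C e/(1-C e*D e) + 1*A e/(1-A e*D e) + 1*B e/(1-B e*D e))"
  have comm: "1-x*y = 1-y*x" for x y :: real by simp
  have Sc: "S12 = T12\<^sup>2*(b*\<alpha>+\<beta>*a)" "S34 = T34\<^sup>2*(d*\<gamma>+\<delta>*c)" "S13 = T13\<^sup>2*(c*\<alpha>+\<gamma>*a)"
       "S23 = T23\<^sup>2*(c*\<beta>+\<gamma>*b)" "S14 = T14\<^sup>2*(d*\<alpha>+\<delta>*a)" "S24 = T24\<^sup>2*(d*\<beta>+\<delta>*b)"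
    using S by (simp_all add: algebra_simps)
  have Tc: "T12*(1-b*a) = 1" "T34*(1-d*c) = 1" "T13*(1-c*a) = 1" "T23*(1-c*b) = 1" "T14*(1-d*a) = 1" "T24*(1-d*b) = 1"
    using T by (simp_all add: mult.commute)
  have v: "G1 0 = g" "G2 0 = g" "G3 0 = g" "G4 0 = g"
    unfolding G1_def G2_def G3_def G4_def ABCD using g unfolding T' by auto
  have d1: "(G1 has_real_derivative g') (at 0)"
    using DERIV_add[OF DERIV_add[OF weighted_side_DERIV[OF T(1) S(1), of 1] weighted_side_DERIV[OF T(3) S(3), of m]] weighted_side_DERIV[OF T(5) S(5), of m]]
    using g' unfolding G1_def ABCD by simp
  have d2: "(G2 has_real_derivative g') (at 0)"
    using DERIV_add[OF DERIV_add[OF weighted_side_DERIV[OF Tc(1) Sc(1), of 1] weighted_side_DERIV[OF T(4) S(4), of m]] weighted_side_DERIV[OF T(6) S(6), of m]]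
    using g' unfolding G2_def ABCD by (simp add: comm[of "b+_" "a+_"])
  have d3: "(G3 has_real_derivative g') (at 0)"
    using DERIV_add[OF DERIV_add[OF weighted_side_DERIV[OF T(2) S(2), of m] weighted_side_DERIV[OF Tc(3) Sc(3), of 1]] weighted_side_DERIV[OF Tc(4) Sc(4), of 1]]
    using g' unfolding G3_def ABCD by (simp add: comm[of "c+_" "a+_"] comm[of "c+_" "b+_"])
  have d4: "(G4 has_real_derivative g') (at 0)"
    using DERIV_add[OF DERIV_add[OF weighted_side_DERIV[OF Tc(2) Sc(2), of m] weighted_side_DERIV[OF Tc(5) Sc(5), of 1]] weighted_side_DERIV[OF Tc(6) Sc(6), of 1]]
    using g' unfolding G4_def ABCD by (simp add: comm[of "d+_" "c+_"] comm[of "d+_" "a+_"] comm[of "d+_" "b+_"])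
  have F12: "flat (\<lambda>e. G1 e - G2 e)" and F34: "flat (\<lambda>e. G3 e - G4 e)" and F: "flat (\<lambda>e. G1 e + G2 e - G3 e - G4 e)"
    unfolding flat_def using v d1 d2 d3 d4 by (auto intro!: derivative_eq_intros)
  have "\<forall>\<^sub>F e in nhds 0. X e * Y e \<noteq> 1"
    if "X \<in> {A,B,C,D}" "Y \<in> {A,B,C,D}" "X 0 * Y 0 < 1" for X Y
  proof -
    have "isCont (\<lambda>e. X e * Y e) 0" using that unfolding ABCD by (auto intro!: continuous_intros)
    then have "((\<lambda>e. X e * Y e) \<longlongrightarrow> X 0 * Y 0) (nhds 0)" by (simp add: continuous_at tendsto_nhds_iff)
    from order_tendstoD(2)[OF this that(3)] show ?thesis by (rule eventually_mono) auto
  qed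
  note ev = this
  \<comment> \<open>The denominators are known to be nonzero only near 0, which suffices because
    flatness is a local property.\<close>
  have ev: "\<forall>\<^sub>F e in nhds 0. A e * B e \<noteq> 1 \<and> C e * D e \<noteq> 1 \<and> A e * C e \<noteq> 1 \<and> B e * C e \<noteq> 1 \<and> A e * D e \<noteq> 1 \<and> B e * D e \<noteq> 1"
    by (intro eventually_conj ev) (use lt in \<open>auto simp: ABCD\<close>)
  let ?p = "\<lambda>e. A e + B e" and ?q = "\<lambda>e. A e * B e" and ?P = "\<lambda>e. C e + D e" and ?Q = "\<lambda>e. C e * D e"
  have AD: "A differentiable (at 0)" "B differentiable (at 0)" "C differentiable (at 0)" "D differentiable (at 0)"
    unfolding ABCD by (auto intro!: derivative_intros)
  have cdif: "(\<lambda>e. cross_den (?p e) (?q e) (?P e) (?Q e)) differentiable (at 0)"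
     "(\<lambda>e. cross_den (?P e) (?Q e) (?p e) (?q e)) differentiable (at 0)"
    unfolding cross_den_def by (auto intro!: derivative_intros AD)
  have f1: "flat (\<lambda>e. (B e - A e) * pair_eq 1 m (?p e) (?q e) (?P e) (?Q e))"
  proof (rule flat_cong)
    show "flat (\<lambda>e. (G1 e - G2 e) * ((1-A e*B e) * cross_den (?p e) (?q e) (?P e) (?Q e)))"
      by (rule flat_mult[OF F12]) (auto intro!: derivative_intros AD cdif)
    show "\<forall>\<^sub>F e in nhds 0. (B e - A e) * pair_eq 1 m (?p e) (?q e) (?P e) (?Q e)
        = (G1 e - G2 e) * ((1-A e*B e) * cross_den (?p e) (?q e) (?P e) (?Q e))"
      using ev
    proof eventually_elim
      case (elim e)
      then show ?case using pair_diff[of "A e" "B e" "C e" "D e" 1 m] unfolding G1_def G2_def by simp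
    qed
  qed
  have f2: "flat (\<lambda>e. (D e - C e) * pair_eq m 1 (?P e) (?Q e) (?p e) (?q e))"
  proof (rule flat_cong)
    show "flat (\<lambda>e. (G3 e - G4 e) * ((1-C e*D e) * cross_den (?P e) (?Q e) (?p e) (?q e)))"
      by (rule flat_mult[OF F34]) (auto intro!: derivative_intros AD cdif)
    show "\<forall>\<^sub>F e in nhds 0. (D e - C e) * pair_eq m 1 (?P e) (?Q e) (?p e) (?q e)
        = (G3 e - G4 e) * ((1-C e*D e) * cross_den (?P e) (?Q e) (?p e) (?q e))"
      using ev
    proof eventually_elim
      case (elim e)
      then show ?case using pair_diff[of "C e" "D e" "A e" "B e" m 1]
        unfolding G3_def G4_def by (simp add: mult.commute[of "A e" "C e"] mult.commute[of "B e" "C e"] mult.commute[of "A e" "D e"] mult.commute[of "B e" "D e"])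
    qed
  qed
  have f3: "flat (\<lambda>e. balance_eq m (?p e) (?q e) (?P e) (?Q e))"
  proof (rule flat_cong)
    show "flat (\<lambda>e. (G1 e + G2 e - G3 e - G4 e) * ((1-?q e) * (1-?Q e) * cross_den (?p e) (?q e) (?P e) (?Q e)))"
      by (rule flat_mult[OF F]) (auto intro!: derivative_intros AD cdif)
    show "\<forall>\<^sub>F e in nhds 0. balance_eq m (?p e) (?q e) (?P e) (?Q e)
        = (G1 e + G2 e - G3 e - G4 e) * ((1-?q e) * (1-?Q e) * cross_den (?p e) (?q e) (?P e) (?Q e))"
      using ev
    proof eventually_elim
      case (elim e)
      have "A e + B e + m*(C e + D e) = (a + b + m*(c+d)) + e*(\<alpha> + \<beta> + m*(\<gamma> + \<delta>))"
        unfolding ABCD by algebra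
      then have "A e + B e + m*(C e + D e) = 0" using sum0 sum1 by simp
      then show ?case using balance_diff[of "A e" "B e" "C e" "D e" m] elim
        unfolding G1_def G2_def G3_def G4_def balance_eq_def by simp
    qed
  qed
  show ?thesis
    using weights_rigid[OF m nz lt sum0 sum1 f1[unfolded ABCD] f2[unfolded ABCD] f3[unfolded ABCD]] .
qed

text \<open>The case \<open>k > 0\<close>. All terms in the pair equations now have one sign, which
  forces \<open>a = b\<close> and \<open>c = d\<close>. The balance equation becomes
  \<open>4*T13 = T12 + T34\<close>, but \<open>T13\<close> is at least 1 while \<open>T12\<close>
  and \<open>T34\<close> are at most 1.\<close>

lemma sign_excluded:
  fixes m a b c d :: real
  assumes m: "0 < m" and nz: "c \<noteq> 0"
    and T: "T12*(1+a*b) = 1" "T34*(1+c*d) = 1" "T13*(1+a*c) = 1" "T23*(1+b*c) = 1" "T14*(1+a*d) = 1" "T24*(1+b*d) = 1"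
    and Tp: "0 < T12" "0 < T34" "0 < T13" "0 < T23" "0 < T14" "0 < T24"
    and sum0: "a + b + m*(c+d) = 0"
    and g: "b*T12 + m*c*T13 + m*d*T14 = g" "a*T12 + m*c*T23 + m*d*T24 = g"
       "m*d*T34 + a*T13 + b*T23 = g" "m*c*T34 + a*T14 + b*T24 = g"
  shows False
proof -
  have ab: "(b-a)*(T12 + m*c\<^sup>2*(T13*T23) + m*d\<^sup>2*(T14*T24)) = 0"
  proof -
    have "T13 - T23 = T13*T23*(c*(b-a))" using T(3,4) by algebra
    moreover have "T14 - T24 = T14*T24*(d*(b-a))" using T(5,6) by algebra
    ultimately show ?thesis using g(1,2) by algebra
  qed
  have "T12 + m*c\<^sup>2*(T13*T23) + m*d\<^sup>2*(T14*T24) > 0" using Tp m by (simp add: add_pos_nonneg)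
  then have ab: "b = a" using ab by (metis less_irrefl mult_eq_0_iff right_minus_eq)
  have cd: "(d-c)*(m*T34 + a\<^sup>2*(T13*T14) + b\<^sup>2*(T23*T24)) = 0"
  proof -
    have "T13 - T14 = T13*T14*(a*(d-c))" using T(3,5) by algebra
    moreover have "T23 - T24 = T23*T24*(b*(d-c))" using T(4,6) by algebra
    ultimately show ?thesis using g(3,4) by algebra
  qed
  have "m*T34 + a\<^sup>2*(T13*T14) + b\<^sup>2*(T23*T24) > 0" using Tp m by (simp add: add_pos_nonneg)
  then have cd: "d = c" using cd by (metis less_irrefl mult_eq_0_iff right_minus_eq)
  have a: "a = - m*c" using sum0 unfolding ab cd by simp
  have "1 + a*c \<noteq> 0" using T(3) by auto
  have e: "T23 = T13" "T14 = T13" "T24 = T13"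
    using T(3-6) \<open>1 + a*c \<noteq> 0\<close> unfolding ab cd by (metis mult_cancel_right)+
  have "m*c*(4*T13 - T12 - T34) = 0" using g(1,3) unfolding ab cd e a by (simp add: algebra_simps)
  then have k: "4*T13 = T12 + T34" using m nz by simp
  have "T12 = 1 - T12*a\<^sup>2" "T34 = 1 - T34*c\<^sup>2" "T13 = 1 + T13*(m*c\<^sup>2)" using T(1-3) unfolding ab cd a by algebra+
  moreover have "T12*a\<^sup>2 \<ge> 0" "T34*c\<^sup>2 \<ge> 0" "T13*(m*c\<^sup>2) \<ge> 0" using Tp m by auto
  ultimately show False using k by linarith
qed

section \<open>Non-collinear configurations\<close>

text \<open>
  Applied to \<open>1/(l s\<^sub>i\<^sub>j) - 1\<close> and to the difference between its first variation and that of
  \<open>k a\<^sub>i a\<^sub>j\<close>, which solves the same linear system.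
\<close>

lemma dependency_rank_one:
  fixes m :: real
  assumes m: "m \<noteq> 0" and nz: "a1 \<noteq> 0" "a2 \<noteq> 0" "a3 \<noteq> 0" "a4 \<noteq> 0"
    and dep: "y4 = m*a3" "y3 = - m*a4" "a2 = y3*x4 - y4*x3" "a1 = y3 - y4 - a2"
    and ne: "x3 \<noteq> x4 \<or> y3 \<noteq> y4"
    and E1: "e12 + m*(e13*x3) + m*(e14*x4) = 0" "e13*y3 + e14*y4 = 0"
    and E2: "e12 + m*(e23*(1-x3)) + m*(e24*(1-x4)) = 0" "e23*y3 + e24*y4 = 0"
    and E3: "e13*x3 + e23*(x3-1) + m*(e34*(x3-x4)) = 0" "(e13+e23)*y3 + m*(e34*(y3-y4)) = 0"
  shows "\<exists>k. e12 = k*(a1*a2) \<and> e13 = k*(a1*a3) \<and> e14 = k*(a1*a4) \<and> e23 = k*(a2*a3)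
           \<and> e24 = k*(a2*a4) \<and> e34 = k*(a3*a4)"
proof -
  \<comment> \<open>The equations of vortex 1 fix its row up to a factor \<open>k\<close>, those of
    vortex 2 its row up to a factor \<open>l\<close>; the shared entry \<open>e12\<close> identifies
    the two factors.\<close>
  define k where "k = e13/(a1*a3)"
  have e13: "e13 = k*(a1*a3)" using nz unfolding k_def by simp
  have "m*a3*(e14 - k*(a1*a4)) = 0" using E1(2) e13 dep(1,2) by algebra
  then have e14: "e14 = k*(a1*a4)" using m nz by simp
  have e12: "e12 = k*(a1*a2)" using E1(1) unfolding e13 e14 dep(3) dep(1,2) by algebra
  define l where "l = e23/(a2*a3)"
  have e23: "e23 = l*(a2*a3)" using nz unfolding l_def by simp
  have "m*a3*(e24 - l*(a2*a4)) = 0" using E2(2) e23 dep(1,2) by algebra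
  then have e24: "e24 = l*(a2*a4)" using m nz by simp
  have "e12 = l*(a1*a2)" using E2(1) unfolding e23 e24 dep(4) dep(3) dep(1,2) by algebra
  then have l: "l = k" using e12 nz by simp
  have "m*((x3-x4)*(e34 - k*(a3*a4))) = 0" using E3(1) unfolding e13 e23 l dep(4) dep(3) dep(1,2) by algebra
  moreover have "m*((y3-y4)*(e34 - k*(a3*a4))) = 0" using E3(2) unfolding e13 e23 l dep(4) dep(3) dep(1,2) by algebra
  ultimately have "e34 = k*(a3*a4)" using m ne by auto
  then show ?thesis using e12 e13 e14 e23 e24 l by blast
qed

text \<open>If vortices 1, 2, 3 were collinear and 4 off their line, the transverse equations would
  give \<open>U14 = U24 = U34 = 0\<close>. Vortex 4 would then be equidistant from three distinct
  points of a line.\<close>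

lemma y3_nonzero:
  fixes l m :: real
  assumes m: "m \<noteq> 0" and U: "(1+U14)*(l*(x4\<^sup>2+y4\<^sup>2)) = 1" "(1+U24)*(l*((x4-1)\<^sup>2+y4\<^sup>2)) = 1"
      "(1+U34)*(l*((x3-x4)\<^sup>2+(y3-y4)\<^sup>2)) = 1"
    and col: "x3 \<noteq> 0 \<or> y3 \<noteq> 0" "x3 \<noteq> 1 \<or> y3 \<noteq> 0" and ncol: "y3 \<noteq> 0 \<or> y4 \<noteq> 0"
    and E: "U13*y3 + U14*y4 = 0" "U23*y3 + U24*y4 = 0" "(U13+U23)*y3 + m*(U34*(y3-y4)) = 0"
  shows "y3 \<noteq> 0"
proof
  assume y3: "y3 = 0"
  then have "y4 \<noteq> 0" using ncol by simp
  then have z: "U14 = 0" "U24 = 0" "U34 = 0" using E y3 m by auto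
  then have "l \<noteq> 0" using U by auto
  have "l*(x4\<^sup>2+y4\<^sup>2) = l*((x4-1)\<^sup>2+y4\<^sup>2)" "l*((x3-x4)\<^sup>2+y4\<^sup>2) = l*(x4\<^sup>2 + y4\<^sup>2)"
    using U unfolding z y3 by auto
  then have "x4\<^sup>2+y4\<^sup>2 = (x4-1)\<^sup>2+y4\<^sup>2" "(x3-x4)\<^sup>2+y4\<^sup>2 = x4\<^sup>2 + y4\<^sup>2"
    using \<open>l \<noteq> 0\<close> by (metis mult_left_cancel)+
  then have "2*x4 = 1" "x3*(x3 - 2*x4) = 0" by (auto simp: power2_eq_square algebra_simps)
  then show False using col y3 by auto
qed

text \<open>The expression vanishes exactly if vortices 1, 3, 4 are collinear. Then
  \<open>U12\<close>, \<open>U23\<close> and \<open>U24\<close> are zero, and vortex 2 would be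
  equidistant from three distinct points of a line.\<close>

lemma a2_nonzero:
  fixes l m :: real
  assumes m: "m \<noteq> 0" and U: "(1+U12)*l = 1" "(1+U23)*(l*((x3-1)\<^sup>2+y3\<^sup>2)) = 1" "(1+U24)*(l*((x4-1)\<^sup>2+y4\<^sup>2)) = 1"
    and y: "y3 \<noteq> 0" "y4 \<noteq> 0" and ne: "x3 \<noteq> x4 \<or> y3 \<noteq> y4"
    and E1: "U12 + m*(U13*x3) + m*(U14*x4) = 0" "U13*y3 + U14*y4 = 0"
    and E2: "U12 + m*(U23*(1-x3)) + m*(U24*(1-x4)) = 0" "U23*y3 + U24*y4 = 0"
  shows "y3*x4 - y4*x3 \<noteq> 0"
proof
  assume z: "y3*x4 - y4*x3 = 0"
  have "y4*U12 = 0" using z E1 m by algebra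
  then have U12: "U12 = 0" using y by simp
  have "m*U23*(y4-y3) = 0" using z E2 U12 by algebra
  moreover have "y3 \<noteq> y4" using z ne y by (auto simp: algebra_simps)
  ultimately have U23: "U23 = 0" using m by simp
  then have U24: "U24 = 0" using E2 y by simp
  have l: "l = 1" "(x3-1)\<^sup>2+y3\<^sup>2 = 1" "(x4-1)\<^sup>2+y4\<^sup>2 = 1" using U unfolding U12 U23 U24 by auto
  define t where "t = y3/y4"
  have t: "y3 = t*y4" "x3 = t*x4" using z y unfolding t_def by (auto simp: field_simps)
  have "t \<noteq> 0" using t y by auto
  have "t*((t-1)*(x4\<^sup>2+y4\<^sup>2)) = 0" using l(2,3) unfolding t by algebra
  then have "t = 1" using \<open>t \<noteq> 0\<close> y by (simp add: add_nonneg_eq_0_iff)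
  then show False using t \<open>y3 \<noteq> y4\<close> by simp
qed

lemma noncollinear_nondegenerate:
  fixes l m :: real
  assumes m: "0 < m" "m < 1" and l: "0 < l"
    and pos: "0 < s13" "0 < s14" "0 < s23" "0 < s24" "0 < s34"
    and s: "s13 = x3\<^sup>2+y3\<^sup>2" "s14 = x4\<^sup>2+y4\<^sup>2" "s23 = (x3-1)\<^sup>2+y3\<^sup>2" "s24 = (x4-1)\<^sup>2+y4\<^sup>2"
      "s34 = (x3-x4)\<^sup>2+(y3-y4)\<^sup>2"
    and s': "s13' = 2*(x3*u3+y3* v3)" "s14' = 2*(x4*u4+y4* v4)" "s23' = 2*((x3-1)*u3+y3* v3)"
      "s24' = 2*((x4-1)*u4+y4* v4)" "s34' = 2*((x3-x4)*(u3-u4)+(y3-y4)*(v3-v4))"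
    and U: "(1+U12)*l = 1" "(1+U13)*(l* s13) = 1" "(1+U14)*(l* s14) = 1" "(1+U23)*(l* s23) = 1"
      "(1+U24)*(l* s24) = 1" "(1+U34)*(l* s34) = 1"
    and U': "l' = - l\<^sup>2*U12'" "l* s13'+l'* s13 = -(l* s13)\<^sup>2*U13'" "l* s14'+l'* s14 = -(l* s14)\<^sup>2*U14'"
      "l* s23'+l'* s23 = -(l* s23)\<^sup>2*U23'" "l* s24'+l'* s24 = -(l* s24)\<^sup>2*U24'" "l* s34'+l'* s34 = -(l* s34)\<^sup>2*U34'"
    and E1: "U12 + m*(U13*x3) + m*(U14*x4) = 0" "U13*y3 + U14*y4 = 0"
    and E2: "U12 + m*(U23*(1-x3)) + m*(U24*(1-x4)) = 0" "U23*y3 + U24*y4 = 0"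
    and E3: "U13*x3 + U23*(x3-1) + m*(U34*(x3-x4)) = 0" "(U13+U23)*y3 + m*(U34*(y3-y4)) = 0"
    and E4: "(U14+U24)*y4 + m*(U34*(y4-y3)) = 0"
    and E1': "U12' + m*(U13'*x3+U13*u3) + m*(U14'*x4+U14*u4) = 0" "U13'*y3+U13* v3 + U14'*y4+U14* v4 = 0"
    and E2': "U12' + m*(U23'*(1-x3)-U23*u3) + m*(U24'*(1-x4)-U24*u4) = 0" "U23'*y3+U23* v3 + U24'*y4+U24* v4 = 0"
    and E3': "U13'*x3+U13*u3 + U23'*(x3-1)+U23*u3 + m*(U34'*(x3-x4)+U34*(u3-u4)) = 0"
      "(U13'+U23')*y3+(U13+U23)* v3 + m*(U34'*(y3-y4)+U34*(v3-v4)) = 0"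
    and ncol: "y3 \<noteq> 0 \<or> y4 \<noteq> 0"
  shows "u3 = 0 \<and> v3 = 0 \<and> u4 = 0 \<and> v4 = 0"
proof -
  have m0: "m \<noteq> 0" using m by simp
  have y3: "y3 \<noteq> 0"
    by (rule y3_nonzero[OF m0 U(3)[unfolded s] U(5)[unfolded s] U(6)[unfolded s] _ _ ncol E1(2) E2(2) E3(2)])
      (use pos s in auto)
  have y4: "y4 \<noteq> 0"
    by (rule y3_nonzero[OF m0 U(2)[unfolded s] U(4)[unfolded s], of U34 x4 y4 U14 U24])
      (use U(6) pos s ncol E1(2) E2(2) E4 in \<open>auto simp: add.commute power2_commute\<close>)
  have ne: "x3 \<noteq> x4 \<or> y3 \<noteq> y4" using pos s by auto
  \<comment> \<open>The coefficients \<open>a1, a2, m*a3, m*a4\<close> are the affine dependency of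
    the points (0,0), (1,0), (x3,y3), (x4,y4).\<close>
  define a2 where "a2 = y3*x4 - y4*x3"
  define a1 where "a1 = y3 - y4 - a2"
  define a3 a4 where "a3 = y4/m" and "a4 = - y3/m"
  have ma: "y4 = m*a3" "y3 = - m*a4" unfolding a3_def a4_def using m by auto
  have a2: "a2 \<noteq> 0" unfolding a2_def
    by (rule a2_nonzero[OF m0 U(1) U(4)[unfolded s] U(5)[unfolded s] y3 y4 ne E1 E2])
  have a1: "a1 \<noteq> 0"
  proof -
    \<comment> \<open>The reflection that sends \<open>x\<close> to \<open>1 - x\<close> exchanges
      vortices 1 and 2 and turns \<open>a2\<close> into \<open>a1\<close>.\<close>
    have "y3*(1-x4) - y4*(1-x3) \<noteq> 0"
      by (rule a2_nonzero[OF m0 U(1), of U13 "1-x3" y3 U14 "1-x4" y4 U23 U24])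
        (use U(2,3) y3 y4 ne E1 E2 in \<open>auto simp: s\<close>)
    then show ?thesis unfolding a1_def a2_def by (simp add: algebra_simps)
  qed
  have a34: "a3 \<noteq> 0" "a4 \<noteq> 0" using y3 y4 m unfolding a3_def a4_def by auto
  obtain k where k: "U12 = k*(a1*a2)" "U13 = k*(a1*a3)" "U14 = k*(a1*a4)" "U23 = k*(a2*a3)" "U24 = k*(a2*a4)" "U34 = k*(a3*a4)"
    using dependency_rank_one[OF m0 a1 a2 a34 ma a2_def a1_def ne E1 E2 E3] by blast
  \<comment> \<open>The \<open>b_i\<close> are the first variations of the weights
    \<open>a_i\<close>.\<close>
  define b2 where "b2 = v3*x4 + y3*u4 - v4*x3 - y4*u3"
  define b1 where "b1 = v3 - v4 - b2"
  define b3 b4 where "b3 = v4/m" and "b4 = - v3/m"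
  have mb: "v4 = m*b3" "v3 = - m*b4" unfolding b3_def b4_def using m by auto
  obtain k' where k': "U12' - k*(b1*a2+a1*b2) = k'*(a1*a2)" "U13' - k*(b1*a3+a1*b3) = k'*(a1*a3)"
      "U14' - k*(b1*a4+a1*b4) = k'*(a1*a4)" "U23' - k*(b2*a3+a2*b3) = k'*(a2*a3)"
      "U24' - k*(b2*a4+a2*b4) = k'*(a2*a4)" "U34' - k*(b3*a4+a3*b4) = k'*(a3*a4)"
  proof -
    have "\<exists>k'. U12' - k*(b1*a2+a1*b2) = k'*(a1*a2) \<and> U13' - k*(b1*a3+a1*b3) = k'*(a1*a3) \<and> 
      U14' - k*(b1*a4+a1*b4) = k'*(a1*a4) \<and> U23' - k*(b2*a3+a2*b3) = k'*(a2*a3) \<and> 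
      U24' - k*(b2*a4+a2*b4) = k'*(a2*a4) \<and> U34' - k*(b3*a4+a3*b4) = k'*(a3*a4)"
    proof (rule dependency_rank_one[OF m0 a1 a2 a34 ma a2_def a1_def ne])
      show "U12' - k*(b1*a2+a1*b2) + m*((U13' - k*(b1*a3+a1*b3))*x3) + m*((U14' - k*(b1*a4+a1*b4))*x4) = 0"
        using E1'(1) unfolding k a1_def a2_def b1_def b2_def ma mb by algebra
      show "(U13' - k*(b1*a3+a1*b3))*y3 + (U14' - k*(b1*a4+a1*b4))*y4 = 0"
        using E1'(2) unfolding k ma mb by algebra
      show "U12' - k*(b1*a2+a1*b2) + m*((U23' - k*(b2*a3+a2*b3))*(1-x3)) + m*((U24' - k*(b2*a4+a2*b4))*(1-x4)) = 0"
        using E2'(1) unfolding k a1_def a2_def b1_def b2_def ma mb by algebra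
      show "(U23' - k*(b2*a3+a2*b3))*y3 + (U24' - k*(b2*a4+a2*b4))*y4 = 0"
        using E2'(2) unfolding k ma mb by algebra
      show "(U13' - k*(b1*a3+a1*b3))*x3 + (U23' - k*(b2*a3+a2*b3))*(x3-1) + m*((U34' - k*(b3*a4+a3*b4))*(x3-x4)) = 0"
        using E3'(1) unfolding k a1_def a2_def b1_def b2_def ma mb by algebra
      show "((U13' - k*(b1*a3+a1*b3)) + (U23' - k*(b2*a3+a2*b3)))*y3 + m*((U34' - k*(b3*a4+a3*b4))*(y3-y4)) = 0"
        using E3'(2) unfolding k a1_def a2_def b1_def b2_def ma mb by algebra
    qed
    then show ?thesis using that by blast
  qed
  have sum: "a1 + a2 + m*(a3+a4) = 0" unfolding a1_def using ma by (simp add: algebra_simps)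
  have sum': "b1 + b2 + m*(b3+b4) = 0" unfolding b1_def using mb by (simp add: algebra_simps)
  define g where "g = a2 + m*a3* s13 + m*a4* s14"
  have g: "a1 + m*a3* s23 + m*a4* s24 = g" "m*a4* s34 + a1* s13 + a2* s23 = g" "m*a3* s34 + a1* s14 + a2* s24 = g"
    unfolding g_def s a1_def a2_def ma by algebra+
  define g' where "g' = b2 + m*(b3* s13+a3* s13') + m*(b4* s14+a4* s14')"
  have g': "b1 + m*(b3* s23+a3* s23') + m*(b4* s24+a4* s24') = g'"
     "m*(b4* s34+a4* s34') + (b1* s13+a1* s13') + (b2* s23+a2* s23') = g'"
     "m*(b3* s34+a3* s34') + (b1* s14+a1* s14') + (b2* s24+a2* s24') = g'"
    unfolding g'_def s s' a1_def a2_def b1_def b2_def ma mb by algebra+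
  have lpos: "0 < l* s13" "0 < l* s14" "0 < l* s23" "0 < l* s24" "0 < l* s34" using l pos by auto
  consider "k = 0" | "k > 0" | "k < 0" by linarith
  then show ?thesis
  proof cases
    case 1
    \<comment> \<open>Four points of the plane would be pairwise equidistant; the heights
      \<open>y3\<close> and \<open>y4\<close> contradict this.\<close>
    then have "l = 1" "s13 = 1" "s14 = 1" "s23 = 1" "s24 = 1" "s34 = 1" using U unfolding k by auto
    then have "2*x3 = 1" "2*x4 = 1" using s by (auto simp: power2_eq_square algebra_simps)
    then have x: "x3 = 1/2" "x4 = 1/2" by auto
    have "y3\<^sup>2 = 3/4" "y4\<^sup>2 = 3/4" "(y3-y4)\<^sup>2 = 1"
      using s(1,2,5) unfolding x \<open>s13 = 1\<close> \<open>s14 = 1\<close> \<open>s34 = 1\<close> by (simp_all add: power2_eq_square)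
    then have p: "y3*y4 = 1/4" by (simp add: power2_eq_square algebra_simps)
    have "(y3*y4)\<^sup>2 = 1/16" unfolding p by (simp add: power2_eq_square)
    then show ?thesis using \<open>y3\<^sup>2 = 3/4\<close> \<open>y4\<^sup>2 = 3/4\<close> by (simp add: power_mult_distrib)
  next
    case 2
    define r where "r = sqrt k"
    have r: "r*r = k" using 2 r_def by simp
    have "r \<noteq> 0" using 2 r by auto
    have "False"
    proof (rule sign_excluded[of m "r*a3" l "r*a1" "r*a2" "l* s34" "r*a4" "l* s13" "l* s23" "l* s14" "l* s24" "r*l*g"])
      show "l * (1 + r*a1*(r*a2)) = 1" "l* s34 * (1 + r*a3*(r*a4)) = 1" "l* s13 * (1 + r*a1*(r*a3)) = 1"
        "l* s23 * (1 + r*a2*(r*a3)) = 1" "l* s14 * (1 + r*a1*(r*a4)) = 1" "l* s24 * (1 + r*a2*(r*a4)) = 1"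
        using U unfolding k r[symmetric] by (simp_all add: algebra_simps)
      show "r*a1 + r*a2 + m*(r*a3+r*a4) = 0" using sum by algebra
      show "r*a2*l + m*(r*a3)*(l* s13) + m*(r*a4)*(l* s14) = r*l*g" unfolding g_def by algebra
      show "r*a1*l + m*(r*a3)*(l* s23) + m*(r*a4)*(l* s24) = r*l*g" unfolding g(1)[symmetric] by algebra
      show "m*(r*a4)*(l* s34) + r*a1*(l* s13) + r*a2*(l* s23) = r*l*g" unfolding g(2)[symmetric] by algebra
      show "m*(r*a3)*(l* s34) + r*a1*(l* s14) + r*a2*(l* s24) = r*l*g" unfolding g(3)[symmetric] by algebra
    qed (use m l lpos a34 \<open>r \<noteq> 0\<close> in auto)
    then show ?thesis ..
  next
    case 3
    define r where "r = sqrt (-k)"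
    have r: "r*r = -k" using 3 r_def by simp
    have r0: "r \<noteq> 0" using 3 r by auto
    \<comment> \<open>Adding \<open>t\<close> times the weights to their variation changes
      \<open>k*(a_i*b_j + b_i*a_j)\<close> by \<open>k'*a_i*a_j\<close> and so absorbs the variation
      of \<open>k\<close>. The factor \<open>r\<close> normalises \<open>k\<close> to -1.\<close>
    define t where "t = k'/(2*k)"
    have t: "k' = 2*k*t" unfolding t_def using 3 by simp
    define \<alpha> \<beta> \<gamma> \<delta> where "\<alpha> = r*(b1+t*a1)" and "\<beta> = r*(b2+t*a2)" and "\<gamma> = r*(b3+t*a3)" and "\<delta> = r*(b4+t*a4)"
    note greek = \<alpha>_def \<beta>_def \<gamma>_def \<delta>_def
    define h where "h = r*(l*g' + (t*l+l')*g)"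
    have key: "- X = r*ai*(r*(bj+t*aj)) + r*(bi+t*ai)*(r*aj)" if "X - k*(bi*aj+ai*bj) = k'*(ai*aj)" for X ai aj bi bj
      using that r unfolding t by algebra
    have "\<alpha> = 0 \<and> \<beta> = 0 \<and> \<gamma> = 0 \<and> \<delta> = 0"
    proof (rule sides_rigid[OF m, of "r*a1" "r*a2" "r*a3" "r*a4" l "l* s34" "l* s13" "l* s23" "l* s14" "l* s24"
          "l'" \<beta> \<alpha> "l* s34'+l'* s34" \<delta> \<gamma> "l* s13'+l'* s13" "l* s23'+l'* s23" "l* s14'+l'* s14" "l* s24'+l'* s24" "r*l*g" h])
      show "l * (1 - r*a1*(r*a2)) = 1" "l* s34 * (1 - r*a3*(r*a4)) = 1" "l* s13 * (1 - r*a1*(r*a3)) = 1"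
        "l* s23 * (1 - r*a2*(r*a3)) = 1" "l* s14 * (1 - r*a1*(r*a4)) = 1" "l* s24 * (1 - r*a2*(r*a4)) = 1"
        using U r unfolding k by algebra+
      show "l' = l\<^sup>2*(r*a1*\<beta>+\<alpha>*(r*a2))" "l* s34'+l'* s34 = (l* s34)\<^sup>2*(r*a3*\<delta>+\<gamma>*(r*a4))"
        "l* s13'+l'* s13 = (l* s13)\<^sup>2*(r*a1*\<gamma>+\<alpha>*(r*a3))" "l* s23'+l'* s23 = (l* s23)\<^sup>2*(r*a2*\<gamma>+\<beta>*(r*a3))"
        "l* s14'+l'* s14 = (l* s14)\<^sup>2*(r*a1*\<delta>+\<alpha>*(r*a4))" "l* s24'+l'* s24 = (l* s24)\<^sup>2*(r*a2*\<delta>+\<beta>*(r*a4))"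
        using U' unfolding greek key[OF k'(1), symmetric] key[OF k'(2), symmetric] key[OF k'(3), symmetric]
            key[OF k'(4), symmetric] key[OF k'(5), symmetric] key[OF k'(6), symmetric] by simp_all
      show "r*a1 + r*a2 + m*(r*a3+r*a4) = 0" using sum by algebra
      show "\<alpha> + \<beta> + m*(\<gamma>+\<delta>) = 0" using sum sum' unfolding greek by algebra
      show "r*a2*l + m*(r*a3)*(l* s13) + m*(r*a4)*(l* s14) = r*l*g" unfolding g_def by algebra
      show "r*a1*l + m*(r*a3)*(l* s23) + m*(r*a4)*(l* s24) = r*l*g" unfolding g(1)[symmetric] by algebra
      show "m*(r*a4)*(l* s34) + r*a1*(l* s13) + r*a2*(l* s23) = r*l*g" unfolding g(2)[symmetric] by algebra
      show "m*(r*a3)*(l* s34) + r*a1*(l* s14) + r*a2*(l* s24) = r*l*g" unfolding g(3)[symmetric] by algebra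
      show "(\<beta>*l + r*a2*l') + m*(\<gamma>*(l* s13) + r*a3*(l* s13'+l'* s13)) + m*(\<delta>*(l* s14) + r*a4*(l* s14'+l'* s14)) = h"
        unfolding h_def greek g_def g'_def by algebra
      show "(\<alpha>*l + r*a1*l') + m*(\<gamma>*(l* s23) + r*a3*(l* s23'+l'* s23)) + m*(\<delta>*(l* s24) + r*a4*(l* s24'+l'* s24)) = h"
        unfolding h_def greek g(1)[symmetric] g'(1)[symmetric] by algebra
      show "m*(\<delta>*(l* s34) + r*a4*(l* s34'+l'* s34)) + (\<alpha>*(l* s13) + r*a1*(l* s13'+l'* s13)) + (\<beta>*(l* s23) + r*a2*(l* s23'+l'* s23)) = h"
        unfolding h_def greek g(2)[symmetric] g'(2)[symmetric] by algebra
      show "m*(\<gamma>*(l* s34) + r*a3*(l* s34'+l'* s34)) + (\<alpha>*(l* s14) + r*a1*(l* s14'+l'* s14)) + (\<beta>*(l* s24) + r*a2*(l* s24'+l'* s24)) = h"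
        unfolding h_def greek g(3)[symmetric] g'(3)[symmetric] by algebra
    qed (use l lpos a1 a2 a34 r0 in auto)
    \<comment> \<open>The normalised weights do not move, so neither do the \<open>U_ij\<close>,
      then \<open>l\<close>, and then the distances to the fixed vortices 1 and 2.\<close>
    then have z: "b1+t*a1 = 0" "b2+t*a2 = 0" "b3+t*a3 = 0" "b4+t*a4 = 0" using r0 unfolding greek by auto
    have "U12' = 0" "U13' = 0" "U14' = 0" "U23' = 0" "U24' = 0" 
      using key[OF k'(1)] key[OF k'(2)] key[OF k'(3)] key[OF k'(4)] key[OF k'(5)] unfolding z by auto
    then have "l' = 0" using U'(1) by simp
    then have "s13' = 0" "s14' = 0" "s23' = 0" "s24' = 0"
      using U' l \<open>U13' = 0\<close> \<open>U14' = 0\<close> \<open>U23' = 0\<close> \<open>U24' = 0\<close> by auto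
    then have "u3 = 0" "u4 = 0" "y3* v3 = 0" "y4* v4 = 0" using s' by (auto simp: algebra_simps)
    then show ?thesis using y3 y4 by simp
  qed
qed

section \<open>Collinear configurations\<close>

text \<open>
  Subtract from \<open>v\<close> its largest slope times \<open>x\<close>. The difference is antitone in \<open>x\<close> and takes the same
  value at two points; subtracting the equations of these two points leaves a sum of terms of one
  sign.
\<close>

lemma collinear_transverse:
  fixes x v G :: "'n::finite \<Rightarrow> real" and l :: real
  assumes inj: "inj x" and G: "\<And>i. 0 < G i"
    and eqx: "\<And>i. (\<Sum>j\<in>UNIV. G j * ((1/(x i - x j)\<^sup>2 - l) * (x i - x j))) = 0"
    and eqv: "\<And>i. (\<Sum>j\<in>UNIV. G j * ((1/(x i - x j)\<^sup>2 - l) * (v i - v j))) = 0"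
  shows "\<exists>k. \<forall>i j. v i - v j = k * (x i - x j)"
proof (cases "\<exists>i j::'n. i \<noteq> j")
  case False
  then have "i = j" for i j :: 'n by blast
  then have "v i - v j = 0 * (x i - x j)" for i j by (metis diff_self mult_zero_left)
  then show ?thesis by blast
next
  case True
  define K where "K = (\<lambda>(i,j). (v i - v j)/(x i - x j)) ` {(i,j). i \<noteq> j}"
  have K: "finite K" "K \<noteq> {}" unfolding K_def using True by auto
  define k where "k = Max K"
  obtain a b where ab: "a \<noteq> b" "x a < x b" "k = (v a - v b)/(x a - x b)"
  proof -
    have "k \<in> K" unfolding k_def using K by simp
    then obtain i j where ij: "i \<noteq> j" "k = (v i - v j)/(x i - x j)" unfolding K_def by auto
    have "(v i - v j)/(x i - x j) = (v j - v i)/(x j - x i)"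
      by (metis minus_diff_eq minus_divide_divide)
    then show ?thesis using that ij inj by (metis injD linorder_less_linear)
  qed
  define w where "w i = v i - k * x i" for i
  have mono: "w j \<le> w i" if "x i < x j" for i j
  proof -
    have "(v j - v i)/(x j - x i) \<in> K" unfolding K_def using that by force
    then have "(v j - v i)/(x j - x i) \<le> k" unfolding k_def using K by simp
    then have "v j - v i \<le> k * (x j - x i)" using that by (simp add: pos_divide_le_eq)
    then show ?thesis unfolding w_def by (simp add: algebra_simps)
  qed
  have wab: "w a = w b" using ab unfolding w_def by (simp add: field_simps)
  have eqw: "(\<Sum>j\<in>UNIV. G j * ((1/(x i - x j)\<^sup>2 - l) * (w i - w j))) = 0" for i
  proof -
    have "(\<Sum>j\<in>UNIV. G j * ((1/(x i - x j)\<^sup>2 - l) * (w i - w j))) =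
       (\<Sum>j\<in>UNIV. G j * ((1/(x i - x j)\<^sup>2 - l) * (v i - v j))) - k * (\<Sum>j\<in>UNIV. G j * ((1/(x i - x j)\<^sup>2 - l) * (x i - x j)))"
      unfolding w_def sum_distrib_left sum_subtractf[symmetric] by (rule sum.cong) (auto simp: algebra_simps diff_divide_distrib add_divide_distrib)
    then show ?thesis using eqx eqv by simp
  qed
  let ?t = "\<lambda>j. G j * ((1/(x b - x j)\<^sup>2 - 1/(x a - x j)\<^sup>2) * (w a - w j))"
  have le: "0 \<le> ?t j \<and> (?t j = 0 \<longrightarrow> w j = w a)" for j
  proof -
    \<comment> \<open>Between the two points \<open>w\<close> is constant, being antitone with equal
      end values. Outside, the difference of the kernels and \<open>w a - w j\<close> have the same
      sign.\<close>
    consider "x j < x a" | "x a \<le> x j \<and> x j \<le> x b" | "x b < x j" by linarith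
    then show ?thesis
    proof cases
      case 1
      then have "(x a - x j)\<^sup>2 < (x b - x j)\<^sup>2" using ab by (intro power_strict_mono) auto
      moreover have "0 < (x a - x j)\<^sup>2" using 1 by simp
      ultimately have "1/(x b - x j)\<^sup>2 - 1/(x a - x j)\<^sup>2 < 0" by (simp add: frac_less2)
      moreover have "w a - w j \<le> 0" using mono[OF 1] by simp
      ultimately show ?thesis using G[of j] by (auto simp: mult_nonpos_nonpos less_imp_le)
    next
      case 2
      then have "w j = w a"
        using mono[of a j] mono[of j b] wab inj by (metis antisym injD order_le_less)
      then show ?thesis by simp
    next
      case 3
      then have "(x j - x b)\<^sup>2 < (x j - x a)\<^sup>2" using ab by (intro power_strict_mono) auto
      moreover have "0 < (x j - x b)\<^sup>2" using 3 by simp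
      ultimately have "1/(x b - x j)\<^sup>2 - 1/(x a - x j)\<^sup>2 > 0"
        by (simp add: frac_less2 power2_commute[of "x b"] power2_commute[of "x a"])
      moreover have "w a - w j \<ge> 0" using mono[OF 3] wab by simp
      ultimately show ?thesis using G[of j] by auto
    qed
  qed
  have "(\<Sum>j\<in>UNIV. ?t j) = 0"
  proof -
    have "(\<Sum>j\<in>UNIV. ?t j) = (\<Sum>j\<in>UNIV. G j * ((1/(x b - x j)\<^sup>2 - l) * (w b - w j)))
        - (\<Sum>j\<in>UNIV. G j * ((1/(x a - x j)\<^sup>2 - l) * (w a - w j)))"
      unfolding wab sum_subtractf[symmetric] by (rule sum.cong) (auto simp: algebra_simps diff_divide_distrib add_divide_distrib)
    then show ?thesis using eqw by simp
  qed
  then have "?t j = 0" for j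
    using sum_nonneg_eq_0_iff[of UNIV ?t] le by simp
  then have "w j = w a" for j using le by blast
  then have "w i = w j" for i j by metis
  then have "v i - v j = k * (x i - x j)" for i j
    using \<open>\<And>j i. w i = w j\<close>[of i j] unfolding w_def by (simp add: algebra_simps)
  then show ?thesis by blast
qed

text \<open>Subtracting a multiple of \<open>x\<close> removes \<open>l'\<close>. What remains is a
  weighted graph Laplacian with positive weights \<open>G i * G j * c i j\<close>, and pairing it
  with \<open>w\<close> gives a sum of squares.\<close>

lemma collinear_tangential:
  fixes x u G :: "'n::finite \<Rightarrow> real" and l l' :: real
  assumes l: "0 < l" and G: "\<And>i. 0 < G i"
    and eqx: "\<And>i. (\<Sum>j\<in>UNIV. G j * ((1/(x i - x j)\<^sup>2 - l) * (x i - x j))) = 0"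
    and equ: "\<And>i. (\<Sum>j\<in>UNIV. G j * ((1/(x i - x j)\<^sup>2 + l) * (u i - u j) + l' * (x i - x j))) = 0"
  shows "\<exists>k. \<forall>i j. u i - u j = k * (x i - x j)"
proof -
  \<comment> \<open>By \<open>eqx\<close>, inserting \<open>k * x\<close> for \<open>u\<close>
    contributes \<open>2*l*k*(x i - x j)\<close>, which has to cancel the term with
    \<open>l'\<close>.\<close>
  define k where "k = - l'/(2*l)"
  have k: "l' = - 2*l*k" unfolding k_def using l by simp
  define w where "w i = u i - k * x i" for i
  define c where "c i j = 1/(x i - x j)\<^sup>2 + l" for i j
  have c: "c i j > 0" "c i j = c j i" for i j
    unfolding c_def using l by (auto simp: add_nonneg_pos power2_commute)
  have eqw: "(\<Sum>j\<in>UNIV. G j * (c i j * (w i - w j))) = 0" for i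
  proof -
    have "(\<Sum>j\<in>UNIV. G j * (c i j * (w i - w j))) =
      (\<Sum>j\<in>UNIV. G j * ((1/(x i - x j)\<^sup>2 + l) * (u i - u j) + l' * (x i - x j)))
      - k * (\<Sum>j\<in>UNIV. G j * ((1/(x i - x j)\<^sup>2 - l) * (x i - x j)))"
      unfolding w_def c_def k sum_distrib_left sum_subtractf[symmetric] by (rule sum.cong) (auto simp: algebra_simps diff_divide_distrib add_divide_distrib)
    then show ?thesis using eqx equ by simp
  qed
  let ?S = "\<Sum>i\<in>UNIV. \<Sum>j\<in>UNIV. G i * G j * (c i j * (w i * (w i - w j)))"
  have "?S = (\<Sum>i\<in>UNIV. G i * w i * (\<Sum>j\<in>UNIV. G j * (c i j * (w i - w j))))"
    unfolding sum_distrib_left by (intro sum.cong) (auto simp: algebra_simps)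
  then have S0: "?S = 0" using eqw by simp
  let ?S' = "\<Sum>i\<in>UNIV. \<Sum>j\<in>UNIV. G i * G j * (c i j * (w j * (w j - w i)))"
  have S': "?S = ?S'"
    by (subst sum.swap) (simp add: mult.commute c(2) cong: sum.cong)
  have "(\<Sum>i\<in>UNIV. \<Sum>j\<in>UNIV. G i * G j * (c i j * (w i - w j)\<^sup>2)) = ?S + ?S'"
    unfolding power2_eq_square sum.distrib[symmetric] by (intro sum.cong) (auto simp: algebra_simps)
  then have z: "(\<Sum>i\<in>UNIV. \<Sum>j\<in>UNIV. G i * G j * (c i j * (w i - w j)\<^sup>2)) = 0" using S0 S' by simp
  have nn: "0 \<le> G i * G j * (c i j * (w i - w j)\<^sup>2)" for i j
    using G[of i] G[of j] c(1)[of i j] by simp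
  have "(\<Sum>j\<in>UNIV. G i * G j * (c i j * (w i - w j)\<^sup>2)) = 0" for i
    using sum_nonneg_eq_0_iff[of UNIV "\<lambda>i. \<Sum>j\<in>UNIV. G i * G j * (c i j * (w i - w j)\<^sup>2)"] z nn
    by (simp add: sum_nonneg)
  then have "G i * G j * (c i j * (w i - w j)\<^sup>2) = 0" for i j
    using sum_nonneg_eq_0_iff[of UNIV "\<lambda>j. G i * G j * (c i j * (w i - w j)\<^sup>2)"] nn by (metis UNIV_I finite)
  then have "w i - w j = 0" for i j using G[of i] G[of j] c(1)[of i j]
    by (metis less_irrefl mult_eq_0_iff power2_eq_square)
  then have "u i - u j = k * (x i - x j)" for i j
    using \<open>\<And>j i. w i - w j = 0\<close>[of i j] unfolding w_def by (simp add: algebra_simps)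
  then show ?thesis by blast
qed

definition by_vortex :: "real \<Rightarrow> real \<Rightarrow> real \<Rightarrow> real \<Rightarrow> 4 \<Rightarrow> real" where
  "by_vortex a b c d i = (if i = 1 then a else if i = 2 then b else if i = 3 then c else d)"

lemma by_vortex_simps [simp]:
  "by_vortex a b c d 1 = a" "by_vortex a b c d 2 = b" "by_vortex a b c d 3 = c" "by_vortex a b c d 4 = d"
  by (simp_all add: by_vortex_def)

text \<open>On a line the force is \<open>l*(U*x) = 1/x - l*x\<close>. Its derivative along the line
  is \<open>- (1/x\<^sup>2 + l)\<close>, whereas a transverse motion meets
  \<open>1/x\<^sup>2 - l\<close>; this sign makes the tangential part definite.\<close>

lemma pair_terms:
  fixes l :: real
  assumes "l \<noteq> 0" "x \<noteq> 0" "(1+U)*(l * x\<^sup>2) = 1" "l*(2*(x*u)) + l' * x\<^sup>2 = -(l * x\<^sup>2)\<^sup>2 * U'"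
  shows "1/x\<^sup>2 - l = l*U" "(1/x\<^sup>2 + l)*u + l' * x = - l*(U' * x + U*u) - l' * (U*x)"
proof -
  have i: "1/x\<^sup>2 = l*(1+U)" using assms(2,3) by (simp add: divide_eq_eq algebra_simps)
  then show "1/x\<^sup>2 - l = l*U" by (simp add: algebra_simps)
  have "(l * x\<^sup>2)*x*((1/x\<^sup>2 + l)*u + l' * x - (- l*(U' * x + U*u) - l' * (U*x))) = 0"
    using assms(3,4) unfolding i by algebra
  then show "(1/x\<^sup>2 + l)*u + l' * x = - l*(U' * x + U*u) - l' * (U*x)" using assms(1,2) by simp
qed

lemma collinear_nondegenerate:
  fixes l m :: real
  assumes m: "0 < m" and l: "0 < l"
    and ne: "x3 \<noteq> 0" "x4 \<noteq> 0" "x3 \<noteq> 1" "x4 \<noteq> 1" "x3 \<noteq> x4"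
    and U: "(1+U12)*l = 1" "(1+U13)*(l * x3\<^sup>2) = 1" "(1+U14)*(l * x4\<^sup>2) = 1" "(1+U23)*(l * (x3-1)\<^sup>2) = 1"
      "(1+U24)*(l * (x4-1)\<^sup>2) = 1" "(1+U34)*(l * (x3-x4)\<^sup>2) = 1"
    and U': "l' = - l\<^sup>2*U12'" "l * (2*(x3*u3))+l' * x3\<^sup>2 = -(l * x3\<^sup>2)\<^sup>2*U13'" "l * (2*(x4*u4))+l' * x4\<^sup>2 = -(l * x4\<^sup>2)\<^sup>2*U14'"
      "l * (2*((x3-1)*u3))+l' * (x3-1)\<^sup>2 = -(l * (x3-1)\<^sup>2)\<^sup>2*U23'" "l * (2*((x4-1)*u4))+l' * (x4-1)\<^sup>2 = -(l * (x4-1)\<^sup>2)\<^sup>2*U24'"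
      "l * (2*((x3-x4)*(u3-u4)))+l' * (x3-x4)\<^sup>2 = -(l * (x3-x4)\<^sup>2)\<^sup>2*U34'"
    and E1: "U12 + m*(U13*x3) + m*(U14*x4) = 0"
    and E2: "U12 + m*(U23*(1-x3)) + m*(U24*(1-x4)) = 0"
    and E3: "U13*x3 + U23*(x3-1) + m*(U34*(x3-x4)) = 0"
    and E1': "U12' + m*(U13'*x3+U13*u3) + m*(U14'*x4+U14*u4) = 0" "U13 * v3 + U14 * v4 = 0"
    and E2': "U12' + m*(U23'*(1-x3)-U23*u3) + m*(U24'*(1-x4)-U24*u4) = 0" "U23 * v3 + U24 * v4 = 0"
    and E3': "U13'*x3+U13*u3 + U23'*(x3-1)+U23*u3 + m*(U34'*(x3-x4)+U34*(u3-u4)) = 0"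
      "(U13+U23) * v3 + m*(U34*(v3-v4)) = 0"
  shows "u3 = 0 \<and> v3 = 0 \<and> u4 = 0 \<and> v4 = 0"
proof -
  define G x u v where "G = by_vortex 1 1 m m" and "x = by_vortex 0 1 x3 x4" and "u = by_vortex 0 0 u3 u4" and "v = by_vortex 0 0 v3 v4"
  have l0: "l \<noteq> 0" using l by simp
  have inj: "inj x"
    unfolding inj_def forall_4 x_def by_vortex_simps using ne by auto
  have Gp: "0 < G i" for i using m unfolding G_def by_vortex_def by simp
  have m0: "m \<noteq> 0" using m by simp
  \<comment> \<open>Forces weighted by the circulations sum to zero, which supplies the equation of
    vortex 4.\<close>
  have "m * (U14*x4 + U24*(x4-1) + m*(U34*(x4-x3))) = 0" using E1 E2 E3 by algebra
  then have E4: "U14*x4 + U24*(x4-1) + m*(U34*(x4-x3)) = 0" using m0 by simp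
  have "m * (U14'*x4+U14*u4 + U24'*(x4-1)+U24*u4 + m*(U34'*(x4-x3)+U34*(u4-u3))) = 0"
    using E1'(1) E2'(1) E3'(1) by algebra
  then have E4': "U14'*x4+U14*u4 + U24'*(x4-1)+U24*u4 + m*(U34'*(x4-x3)+U34*(u4-u3)) = 0" using m0 by simp
  have E4v: "(U14+U24) * v4 + m*(U34*(v4-v3)) = 0" using E1'(2) E2'(2) E3'(2) by algebra
  have t12: "1 - l = l*U12" "l' = - l*U12' - l' * U12"
    using U(1) U'(1) by algebra+
  note t13 = pair_terms[OF l0 ne(1) U(2) U'(2)]
  note t14 = pair_terms[OF l0 ne(2) U(3) U'(3)]
  note t23 = pair_terms[OF l0 _ U(4) U'(4)]
  note t24 = pair_terms[OF l0 _ U(5) U'(5)]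
  note t34 = pair_terms[OF l0 _ U(6) U'(6)]
  define K12 K13 K14 K23 K24 K34 where K: "K12 = (1::real)" "K13 = 1/x3\<^sup>2" "K14 = 1/x4\<^sup>2" "K23 = 1/(x3-1)\<^sup>2"
     "K24 = 1/(x4-1)\<^sup>2" "K34 = 1/(x3-x4)\<^sup>2"
  have P: "K12 - l = l*U12" "K13 - l = l*U13" "K14 - l = l*U14" "K23 - l = l*U23" "K24 - l = l*U24" "K34 - l = l*U34"
    using t12 t13(1) t14(1) t23(1) t24(1) t34(1) ne unfolding K by auto
  have R: "l' = - l*U12' - l' * U12"
    "(K13+l)*u3 + l' * x3 = - l*(U13' * x3 + U13*u3) - l' * (U13*x3)"
    "(K14+l)*u4 + l' * x4 = - l*(U14' * x4 + U14*u4) - l' * (U14*x4)"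
    "(K23+l)*u3 + l' * (x3-1) = - l*(U23' * (x3-1) + U23*u3) - l' * (U23*(x3-1))"
    "(K24+l)*u4 + l' * (x4-1) = - l*(U24' * (x4-1) + U24*u4) - l' * (U24*(x4-1))"
    "(K34+l)*(u3-u4) + l' * (x3-x4) = - l*(U34' * (x3-x4) + U34*(u3-u4)) - l' * (U34*(x3-x4))"
    using t12(2) t13(2) t14(2) t23(2) t24(2) t34(2) ne unfolding K by auto
  have sw: "(1-x3)\<^sup>2 = (x3-1)\<^sup>2" "(1-x4)\<^sup>2 = (x4-1)\<^sup>2" "(x4-x3)\<^sup>2 = (x3-x4)\<^sup>2"
    by (rule power2_commute)+
  have sumw: "(\<Sum>j\<in>UNIV. G j * ((1/(x i - x j)\<^sup>2 + p) * (w i - w j) + q * (x i - x j))) =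
     by_vortex (m*((K13+p)*(w 1-w 3) + q*(- x3)) + m*((K14+p)*(w 1-w 4) + q*(- x4)) + ((K12+p)*(w 1-w 2) - q))
          (m*((K23+p)*(w 2-w 3) + q*(1-x3)) + m*((K24+p)*(w 2-w 4) + q*(1-x4)) + ((K12+p)*(w 2-w 1) + q))
          ((K13+p)*(w 3-w 1) + q*x3 + ((K23+p)*(w 3-w 2) + q*(x3-1)) + m*((K34+p)*(w 3-w 4) + q*(x3-x4)))
          ((K14+p)*(w 4-w 1) + q*x4 + ((K24+p)*(w 4-w 2) + q*(x4-1)) + m*((K34+p)*(w 4-w 3) + q*(x4-x3))) i"
    for w :: "4 \<Rightarrow> real" and p q i
  proof -
    have "\<forall>i. (\<Sum>j\<in>UNIV. G j * ((1/(x i - x j)\<^sup>2 + p) * (w i - w j) + q * (x i - x j))) =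
     by_vortex (m*((K13+p)*(w 1-w 3) + q*(- x3)) + m*((K14+p)*(w 1-w 4) + q*(- x4)) + ((K12+p)*(w 1-w 2) - q))
          (m*((K23+p)*(w 2-w 3) + q*(1-x3)) + m*((K24+p)*(w 2-w 4) + q*(1-x4)) + ((K12+p)*(w 2-w 1) + q))
          ((K13+p)*(w 3-w 1) + q*x3 + ((K23+p)*(w 3-w 2) + q*(x3-1)) + m*((K34+p)*(w 3-w 4) + q*(x3-x4)))
          ((K14+p)*(w 4-w 1) + q*x4 + ((K24+p)*(w 4-w 2) + q*(x4-1)) + m*((K34+p)*(w 4-w 3) + q*(x4-x3))) i"
      unfolding forall_4 sum_4 G_def x_def by_vortex_simps K by (simp add: sw)
    then show ?thesis by blast
  qed
  have eqx: "(\<Sum>j\<in>UNIV. G j * ((1/(x i - x j)\<^sup>2 - l) * (x i - x j))) = 0" for i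
  proof -
    have "(\<Sum>j\<in>UNIV. G j * ((1/(x i - x j)\<^sup>2 - l) * (x i - x j))) =
        by_vortex (- l*(U12 + m*(U13*x3) + m*(U14*x4))) (l*(U12 + m*(U23*(1-x3)) + m*(U24*(1-x4))))
          (l*(U13*x3 + U23*(x3-1) + m*(U34*(x3-x4)))) (l*(U14*x4 + U24*(x4-1) + m*(U34*(x4-x3)))) i"
      using sumw[of i "-l" x 0] unfolding x_def by_vortex_simps by (simp add: P algebra_simps)
    then show ?thesis unfolding E1 E2 E3 E4 by (simp add: by_vortex_def)
  qed
  have eqv: "(\<Sum>j\<in>UNIV. G j * ((1/(x i - x j)\<^sup>2 - l) * (v i - v j))) = 0" for i
  proof -
    have "(\<Sum>j\<in>UNIV. G j * ((1/(x i - x j)\<^sup>2 - l) * (v i - v j))) =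
        by_vortex (- l*m*(U13 * v3 + U14 * v4)) (- l*m*(U23 * v3 + U24 * v4))
          (l*((U13+U23) * v3 + m*(U34*(v3-v4)))) (l*((U14+U24) * v4 + m*(U34*(v4-v3)))) i"
      using sumw[of i "-l" v 0] unfolding v_def by_vortex_simps by (simp add: P algebra_simps)
    then show ?thesis unfolding E1' E2' E3' E4v by (simp add: by_vortex_def)
  qed
  have equ: "(\<Sum>j\<in>UNIV. G j * ((1/(x i - x j)\<^sup>2 + l) * (u i - u j) + l' * (x i - x j))) = 0" for i
  proof -
    have "m*((K13+l)*(0-u3) + l' * (- x3)) + m*((K14+l)*(0-u4) + l' * (- x4)) + ((K12+l)*(0-0) - l') = 0"
      using R(1-3) E1 E1'(1) by algebra
    moreover have "m*((K23+l)*(0-u3) + l' * (1-x3)) + m*((K24+l)*(0-u4) + l' * (1-x4)) + ((K12+l)*(0-0) + l') = 0"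
      using R(1,4,5) E2 E2'(1) by algebra
    moreover have "(K13+l)*(u3-0) + l' * x3 + ((K23+l)*(u3-0) + l' * (x3-1)) + m*((K34+l)*(u3-u4) + l' * (x3-x4)) = 0"
      using R(2,4,6) E3 E3'(1) by algebra
    moreover have "(K14+l)*(u4-0) + l' * x4 + ((K24+l)*(u4-0) + l' * (x4-1)) + m*((K34+l)*(u4-u3) + l' * (x4-x3)) = 0"
      using R(3,5,6) E4 E4' by algebra
    ultimately show ?thesis using sumw[of i l u l'] unfolding u_def by_vortex_simps by (simp add: by_vortex_def)
  qed
  obtain k where k: "\<And>i j. v i - v j = k * (x i - x j)"
    using collinear_transverse[OF inj Gp eqx eqv] by blast
  obtain n where n: "\<And>i j. u i - u j = n * (x i - x j)"
    using collinear_tangential[OF l Gp eqx equ] by blast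
  \<comment> \<open>Vortices 1 and 2 do not move, so both common slopes are zero.\<close>
  have "k = 0" using k[of 2 1] unfolding v_def x_def by simp
  moreover have "n = 0" using n[of 2 1] unfolding u_def x_def by simp
  ultimately show ?thesis
    using k[of 3 1] k[of 4 1] n[of 3 1] n[of 4 1] unfolding v_def u_def by simp
qed

section \<open>Nondegeneracy of relative equilibria\<close>

text \<open>Passes from \<open>S = 1/s - l\<close> to \<open>U = S/l = 1/(l*s) - 1\<close>, whose
  first variation is \<open>(S' - l'*U)/l\<close>.\<close>

lemma normalize_pair:
  fixes l :: real
  assumes l: "0 < l" and "0 < s" "s*S = 1 - l * s" "s*S' = - S * s' - l' * s - l * s'"
  shows "(1+S/l)*(l * s) = 1" "l * s' + l' * s = - (l * s)\<^sup>2 * ((S' - l' * (S/l))/l)"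
proof -
  define U where "U = S/l"
  have S: "S = l*U" using l U_def by simp
  define V where "V = (S' - l' * U)/l"
  have S': "S' = l*V + l' * U" using l V_def by simp
  show 1: "(1+S/l)*(l * s) = 1" unfolding U_def[symmetric] using assms(3) unfolding S by algebra
  have "l * s' + l' * s = - (l * s)\<^sup>2 * V" using assms(3,4) unfolding S S' by algebra
  then show "l * s' + l' * s = - (l * s)\<^sup>2 * ((S' - l' * (S/l))/l)" unfolding V_def U_def .
qed

text \<open>
  Only the equations of the third and fourth vortex are assumed: those of the first two follow from
  the identities behind conservation of linear and angular momentum and from the choice of the
  multiplier \<open>l\<close>. Here \<open>S\<close> stands for \<open>1/s - l\<close>, and primes denote first variations.
\<close>

lemma critical_nondegenerate:
  fixes l m :: real
  assumes m: "0 < m" "m < 1" and l: "0 < l"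
    and pos: "0 < s13" "0 < s14" "0 < s23" "0 < s24" "0 < s34"
    and s: "s13 = x3\<^sup>2+y3\<^sup>2" "s14 = x4\<^sup>2+y4\<^sup>2" "s23 = (x3-1)\<^sup>2+y3\<^sup>2" "s24 = (x4-1)\<^sup>2+y4\<^sup>2"
      "s34 = (x3-x4)\<^sup>2+(y3-y4)\<^sup>2"
    and s': "s13' = 2*(x3*u3+y3 * v3)" "s14' = 2*(x4*u4+y4 * v4)" "s23' = 2*((x3-1)*u3+y3 * v3)"
      "s24' = 2*((x4-1)*u4+y4 * v4)" "s34' = 2*((x3-x4)*(u3-u4)+(y3-y4)*(v3-v4))"
    and J: "l * (1 + m*(s13+s14+s23+s24) + m\<^sup>2 * s34) = 1 + 4*m + m\<^sup>2"
    and J': "l' * (1 + m*(s13+s14+s23+s24) + m\<^sup>2 * s34) + l * (m*(s13'+s14'+s23'+s24') + m\<^sup>2 * s34') = 0"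
    and S: "s13*S13 = 1 - l * s13" "s14*S14 = 1 - l * s14" "s23*S23 = 1 - l * s23" "s24*S24 = 1 - l * s24"
       "s34*S34 = 1 - l * s34"
    and S': "s13*S13' = - S13 * s13' - l' * s13 - l * s13'" "s14*S14' = - S14 * s14' - l' * s14 - l * s14'"
       "s23*S23' = - S23 * s23' - l' * s23 - l * s23'" "s24*S24' = - S24 * s24' - l' * s24 - l * s24'"
       "s34*S34' = - S34 * s34' - l' * s34 - l * s34'"
    and E3: "S13*x3 + S23*(x3-1) + m*(S34*(x3-x4)) = 0" "S13*y3 + S23*y3 + m*(S34*(y3-y4)) = 0"
    and E4: "S14*x4 + S24*(x4-1) + m*(S34*(x4-x3)) = 0" "S14*y4 + S24*y4 + m*(S34*(y4-y3)) = 0"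
    and E3': "S13'*x3 + S13*u3 + S23'*(x3-1) + S23*u3 + m*(S34'*(x3-x4) + S34*(u3-u4)) = 0"
      "S13'*y3 + S13 * v3 + S23'*y3 + S23 * v3 + m*(S34'*(y3-y4) + S34*(v3-v4)) = 0"
    and E4': "S14'*x4 + S14*u4 + S24'*(x4-1) + S24*u4 + m*(S34'*(x4-x3) + S34*(u4-u3)) = 0"
      "S14'*y4 + S14 * v4 + S24'*y4 + S24 * v4 + m*(S34'*(y4-y3) + S34*(v4-v3)) = 0"
  shows "u3 = 0 \<and> v3 = 0 \<and> u4 = 0 \<and> v4 = 0"
proof -
  have m0: "m \<noteq> 0" using m by simp
  define S12 S12' where "S12 = 1 - l" and "S12' = - l'"
  have tr: "S12 + m*(s13*S13 + s14*S14 + s23*S23 + s24*S24) + m\<^sup>2*(s34*S34) = 0"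
    unfolding S S12_def using J by algebra
  have tr': "S12' + m*((s13*S13'+S13 * s13') + (s14*S14'+S14 * s14') + (s23*S23'+S23 * s23') + (s24*S24'+S24 * s24'))
      + m\<^sup>2*(s34*S34'+S34 * s34') = 0"
    unfolding S' S12'_def using J' by algebra
  \<comment> \<open>By the choice of \<open>l\<close>, the products of force and position sum to
    zero. Vortex 1 sits at the origin and no force acts on 3 and 4, so the component of the force on
    vortex 2 along (1,0) vanishes. Torques give its other component.\<close>
  have E2: "S12 + m*(S23*(1-x3)) + m*(S24*(1-x4)) = 0" using tr E3 E4 unfolding s by algebra
  have E2y: "S23*y3 + S24*y4 = 0" using E3 E4 by algebra
  have E1: "S12 + m*(S13*x3) + m*(S14*x4) = 0" using E2 E3(1) E4(1) by algebra
  have "m*(S13*y3 + S14*y4) = 0" using E2y E3(2) E4(2) by algebra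
  then have E1y: "S13*y3 + S14*y4 = 0" using m0 by simp
  have E2': "S12' + m*(S23'*(1-x3) - S23*u3) + m*(S24'*(1-x4) - S24*u4) = 0"
    using tr' E3 E4 E3' E4' unfolding s s' by algebra
  have E2y': "S23'*y3 + S23 * v3 + S24'*y4 + S24 * v4 = 0" using E3 E4 E3' E4' by algebra
  have E1': "S12' + m*(S13'*x3 + S13*u3) + m*(S14'*x4 + S14*u4) = 0" using E2' E3'(1) E4'(1) by algebra
  have "m*(S13'*y3 + S13 * v3 + S14'*y4 + S14 * v4) = 0" using E2y' E3'(2) E4'(2) by algebra
  then have E1y': "S13'*y3 + S13 * v3 + S14'*y4 + S14 * v4 = 0" using m0 by simp
  define U12 U13 U14 U23 U24 U34 where "U12 = S12/l" and "U13 = S13/l" and "U14 = S14/l" and "U23 = S23/l" and "U24 = S24/l" and "U34 = S34/l"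
  note U = U12_def U13_def U14_def U23_def U24_def U34_def
  define V12 V13 V14 V23 V24 V34 where "V12 = (S12' - l' * U12)/l" and "V13 = (S13' - l' * U13)/l" and "V14 = (S14' - l' * U14)/l" and "V23 = (S23' - l' * U23)/l" and "V24 = (S24' - l' * U24)/l" and "V34 = (S34' - l' * U34)/l"
  note V = V12_def V13_def V14_def V23_def V24_def V34_def
  have SU: "S12 = l*U12" "S13 = l*U13" "S14 = l*U14" "S23 = l*U23" "S24 = l*U24" "S34 = l*U34" using l unfolding U by auto
  have SV: "S12' = l*V12 + l' * U12" "S13' = l*V13 + l' * U13" "S14' = l*V14 + l' * U14" "S23' = l*V23 + l' * U23" "S24' = l*V24 + l' * U24" "S34' = l*V34 + l' * U34" using l unfolding V by auto
  have l0: "l \<noteq> 0" using l by simp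
  have canc: "X = 0" if "l * X = 0" for X using that l0 by simp
  have e12: "(1 + U12)*l = 1" using SU(1) unfolding S12_def by algebra
  have e12': "l' = - l\<^sup>2 * V12" using SU(1) SV(1) unfolding S12_def S12'_def by algebra
  have e: "(1+U13)*(l * s13) = 1" "(1+U14)*(l * s14) = 1" "(1+U23)*(l * s23) = 1"
      "(1+U24)*(l * s24) = 1" "(1+U34)*(l * s34) = 1"
    using normalize_pair(1)[OF l pos(1) S(1) S'(1)] normalize_pair(1)[OF l pos(2) S(2) S'(2)]
      normalize_pair(1)[OF l pos(3) S(3) S'(3)] normalize_pair(1)[OF l pos(4) S(4) S'(4)]
      normalize_pair(1)[OF l pos(5) S(5) S'(5)] unfolding U by blast+
  have e': "l * s13'+l' * s13 = -(l * s13)\<^sup>2*V13" "l * s14'+l' * s14 = -(l * s14)\<^sup>2*V14"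
      "l * s23'+l' * s23 = -(l * s23)\<^sup>2*V23" "l * s24'+l' * s24 = -(l * s24)\<^sup>2*V24"
      "l * s34'+l' * s34 = -(l * s34)\<^sup>2*V34"
    using normalize_pair(2)[OF l pos(1) S(1) S'(1)] normalize_pair(2)[OF l pos(2) S(2) S'(2)]
      normalize_pair(2)[OF l pos(3) S(3) S'(3)] normalize_pair(2)[OF l pos(4) S(4) S'(4)]
      normalize_pair(2)[OF l pos(5) S(5) S'(5)] unfolding V U by blast+
  have F: "U12 + m*(U13*x3) + m*(U14*x4) = 0" "U13*y3 + U14*y4 = 0"
     "U12 + m*(U23*(1-x3)) + m*(U24*(1-x4)) = 0" "U23*y3 + U24*y4 = 0"
     "U13*x3 + U23*(x3-1) + m*(U34*(x3-x4)) = 0" "(U13+U23)*y3 + m*(U34*(y3-y4)) = 0"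
     "(U14+U24)*y4 + m*(U34*(y4-y3)) = 0"
    by (rule canc; use E1 E1y E2 E2y E3 E4 in \<open>unfold SU, algebra\<close>)+
  have F': "V12 + m*(V13*x3+U13*u3) + m*(V14*x4+U14*u4) = 0"
    "V13*y3+U13 * v3 + V14*y4+U14 * v4 = 0"
    "V12 + m*(V23*(1-x3)-U23*u3) + m*(V24*(1-x4)-U24*u4) = 0"
    "V23*y3+U23 * v3 + V24*y4+U24 * v4 = 0"
    "V13*x3+U13*u3 + V23*(x3-1)+U23*u3 + m*(V34*(x3-x4)+U34*(u3-u4)) = 0"
    "(V13+V23)*y3+(U13+U23) * v3 + m*(V34*(y3-y4)+U34*(v3-v4)) = 0"
    by (rule canc; use E1' E1y' E2' E2y' E3' F in \<open>unfold SU SV, algebra\<close>)+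
  show ?thesis
  proof (cases "y3 = 0 \<and> y4 = 0")
    case True
    then have y: "y3 = 0" "y4 = 0" by auto
    have ne: "x3 \<noteq> 0" "x4 \<noteq> 0" "x3 \<noteq> 1" "x4 \<noteq> 1" "x3 \<noteq> x4" using pos s y by auto
    have s2: "s13 = x3\<^sup>2" "s14 = x4\<^sup>2" "s23 = (x3-1)\<^sup>2" "s24 = (x4-1)\<^sup>2" "s34 = (x3-x4)\<^sup>2"
      "s13' = 2*(x3*u3)" "s14' = 2*(x4*u4)" "s23' = 2*((x3-1)*u3)" "s24' = 2*((x4-1)*u4)" "s34' = 2*((x3-x4)*(u3-u4))"
      using s s' y by simp_all
    show ?thesis
      by (rule collinear_nondegenerate[OF m(1) l ne e12 e[unfolded s2] e12' e'[unfolded s2] F(1,3,5) F'(1) _ F'(3) _ F'(5)])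
        (use F'(2,4,6) y in auto)
  next
    case False
    show ?thesis
      by (rule noncollinear_nondegenerate[OF m l pos s s' e12 e e12' e' F F']) (use False in auto)
  qed
qed

section \<open>Smooth functions\<close>

lemma times_cont_differentiable_on_cong:
  assumes "open S" "\<And>x. x \<in> S \<Longrightarrow> f x = g x" "times_cont_differentiable_on k f S"
  shows "times_cont_differentiable_on k g S"
  using assms(2,3)
proof (induction k arbitrary: f g)
  case 0
  then show ?case by (simp cong: continuous_on_cong)
next
  case (Suc k)
  have d: "f differentiable (at x)" if "x \<in> S" for x using Suc.prems that by simp
  have eq: "frechet_derivative f (at x) = frechet_derivative g (at x)" if "x \<in> S" for x
    by (rule frechet_derivative_transform_within_open[OF d[OF that] assms(1) that Suc.prems(1)])
  have "g differentiable (at x)" if "x \<in> S" for x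
  proof -
    obtain D where "(f has_derivative D) (at x)" using d[OF \<open>x \<in> S\<close>] unfolding differentiable_def by blast
    from has_derivative_transform_within_open[OF this assms(1) \<open>x \<in> S\<close> Suc.prems(1)]
    show ?thesis unfolding differentiable_def by blast
  qed
  moreover have "times_cont_differentiable_on k (\<lambda>x. frechet_derivative g (at x) v) S" for v
    by (rule Suc.IH[of "\<lambda>x. frechet_derivative f (at x) v"]) (use Suc.prems eq in auto)
  ultimately show ?case by simp
qed

lemma times_cont_differentiable_on_SucI:
  assumes "open S" "\<And>x. x \<in> S \<Longrightarrow> (f has_derivative f' x) (at x)"
    and "\<And>v. times_cont_differentiable_on k (\<lambda>x. f' x v) S"
  shows "times_cont_differentiable_on (Suc k) f S"
proof -
  have "frechet_derivative f (at x) = f' x" if "x \<in> S" for x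
    using frechet_derivative_at[OF assms(2)[OF that]] by simp
  then have "times_cont_differentiable_on k (\<lambda>x. frechet_derivative f (at x) v) S" for v
    by (intro times_cont_differentiable_on_cong[OF assms(1) _ assms(3)[of v]]) auto
  then show ?thesis using assms(2) by (auto simp: differentiable_def)
qed

text \<open>Derivatives of products and inverses again contain the undifferentiated functions, so
  the inductions on the order must be able to lower it.\<close>

lemma times_cont_differentiable_on_SucD:
  "times_cont_differentiable_on (Suc k) f S \<Longrightarrow> times_cont_differentiable_on k f S"
proof (induction k arbitrary: f)
  case 0
  then show ?case by (auto intro!: continuous_at_imp_continuous_on differentiable_imp_continuous_within)
next
  case (Suc k)
  have "times_cont_differentiable_on k (\<lambda>x. frechet_derivative f (at x) v) S" for v
    by (rule Suc.IH) (use Suc.prems in simp)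
  then show ?case using Suc.prems by simp
qed

lemma times_cont_differentiable_on_has_derivative:
  "times_cont_differentiable_on (Suc k) f S \<Longrightarrow> x \<in> S \<Longrightarrow> (f has_derivative frechet_derivative f (at x)) (at x)"
  by (simp add: frechet_derivative_works[symmetric])

lemma times_cont_differentiable_on_const:
  assumes "open S"
  shows "times_cont_differentiable_on k (\<lambda>x. c) S"
proof (induction k arbitrary: c)
  case (Suc k)
  show ?case by (rule times_cont_differentiable_on_SucI[OF assms, of _ "\<lambda>x v. 0"]) (use Suc in simp_all)
qed simp

lemma times_cont_differentiable_on_id:
  assumes "open S"
  shows "times_cont_differentiable_on k (\<lambda>x. x) S"
proof (cases k)
  case (Suc j)
  show ?thesis unfolding Suc
    by (rule times_cont_differentiable_on_SucI[OF assms, of _ "\<lambda>x v. v"])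
      (use times_cont_differentiable_on_const[OF assms] in simp_all)
qed simp

lemma times_cont_differentiable_on_linear:
  assumes "open S" "bounded_linear L" "times_cont_differentiable_on k f S"
  shows "times_cont_differentiable_on k (\<lambda>x. L (f x)) S"
  using assms(3)
proof (induction k arbitrary: f)
  case 0
  then show ?case using bounded_linear.continuous_on[OF assms(2)] by simp
next
  case (Suc k)
  show ?case
  proof (rule times_cont_differentiable_on_SucI[OF assms(1)])
    show "((\<lambda>x. L (f x)) has_derivative (\<lambda>v. L (frechet_derivative f (at x) v))) (at x)" if "x \<in> S" for x
      by (rule bounded_linear.has_derivative[OF assms(2) times_cont_differentiable_on_has_derivative[OF Suc.prems that]])
    show "times_cont_differentiable_on k (\<lambda>x. L (frechet_derivative f (at x) v)) S" for v
      using Suc by auto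
  qed
qed

lemma times_cont_differentiable_on_add:
  assumes "open S" "times_cont_differentiable_on k f S" "times_cont_differentiable_on k g S"
  shows "times_cont_differentiable_on k (\<lambda>x. f x + g x) S"
  using assms(2,3)
proof (induction k arbitrary: f g)
  case 0
  then show ?case by (simp add: continuous_on_add)
next
  case (Suc k)
  show ?case
  proof (rule times_cont_differentiable_on_SucI[OF assms(1)])
    show "((\<lambda>x. f x + g x) has_derivative (\<lambda>v. frechet_derivative f (at x) v + frechet_derivative g (at x) v)) (at x)"
      if "x \<in> S" for x
      by (rule has_derivative_add[OF times_cont_differentiable_on_has_derivative[OF Suc.prems(1) that]
            times_cont_differentiable_on_has_derivative[OF Suc.prems(2) that]])
    show "times_cont_differentiable_on k (\<lambda>x. frechet_derivative f (at x) v + frechet_derivative g (at x) v) S" for v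
      using Suc by auto
  qed
qed

lemma times_cont_differentiable_on_scaleR:
  assumes "open S" "times_cont_differentiable_on k f S" "times_cont_differentiable_on k g S"
  shows "times_cont_differentiable_on k (\<lambda>x. f x *\<^sub>R g x) S"
  using assms(2,3)
proof (induction k arbitrary: f g)
  case 0
  then show ?case by (simp add: continuous_on_scaleR)
next
  case (Suc k)
  show ?case
  proof (rule times_cont_differentiable_on_SucI[OF assms(1)])
    show "((\<lambda>x. f x *\<^sub>R g x) has_derivative
        (\<lambda>v. f x *\<^sub>R frechet_derivative g (at x) v + frechet_derivative f (at x) v *\<^sub>R g x)) (at x)"
      if "x \<in> S" for x
      by (rule has_derivative_scaleR[OF times_cont_differentiable_on_has_derivative[OF Suc.prems(1) that]
            times_cont_differentiable_on_has_derivative[OF Suc.prems(2) that]])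
    show "times_cont_differentiable_on k (\<lambda>x. f x *\<^sub>R frechet_derivative g (at x) v + frechet_derivative f (at x) v *\<^sub>R g x) S" for v
      using Suc.prems times_cont_differentiable_on_SucD[OF Suc.prems(1)] times_cont_differentiable_on_SucD[OF Suc.prems(2)]
      by (intro times_cont_differentiable_on_add[OF assms(1)] Suc.IH) auto
  qed
qed

lemma times_cont_differentiable_on_mult:
  fixes f g :: "'a::euclidean_space \<Rightarrow> real"
  assumes "open S" "times_cont_differentiable_on k f S" "times_cont_differentiable_on k g S"
  shows "times_cont_differentiable_on k (\<lambda>x. f x * g x) S"
  using times_cont_differentiable_on_scaleR[OF assms] by simp

lemma times_cont_differentiable_on_sum:
  assumes "open S" "finite A" "\<And>i. i \<in> A \<Longrightarrow> times_cont_differentiable_on k (f i) S"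
  shows "times_cont_differentiable_on k (\<lambda>x. \<Sum>i\<in>A. f i x) S"
  using assms(2,3)
proof (induction A rule: finite_induct)
  case empty
  show ?case using times_cont_differentiable_on_const[OF assms(1)] by simp
next
  case (insert a A)
  have "times_cont_differentiable_on k (\<lambda>x. f a x + (\<Sum>i\<in>A. f i x)) S"
    by (rule times_cont_differentiable_on_add[OF assms(1)]) (use insert in auto)
  then show ?case using insert by simp
qed

lemma times_cont_differentiable_on_inverse:
  fixes f :: "'a::euclidean_space \<Rightarrow> real"
  assumes "open S" "times_cont_differentiable_on k f S" "\<And>x. x \<in> S \<Longrightarrow> f x \<noteq> 0"
  shows "times_cont_differentiable_on k (\<lambda>x. inverse (f x)) S"
  using assms(2)
proof (induction k)
  case 0
  then show ?case using assms(3) by (auto intro!: continuous_on_inverse)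
next
  case (Suc k)
  show ?case
  proof (rule times_cont_differentiable_on_SucI[OF assms(1)])
    show "((\<lambda>x. inverse (f x)) has_derivative (\<lambda>v. (-1) * (inverse (f x) * (frechet_derivative f (at x) v * inverse (f x))))) (at x)"
      if "x \<in> S" for x
      using Deriv.has_derivative_inverse[OF assms(3)[OF that] times_cont_differentiable_on_has_derivative[OF Suc.prems that]] by (simp add: mult.assoc)
    show "times_cont_differentiable_on k (\<lambda>x. (-1) * (inverse (f x) * (frechet_derivative f (at x) v * inverse (f x)))) S" for v
      using Suc.prems Suc.IH[OF times_cont_differentiable_on_SucD[OF Suc.prems]] assms(1)
      by (intro times_cont_differentiable_on_mult times_cont_differentiable_on_const) auto
  qed
qed

lemma times_cont_differentiable_on_ln:
  fixes f :: "'a::euclidean_space \<Rightarrow> real"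
  assumes "open S" "times_cont_differentiable_on k f S" "\<And>x. x \<in> S \<Longrightarrow> 0 < f x"
  shows "times_cont_differentiable_on k (\<lambda>x. ln (f x)) S"
proof (cases k)
  case 0
  then show ?thesis using assms by (auto intro!: continuous_on_ln simp: less_imp_neq[symmetric])
next
  case (Suc j)
  note f = assms(2)[unfolded Suc]
  show ?thesis unfolding Suc
  proof (rule times_cont_differentiable_on_SucI[OF assms(1)])
    show "((\<lambda>x. ln (f x)) has_derivative (\<lambda>v. frechet_derivative f (at x) v * inverse (f x))) (at x)" if "x \<in> S" for x
      using has_derivative_ln[OF assms(3)[OF that] times_cont_differentiable_on_has_derivative[OF f that]]
      by (simp add: divide_inverse)
    show "times_cont_differentiable_on j (\<lambda>x. frechet_derivative f (at x) v * inverse (f x)) S" for v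
      using f assms(3) by (intro times_cont_differentiable_on_mult times_cont_differentiable_on_inverse assms(1)
        times_cont_differentiable_on_SucD[OF f]) (auto simp: less_imp_neq[symmetric])
  qed
qed

lemma times_cont_differentiable_on_sqrt:
  fixes f :: "'a::euclidean_space \<Rightarrow> real"
  assumes "open S" "times_cont_differentiable_on k f S" "\<And>x. x \<in> S \<Longrightarrow> 0 < f x"
  shows "times_cont_differentiable_on k (\<lambda>x. sqrt (f x)) S"
  using assms(2)
proof (induction k)
  case 0
  then show ?case by (auto intro!: continuous_on_real_sqrt)
next
  case (Suc k)
  show ?case
  proof (rule times_cont_differentiable_on_SucI[OF assms(1)])
    show "((\<lambda>x. sqrt (f x)) has_derivative (\<lambda>v. frechet_derivative f (at x) v * (inverse (sqrt (f x)) * (1/2)))) (at x)"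
      if "x \<in> S" for x
      by (rule has_derivative_eq_rhs[OF has_derivative_real_sqrt[OF assms(3)[OF that] times_cont_differentiable_on_has_derivative[OF Suc.prems that]]])
        (simp add: fun_eq_iff)
    show "times_cont_differentiable_on k (\<lambda>x. frechet_derivative f (at x) v * (inverse (sqrt (f x)) * (1/2))) S" for v
      using Suc.prems assms(3) Suc.IH[OF times_cont_differentiable_on_SucD[OF Suc.prems]]
      by (intro times_cont_differentiable_on_mult times_cont_differentiable_on_inverse assms(1)
        times_cont_differentiable_on_const) (auto simp: less_imp_neq[symmetric])
  qed
qed

text \<open>Stated for an arbitrary \<open>\<phi>\<close>, since smoothness on the quotient ranges
  over all parametrisations and not only over the chart constructed below.\<close>

lemma smooth_on_hamiltonian_comp:
  assumes "open U" "smooth_on U \<phi>" "\<phi> ` U \<inter> collision_set = {}"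
  shows "smooth_on U (\<lambda>u. hamiltonian \<Gamma> (\<phi> u))"
  unfolding smooth_on_def
proof
  fix k
  have \<phi>: "times_cont_differentiable_on k \<phi> U" using assms(2) unfolding smooth_on_def by blast
  have ne: "\<phi> u $ i \<noteq> \<phi> u $ j" if "u \<in> U" "i \<noteq> j" for u i j
    using assms(3) that unfolding collision_set_def by blast
  have ln: "times_cont_differentiable_on k (\<lambda>u. ln (norm (\<phi> u $ i - \<phi> u $ j))) U" if "i \<noteq> j" for i j
  proof -
    let ?d = "\<lambda>u. \<phi> u $ i - \<phi> u $ j"
    have L: "bounded_linear (\<lambda>z::config. (z $ i - z $ j) $ l)" for l
      by (rule bounded_linear_compose[OF bounded_linear_vec_nth bounded_linear_sub[OF bounded_linear_vec_nth bounded_linear_vec_nth]])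
    have "times_cont_differentiable_on k (\<lambda>u. \<Sum>l\<in>UNIV. ?d u $ l * ?d u $ l) U"
      by (intro times_cont_differentiable_on_sum[OF assms(1)] times_cont_differentiable_on_mult[OF assms(1)]
          times_cont_differentiable_on_linear[OF assms(1) L \<phi>]) auto
    then have "times_cont_differentiable_on k (\<lambda>u. ln (sqrt (\<Sum>l\<in>UNIV. ?d u $ l * ?d u $ l))) U"
    proof (intro times_cont_differentiable_on_ln[OF assms(1)] times_cont_differentiable_on_sqrt[OF assms(1)])
      show pos: "0 < (\<Sum>l\<in>UNIV. ?d u $ l * ?d u $ l)" if "u \<in> U" for u
      proof -
        have "(\<Sum>l\<in>UNIV. ?d u $ l * ?d u $ l) = inner (?d u) (?d u)" by (simp add: inner_vec_def)
        then show ?thesis using ne[OF that \<open>i \<noteq> j\<close>] by simp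
      qed
      show "0 < sqrt (\<Sum>l\<in>UNIV. ?d u $ l * ?d u $ l)" if "u \<in> U" for u
        using pos[OF that] by simp
    qed
    then show ?thesis unfolding norm_eq_sqrt_inner inner_vec_def inner_real_def .
  qed
  have "times_cont_differentiable_on k (\<lambda>u. (-1) * (\<Sum>i\<in>UNIV. \<Sum>j\<in>{j. i < j}. \<Gamma> $ i * \<Gamma> $ j * ln (norm (\<phi> u $ i - \<phi> u $ j)))) U"
    by (intro times_cont_differentiable_on_mult[OF assms(1) times_cont_differentiable_on_const[OF assms(1)]]
          times_cont_differentiable_on_sum[OF assms(1)] ln) auto
  then show "times_cont_differentiable_on k (\<lambda>u. hamiltonian \<Gamma> (\<phi> u)) U"
    unfolding hamiltonian_def by simp
qed

section \<open>A global chart of the quotient\<close>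

lemma less_index_4: "(1::4) < 2" "(2::4) < 3" "(4::4) < 1"
  by (simp_all add: less_bit0_def bit0.Rep_1 bit0.Rep_numeral)

lemma greater_index_4:
  "{j::4. 1 < j} = {2,3}" "{j::4. 2 < j} = {3}" "{j::4. 3 < j} = {}" "{j::4. 4 < j} = {1,2,3}"
  using less_index_4 by (auto simp: set_eq_iff forall_4)

lemma hamiltonian_expand:
  "hamiltonian \<Gamma> z = - (\<Gamma>$1 * \<Gamma>$2 * ln (norm (z$1 - z$2)) + \<Gamma>$1 * \<Gamma>$3 * ln (norm (z$1 - z$3))
     + \<Gamma>$1 * \<Gamma>$4 * ln (norm (z$1 - z$4)) + \<Gamma>$2 * \<Gamma>$3 * ln (norm (z$2 - z$3))
     + \<Gamma>$2 * \<Gamma>$4 * ln (norm (z$2 - z$4)) + \<Gamma>$3 * \<Gamma>$4 * ln (norm (z$3 - z$4)))"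
  unfolding hamiltonian_def sum_4 greater_index_4
  by (simp add: norm_minus_commute[of "z$4"] algebra_simps)

definition centered :: "real^4 \<Rightarrow> config \<Rightarrow> config" where
  "centered \<Gamma> z = (\<chi> i. z $ i - vorticity_center \<Gamma> z)"

lemma centered_diff: "centered \<Gamma> z $ i - centered \<Gamma> z $ j = z $ i - z $ j"
  by (simp add: centered_def)

lemma linear_vorticity_center: "linear (vorticity_center \<Gamma>)"
  unfolding vorticity_center_def
  by (rule linearI) (simp_all add: scaleR_add_right sum.distrib scaleR_sum_right algebra_simps)

lemma linear_centered: "linear (centered \<Gamma>)"
  by (rule linearI) (simp_all add: centered_def vec_eq_iff linear_add[OF linear_vorticity_center]
    linear_scale[OF linear_vorticity_center] algebra_simps)

lemma angular_impulse_centered: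
  "angular_impulse \<Gamma> z = (\<Sum>i\<in>UNIV. \<Gamma> $ i * (norm (centered \<Gamma> z $ i))\<^sup>2)"
  by (simp add: angular_impulse_def centered_def)

lemma vorticity_center_centered:
  assumes "total_circulation \<Gamma> \<noteq> 0"
  shows "vorticity_center \<Gamma> (centered \<Gamma> z) = 0"
proof -
  have "(\<Sum>i\<in>UNIV. \<Gamma> $ i *\<^sub>R centered \<Gamma> z $ i)
     = (\<Sum>i\<in>UNIV. \<Gamma> $ i *\<^sub>R z $ i) - total_circulation \<Gamma> *\<^sub>R vorticity_center \<Gamma> z"
    by (simp add: centered_def scaleR_diff_right sum_subtractf total_circulation_def scaleR_left.sum)
  also have "\<dots> = 0" using assms by (simp add: vorticity_center_def)
  finally show ?thesis by (simp add: vorticity_center_def)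
qed

lemma normalized_scaled_centered:
  assumes "total_circulation \<Gamma> \<noteq> 0" "0 < angular_impulse \<Gamma> z"
  shows "inverse (sqrt (angular_impulse \<Gamma> z)) *\<^sub>R centered \<Gamma> z \<in> normalized_configs \<Gamma>"
proof -
  define r where "r = inverse (sqrt (angular_impulse \<Gamma> z))"
  have c: "vorticity_center \<Gamma> (r *\<^sub>R centered \<Gamma> z) = 0"
    using vorticity_center_centered[OF assms(1)] by (simp add: linear_scale[OF linear_vorticity_center])
  have "angular_impulse \<Gamma> (r *\<^sub>R centered \<Gamma> z) = (\<Sum>i\<in>UNIV. \<Gamma> $ i * (norm (r *\<^sub>R centered \<Gamma> z $ i))\<^sup>2)"
    unfolding angular_impulse_def c by simp
  also have "\<dots> = r\<^sup>2 * angular_impulse \<Gamma> z"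
    unfolding angular_impulse_centered sum_distrib_left by (simp add: power_mult_distrib algebra_simps)
  also have "\<dots> = 1" using assms(2) unfolding r_def by (simp add: power_inverse)
  finally show ?thesis using c unfolding normalized_configs_def r_def by simp
qed

lemma rotation_matrix_mult:
  fixes A B :: "real^'n^'n"
  shows "rotation_matrix A \<Longrightarrow> rotation_matrix B \<Longrightarrow> rotation_matrix (A ** B)"
  by (simp add: rotation_matrix_def orthogonal_matrix_mul det_mul)

lemma rotate_config_mult: "rotate_config A (rotate_config B z) = rotate_config (A ** B) z"
  by (simp add: rotate_config_def matrix_vector_mul_assoc)

lemma orbit_refl: "z \<in> orbit z"
proof -
  have "rotation_matrix (mat 1 :: real^2^2)"
    by (simp add: rotation_matrix_def orthogonal_matrix_id)
  moreover have "rotate_config (mat 1) z = z" by (simp add: rotate_config_def vec_eq_iff)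
  ultimately show ?thesis unfolding orbit_def by force
qed

lemma orbit_rotate_config:
  assumes "rotation_matrix A"
  shows "orbit (rotate_config A z) = orbit z"
proof -
  have sub: "orbit (rotate_config B w) \<subseteq> orbit w" if "rotation_matrix B" for B w
    using that rotation_matrix_mult unfolding orbit_def by (auto simp: rotate_config_mult)
  have tr: "rotation_matrix (transpose A)" and inv: "transpose A ** A = mat 1"
    using assms by (auto simp: rotation_matrix_def orthogonal_matrix_transpose det_transpose orthogonal_matrix_def)
  have "z = rotate_config (transpose A) (rotate_config A z)"
    unfolding rotate_config_mult inv by (simp add: rotate_config_def vec_eq_iff)
  then show ?thesis using sub[OF assms] sub[OF tr] by (metis subset_antisym)
qed

text \<open>A similarity moves the first two vortices to (0,0) and (1,0); the coordinates
  \<open>u\<close> are the positions of the other two.\<close>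

definition relative_config :: "real^4 \<Rightarrow> config" where
  "relative_config u = (\<chi> i. if i = 2 then vector [1,0] else if i = 3 then vector [u$1,u$2]
     else if i = 4 then vector [u$3,u$4] else 0)"

definition relative_shift :: "real^4 \<Rightarrow> config" where
  "relative_shift u = (\<chi> i. if i = 3 then vector [u$1,u$2] else if i = 4 then vector [u$3,u$4] else 0)"

lemma relative_config_nth [simp]:
  "relative_config u $ 1 = 0" "relative_config u $ 2 = vector [1,0]"
  "relative_config u $ 3 = vector [u$1,u$2]" "relative_config u $ 4 = vector [u$3,u$4]"
  by (simp_all add: relative_config_def)

lemma relative_shift_nth [simp]:
  "relative_shift u $ 1 = 0" "relative_shift u $ 2 = 0"
  "relative_shift u $ 3 = vector [u$1,u$2]" "relative_shift u $ 4 = vector [u$3,u$4]"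
  by (simp_all add: relative_shift_def)

lemma linear_relative_shift: "linear relative_shift"
  by (rule linearI) (simp_all add: vec_eq_iff forall_4 forall_2)

lemma relative_config_shift: "relative_config u = relative_config 0 + relative_shift u"
  by (simp add: vec_eq_iff forall_4 forall_2)

definition sq13 :: "real^4 \<Rightarrow> real" where "sq13 u = (u$1)\<^sup>2 + (u$2)\<^sup>2"
definition sq14 :: "real^4 \<Rightarrow> real" where "sq14 u = (u$3)\<^sup>2 + (u$4)\<^sup>2"
definition sq23 :: "real^4 \<Rightarrow> real" where "sq23 u = (u$1 - 1)\<^sup>2 + (u$2)\<^sup>2"
definition sq24 :: "real^4 \<Rightarrow> real" where "sq24 u = (u$3 - 1)\<^sup>2 + (u$4)\<^sup>2"
definition sq34 :: "real^4 \<Rightarrow> real" where "sq34 u = (u$1 - u$3)\<^sup>2 + (u$2 - u$4)\<^sup>2"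

lemmas sq_defs = sq13_def sq14_def sq23_def sq24_def sq34_def

text \<open>The sum of \<open>\<Gamma>_i \<Gamma>_j r_ij^2\<close> over all pairs, with
  \<open>r_12 = 1\<close>. By Lagrange's identity it is the total circulation times the angular
  impulse.\<close>

definition impulse_poly :: "real \<Rightarrow> real^4 \<Rightarrow> real" where
  "impulse_poly m u = 1 + m*(sq13 u + sq14 u + sq23 u + sq24 u) + m\<^sup>2 * sq34 u"

definition collision_free :: "(real^4) set" where
  "collision_free = {u. sq13 u \<noteq> 0 \<and> sq14 u \<noteq> 0 \<and> sq23 u \<noteq> 0 \<and> sq24 u \<noteq> 0 \<and> sq34 u \<noteq> 0}"

lemma norm_vec_2: "norm (v :: real^2) = sqrt ((v$1)\<^sup>2 + (v$2)\<^sup>2)"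
  by (simp add: norm_vec_def L2_set_def sum_2)

lemma norm_relative_config:
  "norm (relative_config u $ 1 - relative_config u $ 2) = 1"
  "norm (relative_config u $ 1 - relative_config u $ 3) = sqrt (sq13 u)"
  "norm (relative_config u $ 1 - relative_config u $ 4) = sqrt (sq14 u)"
  "norm (relative_config u $ 2 - relative_config u $ 3) = sqrt (sq23 u)"
  "norm (relative_config u $ 2 - relative_config u $ 4) = sqrt (sq24 u)"
  "norm (relative_config u $ 3 - relative_config u $ 4) = sqrt (sq34 u)"
  by (simp_all add: norm_vec_2 sq_defs power2_commute[of 1])

lemma open_collision_free: "open collision_free"
  unfolding collision_free_def sq_defs
  by (intro open_Collect_conj open_Collect_neq continuous_intros)

lemma sq_pos:
  assumes "u \<in> collision_free"
  shows "0 < sq13 u" "0 < sq14 u" "0 < sq23 u" "0 < sq24 u" "0 < sq34 u"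
  using assms unfolding collision_free_def sq_defs by (auto simp: sum_power2_gt_zero_iff sum_power2_eq_zero_iff)

lemma collision_free_iff: "u \<in> collision_free \<longleftrightarrow> relative_config u \<notin> collision_set"
proof -
  have z: "sq13 u = 0 \<longleftrightarrow> relative_config u $ 1 = relative_config u $ 3" "sq14 u = 0 \<longleftrightarrow> relative_config u $ 1 = relative_config u $ 4"
    "sq23 u = 0 \<longleftrightarrow> relative_config u $ 2 = relative_config u $ 3" "sq24 u = 0 \<longleftrightarrow> relative_config u $ 2 = relative_config u $ 4"
    "sq34 u = 0 \<longleftrightarrow> relative_config u $ 3 = relative_config u $ 4"
    by (auto simp: sq_defs vec_eq_iff forall_2 sum_power2_eq_zero_iff)
  have "relative_config u $ 1 \<noteq> relative_config u $ 2" by (auto simp: vec_eq_iff forall_2)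
  moreover have "z \<in> collision_set \<longleftrightarrow> \<not> (\<forall>i j. z $ i = z $ j \<longrightarrow> i = j)" for z
    unfolding collision_set_def by blast
  ultimately show ?thesis unfolding collision_free_def mem_Collect_eq z forall_4 by auto
qed

lemma norm_rotation:
  fixes A :: "real^'n^'n"
  assumes "rotation_matrix A"
  shows "norm (A *v x) = norm x"
proof -
  have "orthogonal_transformation ((*v) A)"
    using assms by (simp add: rotation_matrix_def orthogonal_transformation_matrix)
  then show ?thesis by (rule orthogonal_transformation_norm)
qed

locale two_pairs =
  fixes \<Gamma> :: "real^4" and m :: real
  assumes circ: "\<Gamma> $ 1 = 1" "\<Gamma> $ 2 = 1" "\<Gamma> $ 3 = m" "\<Gamma> $ 4 = m" and m_pos: "0 < m"
begin

lemma total_circulation_eq: "total_circulation \<Gamma> = 2 + 2*m"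
  by (simp add: total_circulation_def sum_4 circ)

lemma impulse_poly_pos: "0 < impulse_poly m u"
  unfolding impulse_poly_def sq_defs using m_pos by (intro add_pos_nonneg) auto

lemma angular_impulse_relative: "angular_impulse \<Gamma> (relative_config u) = impulse_poly m u / (2 + 2*m)"
proof -
  define c where "c = vorticity_center \<Gamma> (relative_config u)"
  have "(2+2*m) *\<^sub>R c = (\<Sum>i\<in>UNIV. \<Gamma> $ i *\<^sub>R relative_config u $ i)"
    unfolding c_def vorticity_center_def total_circulation_eq using m_pos by simp
  then have c1: "(2+2*m) * c$1 = 1 + m*u$1 + m*u$3" and c2: "(2+2*m) * c$2 = m*u$2 + m*u$4"
    by (auto simp: vec_eq_iff forall_2 sum_4 circ)
  have "angular_impulse \<Gamma> (relative_config u) = (c$1)\<^sup>2 + (c$2)\<^sup>2 + ((1-c$1)\<^sup>2 + (c$2)\<^sup>2)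
     + m*((u$1-c$1)\<^sup>2 + (u$2-c$2)\<^sup>2) + m*((u$3-c$1)\<^sup>2 + (u$4-c$2)\<^sup>2)"
    unfolding angular_impulse_def c_def[symmetric] by (simp add: sum_4 circ norm_vec_2)
  then have "(2+2*m) * angular_impulse \<Gamma> (relative_config u) = impulse_poly m u"
    unfolding impulse_poly_def sq_defs using c1 c2 by algebra
  then show ?thesis using m_pos by (simp add: field_simps)
qed

text \<open>The factor that brings the angular impulse to 1, written with inverses to match the
  smoothness rules.\<close>

definition chart_scale :: "real^4 \<Rightarrow> real" where
  "chart_scale u = inverse (sqrt (impulse_poly m u * inverse (2 + 2*m)))"

definition chart :: "real^4 \<Rightarrow> config" where
  "chart u = chart_scale u *\<^sub>R centered \<Gamma> (relative_config u)"

lemma chart_scale_pos: "0 < chart_scale u"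
  unfolding chart_scale_def using impulse_poly_pos[of u] m_pos by simp

lemma chart_diff: "chart u $ i - chart u $ j = chart_scale u *\<^sub>R (relative_config u $ i - relative_config u $ j)"
  unfolding chart_def by (simp add: centered_diff flip: scaleR_diff_right)

lemma chart_normalized: "chart u \<in> normalized_configs \<Gamma>"
proof -
  have "total_circulation \<Gamma> \<noteq> 0" using total_circulation_eq m_pos by simp
  moreover have "0 < angular_impulse \<Gamma> (relative_config u)"
    unfolding angular_impulse_relative using impulse_poly_pos m_pos by simp
  ultimately show ?thesis
    using normalized_scaled_centered[of \<Gamma> "relative_config u"]
    unfolding chart_def chart_scale_def angular_impulse_relative divide_inverse by blast
qed

lemma chart_collision_free: "u \<in> collision_free \<Longrightarrow> chart u \<notin> collision_set"
proof -
  have "chart u $ i = chart u $ j \<longleftrightarrow> relative_config u $ i = relative_config u $ j" for i j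
    using chart_diff[of u i j] chart_scale_pos[of u] by auto
  then show "u \<in> collision_free \<Longrightarrow> chart u \<notin> collision_set"
    unfolding collision_free_iff collision_set_def by auto
qed

lemma smooth_coordinate: "open S \<Longrightarrow> times_cont_differentiable_on k (\<lambda>u::real^4. u $ i) S"
  by (rule times_cont_differentiable_on_linear[OF _ bounded_linear_vec_nth times_cont_differentiable_on_id])

lemma smooth_square_diff:
  assumes "open S"
  shows "times_cont_differentiable_on k (\<lambda>u::real^4. (u $ i - c)\<^sup>2) S"
proof -
  have "times_cont_differentiable_on k (\<lambda>u::real^4. (u $ i + (- c)) * (u $ i + (- c))) S"
    by (intro times_cont_differentiable_on_mult[OF assms] times_cont_differentiable_on_add[OF assms]
        smooth_coordinate[OF assms] times_cont_differentiable_on_const[OF assms])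
  then show ?thesis by (simp add: power2_eq_square)
qed

lemma smooth_square_diff':
  assumes "open S"
  shows "times_cont_differentiable_on k (\<lambda>u::real^4. (u $ i - u $ j)\<^sup>2) S"
proof -
  have "times_cont_differentiable_on k (\<lambda>u::real^4. (u $ i + (-1) * u $ j) * (u $ i + (-1) * u $ j)) S"
    by (intro times_cont_differentiable_on_mult[OF assms] times_cont_differentiable_on_add[OF assms]
        smooth_coordinate[OF assms] times_cont_differentiable_on_const[OF assms])
  then show ?thesis by (simp add: power2_eq_square)
qed

lemma smooth_chart_scale:
  assumes "open S"
  shows "times_cont_differentiable_on k chart_scale S"
proof -
  note sq = smooth_square_diff[OF assms, of k]
  have sq0: "times_cont_differentiable_on k (\<lambda>u::real^4. (u $ i)\<^sup>2) S" for i using sq[of i 0] by simp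
  have "times_cont_differentiable_on k (\<lambda>u. impulse_poly m u * inverse (2 + 2*m)) S"
    unfolding impulse_poly_def sq_defs
    by (intro times_cont_differentiable_on_mult[OF assms] times_cont_differentiable_on_add[OF assms]
        times_cont_differentiable_on_const[OF assms] sq sq0 smooth_square_diff'[OF assms])
  note imp = this
  have pos: "0 < impulse_poly m u * inverse (2 + 2*m)" for u using impulse_poly_pos[of u] m_pos by simp
  have "times_cont_differentiable_on k (\<lambda>u. inverse (sqrt (impulse_poly m u * inverse (2 + 2*m)))) S"
  proof (rule times_cont_differentiable_on_inverse[OF assms times_cont_differentiable_on_sqrt[OF assms imp pos]])
    show "sqrt (impulse_poly m u * inverse (2 + 2*m)) \<noteq> 0" for u
      using real_sqrt_gt_zero[OF pos[of u]] by linarith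
  qed
  then show ?thesis unfolding chart_scale_def[abs_def] .
qed

lemma smooth_chart:
  assumes "open S"
  shows "smooth_on S chart"
  unfolding smooth_on_def
proof
  fix k
  have L: "bounded_linear (centered \<Gamma>)" "bounded_linear relative_shift"
    using linear_centered linear_relative_shift by (auto simp: linear_conv_bounded_linear)
  have "times_cont_differentiable_on k (\<lambda>u. relative_config 0 + relative_shift u) S"
    by (intro times_cont_differentiable_on_add[OF assms] times_cont_differentiable_on_const[OF assms]
        times_cont_differentiable_on_linear[OF assms L(2) times_cont_differentiable_on_id[OF assms]])
  moreover have "relative_config = (\<lambda>u. relative_config 0 + relative_shift u)"
    by (rule ext) (rule relative_config_shift)
  ultimately have "times_cont_differentiable_on k relative_config S" by simp
  then show "times_cont_differentiable_on k chart S"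
    unfolding chart_def[abs_def]
    by (intro times_cont_differentiable_on_scaleR[OF assms] smooth_chart_scale[OF assms]
        times_cont_differentiable_on_linear[OF assms L(1)])
qed

text \<open>Differences to vortex 1 remove the centre. Vortex 2 has relative position (1,0) in both
  configurations: its length identifies the scales, and its direction makes the rotation the
  identity.\<close>

lemma inj_on_orbit_chart: "inj_on (orbit \<circ> chart) S"
proof (rule inj_onI)
  fix u v assume "(orbit \<circ> chart) u = (orbit \<circ> chart) v"
  then have "chart u \<in> orbit (chart v)" using orbit_refl[of "chart u"] by simp
  then obtain A where A: "rotation_matrix A" "chart u = rotate_config A (chart v)" unfolding orbit_def by blast
  have eq: "chart_scale u *\<^sub>R relative_config u $ i = chart_scale v *\<^sub>R (A *v relative_config v $ i)" for i
  proof -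
    have "chart u $ i - chart u $ 1 = A *v (chart v $ i - chart v $ 1)"
      unfolding A(2) by (simp add: rotate_config_def matrix_vector_mult_diff_distrib)
    then show ?thesis unfolding chart_diff by (simp add: matrix_vector_mult_scaleR)
  qed
  have e1: "vector [1,0] = (axis 1 1 :: real^2)" by (simp add: vec_eq_iff forall_2 axis_def)
  have orth: "orthogonal_matrix A" and det: "det A = 1" using A(1) by (auto simp: rotation_matrix_def)
  have nrm: "norm (A *v x) = norm x" for x
    by (rule norm_rotation[OF A(1)])
  have "norm (chart_scale u *\<^sub>R relative_config u $ 2) = norm (chart_scale v *\<^sub>R (A *v relative_config v $ 2))"
    by (rule arg_cong[OF eq])
  then have r: "chart_scale u = chart_scale v"
    using chart_scale_pos[of u] chart_scale_pos[of v] by (simp add: nrm e1)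
  have eq': "relative_config u $ i = A *v relative_config v $ i" for i
    using eq[of i] chart_scale_pos[of v] unfolding r by simp
  have "A$1$1 = 1" "A$2$1 = 0"
    using eq'[of 2] by (simp_all add: vec_eq_iff forall_2 matrix_vector_mult_def sum_2)
  moreover have "A$2$2 = 1" using det calculation by (simp add: det_2)
  moreover have "A$1$2 = 0"
  proof -
    have "(A ** transpose A)$1$2 = 0" using orth by (simp add: orthogonal_matrix_def mat_def)
    then show ?thesis using calculation by (simp add: matrix_matrix_mult_def transpose_def sum_2)
  qed
  ultimately have "A = mat 1" by (simp add: vec_eq_iff forall_2 mat_def)
  then have "relative_config u $ i = relative_config v $ i" for i using eq'[of i] by simp
  from this[of 3] this[of 4] show "u = v" by (simp add: vec_eq_iff forall_2 forall_4)
qed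

text \<open>The infinitesimal form of injectivity: since vortex 2 is held at (1,0), its first
  coordinate shows that the scale does not vary and its second that there is no rotation.\<close>

lemma chart_immersion:
  assumes "frechet_derivative chart (at u) v \<in> span {rotation_field (chart u)}"
  shows "v = 0"
proof -
  have "times_cont_differentiable_on (Suc 0) chart_scale UNIV" by (rule smooth_chart_scale) simp
  then obtain r' where r': "(chart_scale has_derivative r') (at u)"
    using times_cont_differentiable_on_has_derivative by blast
  have "relative_config = (\<lambda>u. relative_config 0 + relative_shift u)"
    by (rule ext) (rule relative_config_shift)
  moreover have "((\<lambda>u. relative_config 0 + relative_shift u) has_derivative relative_shift) (at u)"
    using has_derivative_add[OF has_derivative_const linear_imp_has_derivative[OF linear_relative_shift]] by simp
  ultimately have "(relative_config has_derivative relative_shift) (at u)" by simp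
  from bounded_linear.has_derivative[OF _ this, of "centered \<Gamma>"]
  have "((\<lambda>u. centered \<Gamma> (relative_config u)) has_derivative (\<lambda>v. centered \<Gamma> (relative_shift v))) (at u)"
    using linear_centered by (simp add: linear_conv_bounded_linear)
  from has_derivative_scaleR[OF r' this]
  have D: "(chart has_derivative (\<lambda>v. chart_scale u *\<^sub>R centered \<Gamma> (relative_shift v) + r' v *\<^sub>R centered \<Gamma> (relative_config u))) (at u)"
    unfolding chart_def[abs_def] .
  obtain k where k: "frechet_derivative chart (at u) v = k *\<^sub>R rotation_field (chart u)"
    using assms unfolding span_singleton by auto
  let ?J = "vector [vector [0, -1], vector [1, 0]] :: real^2^2"
  have eq: "chart_scale u *\<^sub>R relative_shift v $ i + r' v *\<^sub>R relative_config u $ i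
      = (k * chart_scale u) *\<^sub>R (?J *v relative_config u $ i)" for i
  proof -
    have "frechet_derivative chart (at u) v $ i - frechet_derivative chart (at u) v $ 1
       = chart_scale u *\<^sub>R (relative_shift v $ i - relative_shift v $ 1) + r' v *\<^sub>R (relative_config u $ i - relative_config u $ 1)"
    proof -
      have reg: "x *\<^sub>R p + y *\<^sub>R q - (x *\<^sub>R p' + y *\<^sub>R q') = x *\<^sub>R (p - p') + y *\<^sub>R (q - q')" for x y and p q p' q' :: "real^2"
        by (simp add: algebra_simps)
      then show ?thesis
        unfolding frechet_derivative_at[OF D, symmetric] vector_add_component vector_scaleR_component reg centered_diff ..
    qed
    moreover have "(k *\<^sub>R rotation_field (chart u)) $ i - (k *\<^sub>R rotation_field (chart u)) $ 1
       = k *\<^sub>R (?J *v (chart u $ i - chart u $ 1))"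
      by (simp add: rotation_field_def matrix_vector_mult_diff_distrib scaleR_diff_right)
    ultimately show ?thesis unfolding k chart_diff by (simp add: matrix_vector_mult_scaleR)
  qed
  have "r' v = 0" "k * chart_scale u = 0"
    using eq[of 2] by (simp_all add: vec_eq_iff forall_2 matrix_vector_mult_def sum_2)
  then have "relative_shift v $ i = 0" for i using eq[of i] chart_scale_pos[of u] by simp
  from this[of 3] this[of 4] show ?thesis by (simp add: vec_eq_iff forall_2 forall_4)
qed

lemma quotient_param_chart: "quotient_param \<Gamma> collision_free chart"
  unfolding quotient_param_def
  using open_collision_free smooth_chart[OF open_collision_free] chart_normalized chart_collision_free
    inj_on_orbit_chart chart_immersion by auto

lemma chart_surj:
  assumes "p \<in> quotient_space \<Gamma>"
  shows "\<exists>u\<in>collision_free. orbit (chart u) = p"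
proof -
  obtain z where z: "z \<in> normalized_configs \<Gamma>" "z \<notin> collision_set" and p: "p = orbit z"
    using assms unfolding quotient_space_def by blast
  have c0: "vorticity_center \<Gamma> z = 0" and I1: "angular_impulse \<Gamma> z = 1" using z unfolding normalized_configs_def by auto
  \<comment> \<open>Scaling by \<open>r\<close> and rotating by \<open>A\<close> carries (1,0) to
    \<open>z$2 - z$1\<close>; undoing this similarity on the other two vortices gives
    \<open>u\<close>.\<close>
  define a b r where "a = (z$2 - z$1)$1" and "b = (z$2 - z$1)$2" and "r = sqrt (a\<^sup>2 + b\<^sup>2)"
  have "z $ 2 \<noteq> z $ 1" using z(2) unfolding collision_set_def by force
  then have "a\<^sup>2 + b\<^sup>2 > 0" unfolding a_def b_def by (auto simp: vec_eq_iff forall_2 sum_power2_gt_zero_iff)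
  then have r: "0 < r" "r * r = a\<^sup>2 + b\<^sup>2" unfolding r_def by auto
  define A :: "real^2^2" where "A = vector [vector [a/r, -b/r], vector [b/r, a/r]]"
  have ab: "a/r * (a/r) + b/r * (b/r) = 1"
  proof -
    have "a/r * (a/r) + b/r * (b/r) = (a\<^sup>2 + b\<^sup>2) / (r * r)"
      by (simp add: power2_eq_square add_divide_distrib)
    also have "\<dots> = 1" unfolding r(2)[symmetric] using r(1) by simp
    finally show ?thesis .
  qed
  have A: "rotation_matrix A"
    unfolding rotation_matrix_def orthogonal_matrix A_def using ab
    by (simp add: det_2 vec_eq_iff forall_2 matrix_matrix_mult_def transpose_def sum_2 mat_def algebra_simps)
  define w where "w i = (1/r) *\<^sub>R (transpose A *v (z$i - z$1))" for i
  define u :: "real^4" where "u = vector [w 3 $ 1, w 3 $ 2, w 4 $ 1, w 4 $ 2]"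
  have inv: "A ** transpose A = mat 1" using A by (simp add: rotation_matrix_def orthogonal_matrix_def)
  have w: "r *\<^sub>R (A *v w i) = z$i - z$1" for i
    unfolding w_def by (simp only: matrix_vector_mult_scaleR matrix_vector_mul_assoc inv matrix_vector_mul_lid scaleR_scaleR) (use r in simp)
  have u34: "u$1 = w 3 $ 1" "u$2 = w 3 $ 2" "u$3 = w 4 $ 1" "u$4 = w 4 $ 2"
    unfolding u_def by (simp_all add: vector_def)
  have rel: "relative_config u $ i = w i" for i
  proof -
    define a' b' where "a' = a/r" and "b' = b/r"
    have d: "z$2 - z$1 = vector [r * a', r * b']"
      using r unfolding a'_def b'_def by (simp add: vec_eq_iff forall_2 a_def b_def)
    have "1/r * (a' * (r * a') + b' * (r * b')) = 1"
    proof -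
      have "a' * a' + b' * b' = 1" using ab unfolding a'_def b'_def .
      moreover have "1/r * (a' * (r * a') + b' * (r * b')) = a' * a' + b' * b'" using r(1) by (simp add: field_simps)
      ultimately show ?thesis by simp
    qed
    moreover have "1/r * (- b' * (r * a') + a' * (r * b')) = 0" by simp
    ultimately have "w 2 = vector [1,0]"
      unfolding w_def d A_def transpose_def using r(1)
      by (simp add: vec_eq_iff forall_2 matrix_vector_mult_def sum_2 flip: a'_def b'_def)
    moreover have "w 1 = 0" unfolding w_def by simp
    ultimately have "\<forall>i. relative_config u $ i = w i"
      unfolding forall_4 relative_config_nth by (simp add: vec_eq_iff forall_2 u34)
    then show ?thesis by blast
  qed
  define y where "y = relative_config u"
  have zy: "z$i - z$j = r *\<^sub>R (A *v (y$i - y$j))" for i j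
    using w[of i] w[of j] unfolding y_def rel
    by (simp add: matrix_vector_mult_diff_distrib scaleR_diff_right)
  have lin: "linear (\<lambda>x. r *\<^sub>R (A *v x))"
    by (intro linear_compose_scale_right matrix_vector_mul_linear)
  have cz: "z $ i = r *\<^sub>R (A *v (centered \<Gamma> y $ i))" for i
  proof -
    have T: "total_circulation \<Gamma> \<noteq> 0" using total_circulation_eq m_pos by simp
    \<comment> \<open>A centred position is a weighted sum of differences of positions, on which the
      similarity acts linearly.\<close>
    have S: "(\<Sum>j\<in>UNIV. \<Gamma> $ j *\<^sub>R (x $ i - x $ j)) = total_circulation \<Gamma> *\<^sub>R (centered \<Gamma> x $ i)" for x
      using T by (simp add: centered_def vorticity_center_def scaleR_diff_right sum_subtractf total_circulation_def scaleR_left.sum)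
    have "total_circulation \<Gamma> *\<^sub>R z $ i = (\<Sum>j\<in>UNIV. \<Gamma> $ j *\<^sub>R (z $ i - z $ j))"
      unfolding S by (simp add: centered_def c0)
    also have "\<dots> = r *\<^sub>R (A *v (\<Sum>j\<in>UNIV. \<Gamma> $ j *\<^sub>R (y $ i - y $ j)))"
      unfolding zy linear_sum[OF lin] linear_scale[OF lin] by simp
    also have "\<dots> = total_circulation \<Gamma> *\<^sub>R (r *\<^sub>R (A *v (centered \<Gamma> y $ i)))"
      unfolding S linear_scale[OF lin] by simp
    finally show ?thesis using T by (simp only: scaleR_cancel_left simp_thms)
  qed
  have nrm: "norm (A *v x) = norm x" for x
    by (rule norm_rotation[OF A])
  have "angular_impulse \<Gamma> z = r\<^sup>2 * angular_impulse \<Gamma> y"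
    unfolding angular_impulse_centered[of \<Gamma> y] sum_distrib_left
    unfolding angular_impulse_def c0 by (simp add: cz nrm power_mult_distrib algebra_simps)
  \<comment> \<open>The normalisation of the angular impulse forces the length \<open>r\<close> to
    be the scale of the chart.\<close>
  then have "r\<^sup>2 * (impulse_poly m u * inverse (2+2*m)) = 1"
    unfolding I1 y_def angular_impulse_relative divide_inverse by simp
  then have "sqrt (r\<^sup>2 * (impulse_poly m u * inverse (2+2*m))) = 1" by simp
  then have "r * sqrt (impulse_poly m u * inverse (2+2*m)) = 1" using r by (simp add: real_sqrt_mult)
  then have rs: "r = chart_scale u" unfolding chart_scale_def by (metis inverse_unique mult.commute)
  have zc: "z = rotate_config A (chart u)"
    by (simp add: vec_eq_iff[of z] rotate_config_def chart_def cz y_def rs matrix_vector_mult_scaleR)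
  then have "orbit (chart u) = p" using orbit_rotate_config[OF A] p by simp
  moreover have "u \<in> collision_free"
    unfolding collision_free_iff collision_set_def
  proof (clarify)
    fix i j :: 4 assume "i \<noteq> j" "relative_config u $ i = relative_config u $ j"
    then show False using zy[of i j] z(2) unfolding y_def collision_set_def by auto
  qed
  ultimately show ?thesis by blast
qed

end

section \<open>The reduced Hamiltonian in the chart\<close>

definition sq13' :: "real^4 \<Rightarrow> real^4 \<Rightarrow> real" where "sq13' u h = 2*(u$1 * h$1 + u$2 * h$2)"
definition sq14' :: "real^4 \<Rightarrow> real^4 \<Rightarrow> real" where "sq14' u h = 2*(u$3 * h$3 + u$4 * h$4)"
definition sq23' :: "real^4 \<Rightarrow> real^4 \<Rightarrow> real" where "sq23' u h = 2*((u$1 - 1) * h$1 + u$2 * h$2)"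
definition sq24' :: "real^4 \<Rightarrow> real^4 \<Rightarrow> real" where "sq24' u h = 2*((u$3 - 1) * h$3 + u$4 * h$4)"
definition sq34' :: "real^4 \<Rightarrow> real^4 \<Rightarrow> real" where
  "sq34' u h = 2*((u$1 - u$3) * (h$1 - h$3) + (u$2 - u$4) * (h$2 - h$4))"

lemmas sq'_defs = sq13'_def sq14'_def sq23'_def sq24'_def sq34'_def

lemma has_derivative_coordinate: "((\<lambda>u::real^'n. u $ i) has_derivative (\<lambda>h. h $ i)) F"
  by (rule bounded_linear_imp_has_derivative[OF bounded_linear_vec_nth])

lemma has_derivative_sq:
  "(sq13 has_derivative sq13' u) (at u)" "(sq14 has_derivative sq14' u) (at u)" "(sq23 has_derivative sq23' u) (at u)"
  "(sq24 has_derivative sq24' u) (at u)" "(sq34 has_derivative sq34' u) (at u)"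
  unfolding sq_defs[abs_def] sq'_defs[abs_def]
  by ((rule derivative_eq_intros has_derivative_coordinate refl)+, simp add: fun_eq_iff algebra_simps)+

definition impulse_poly' :: "real \<Rightarrow> real^4 \<Rightarrow> real^4 \<Rightarrow> real" where
  "impulse_poly' m u h = m*(sq13' u h + sq14' u h + sq23' u h + sq24' u h) + m\<^sup>2 * sq34' u h"

lemma has_derivative_impulse_poly: "(impulse_poly m has_derivative impulse_poly' m u) (at u)"
  unfolding impulse_poly_def[abs_def] impulse_poly'_def[abs_def]
  by (rule derivative_eq_intros has_derivative_sq refl)+ (simp add: fun_eq_iff algebra_simps)

text \<open>The constant \<open>1 + 4*m + m\<^sup>2\<close> is the sum of the products of
  circulations over all pairs. The chart scale enters the Hamiltonian through its logarithm times
  this constant, and differentiating that logarithm produces the quotient.\<close>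

definition multiplier :: "real \<Rightarrow> real^4 \<Rightarrow> real" where
  "multiplier m u = (1 + 4*m + m\<^sup>2) * inverse (impulse_poly m u)"

definition multiplier' :: "real \<Rightarrow> real^4 \<Rightarrow> real^4 \<Rightarrow> real" where
  "multiplier' m u h = - ((1 + 4*m + m\<^sup>2) * (inverse (impulse_poly m u) * impulse_poly' m u h * inverse (impulse_poly m u)))"

definition force_coeff :: "real \<Rightarrow> (real^4 \<Rightarrow> real) \<Rightarrow> real^4 \<Rightarrow> real" where
  "force_coeff m s u = inverse (s u) - multiplier m u"

definition force_coeff' :: "real \<Rightarrow> (real^4 \<Rightarrow> real) \<Rightarrow> (real^4 \<Rightarrow> real^4 \<Rightarrow> real) \<Rightarrow> real^4 \<Rightarrow> real^4 \<Rightarrow> real" where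
  "force_coeff' m s s' u h = - (inverse (s u) * s' u h * inverse (s u)) - multiplier' m u h"

text \<open>Minus the gradient, divided by the circulation of the third and fourth vortex.\<close>

definition force :: "real \<Rightarrow> real^4 \<Rightarrow> real^4" where
  "force m u = vector [
     force_coeff m sq13 u * u$1 + force_coeff m sq23 u * (u$1 - 1) + m * (force_coeff m sq34 u * (u$1 - u$3)),
     force_coeff m sq13 u * u$2 + force_coeff m sq23 u * u$2 + m * (force_coeff m sq34 u * (u$2 - u$4)),
     force_coeff m sq14 u * u$3 + force_coeff m sq24 u * (u$3 - 1) + m * (force_coeff m sq34 u * (u$3 - u$1)),
     force_coeff m sq14 u * u$4 + force_coeff m sq24 u * u$4 + m * (force_coeff m sq34 u * (u$4 - u$2))]"

definition force' :: "real \<Rightarrow> real^4 \<Rightarrow> real^4 \<Rightarrow> real^4" where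
  "force' m u h = vector [
     force_coeff' m sq13 sq13' u h * u$1 + force_coeff m sq13 u * h$1
       + force_coeff' m sq23 sq23' u h * (u$1 - 1) + force_coeff m sq23 u * h$1
       + m * (force_coeff' m sq34 sq34' u h * (u$1 - u$3) + force_coeff m sq34 u * (h$1 - h$3)),
     force_coeff' m sq13 sq13' u h * u$2 + force_coeff m sq13 u * h$2
       + force_coeff' m sq23 sq23' u h * u$2 + force_coeff m sq23 u * h$2
       + m * (force_coeff' m sq34 sq34' u h * (u$2 - u$4) + force_coeff m sq34 u * (h$2 - h$4)),
     force_coeff' m sq14 sq14' u h * u$3 + force_coeff m sq14 u * h$3
       + force_coeff' m sq24 sq24' u h * (u$3 - 1) + force_coeff m sq24 u * h$3
       + m * (force_coeff' m sq34 sq34' u h * (u$3 - u$1) + force_coeff m sq34 u * (h$3 - h$1)),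
     force_coeff' m sq14 sq14' u h * u$4 + force_coeff m sq14 u * h$4
       + force_coeff' m sq24 sq24' u h * u$4 + force_coeff m sq24 u * h$4
       + m * (force_coeff' m sq34 sq34' u h * (u$4 - u$2) + force_coeff m sq34 u * (h$4 - h$2))]"

lemma vector_4_nth [simp]:
  "(vector [a,b,c,d] :: 'a::zero^4) $ 1 = a" "(vector [a,b,c,d] :: 'a::zero^4) $ 2 = b"
  "(vector [a,b,c,d] :: 'a::zero^4) $ 3 = c" "(vector [a,b,c,d] :: 'a::zero^4) $ 4 = d"
  by (simp_all add: vector_def)

context two_pairs
begin

lemma has_derivative_force_coeff:
  assumes "(s has_derivative s' u) (at u)" "s u \<noteq> 0"
  shows "(force_coeff m s has_derivative force_coeff' m s s' u) (at u)"
proof -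
  have "impulse_poly m u \<noteq> 0" using impulse_poly_pos[of u] by simp
  then have "(multiplier m has_derivative multiplier' m u) (at u)"
    unfolding multiplier_def[abs_def] multiplier'_def[abs_def]
    by (auto intro!: derivative_eq_intros has_derivative_impulse_poly)
  moreover have "((\<lambda>u. inverse (s u)) has_derivative (\<lambda>h. - (inverse (s u) * s' u h * inverse (s u)))) (at u)"
    by (rule Deriv.has_derivative_inverse[OF assms(2,1)])
  ultimately show ?thesis
    unfolding force_coeff_def[abs_def] force_coeff'_def[abs_def] by (intro has_derivative_diff)
qed

lemma has_derivative_force:
  assumes u: "u \<in> collision_free"
  shows "((\<lambda>u. force m u $ i) has_derivative (\<lambda>h. force' m u h $ i)) (at u)"
proof -
  note pos = sq_pos[OF u]
  have c: "(force_coeff m sq13 has_derivative force_coeff' m sq13 sq13' u) (at u)"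
    "(force_coeff m sq14 has_derivative force_coeff' m sq14 sq14' u) (at u)"
    "(force_coeff m sq23 has_derivative force_coeff' m sq23 sq23' u) (at u)"
    "(force_coeff m sq24 has_derivative force_coeff' m sq24 sq24' u) (at u)"
    "(force_coeff m sq34 has_derivative force_coeff' m sq34 sq34' u) (at u)"
    using pos by (auto intro!: has_derivative_force_coeff has_derivative_sq)
  have "\<forall>i. ((\<lambda>u. force m u $ i) has_derivative (\<lambda>h. force' m u h $ i)) (at u)"
    unfolding forall_4 force_def force'_def vector_4_nth
    by (intro conjI; ((rule derivative_eq_intros has_derivative_coordinate c refl)+, simp add: fun_eq_iff algebra_simps))
  then show ?thesis by blast
qed

lemma linear_force':
  assumes "u \<in> collision_free"
  shows "linear (\<lambda>h. force' m u h $ i)"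
  using has_derivative_linear[OF has_derivative_force[OF assms]] .

lemma hamiltonian_chart:
  assumes u: "u \<in> collision_free"
  shows "hamiltonian \<Gamma> (chart u) = - (1/2) * (m * (ln (sq13 u) + ln (sq14 u) + ln (sq23 u) + ln (sq24 u)) + m\<^sup>2 * ln (sq34 u))
     - (1 + 4*m + m\<^sup>2) * ln (inverse (sqrt (impulse_poly m u * inverse (2 + 2*m))))"
proof -
  note pos = sq_pos[OF u]
  have l: "ln (norm (chart u $ i - chart u $ j)) = ln (chart_scale u) + ln (norm (relative_config u $ i - relative_config u $ j))"
    if "0 < norm (relative_config u $ i - relative_config u $ j)" for i j
    unfolding chart_diff using that chart_scale_pos[of u] by (simp add: ln_mult)
  have ls: "ln (sqrt x) = ln x / 2" if "0 < x" for x using that by (simp add: ln_sqrt)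
  have "hamiltonian \<Gamma> (chart u) = - ((ln (chart_scale u) + 0) + m * (ln (chart_scale u) + ln (sqrt (sq13 u)))
     + m * (ln (chart_scale u) + ln (sqrt (sq14 u))) + m * (ln (chart_scale u) + ln (sqrt (sq23 u)))
     + m * (ln (chart_scale u) + ln (sqrt (sq24 u))) + m * m * (ln (chart_scale u) + ln (sqrt (sq34 u))))"
    unfolding hamiltonian_expand circ
    using pos l[of 1 2, unfolded norm_relative_config] l[of 1 3, unfolded norm_relative_config]
      l[of 1 4, unfolded norm_relative_config] l[of 2 3, unfolded norm_relative_config]
      l[of 2 4, unfolded norm_relative_config] l[of 3 4, unfolded norm_relative_config]
    by simp
  then show ?thesis unfolding chart_scale_def[symmetric] ls[OF pos(1)] ls[OF pos(2)] ls[OF pos(3)] ls[OF pos(4)] ls[OF pos(5)]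
    by (simp add: algebra_simps power2_eq_square)
qed

lemma has_derivative_hamiltonian_chart:
  assumes u: "u \<in> collision_free"
  shows "((\<lambda>u. hamiltonian \<Gamma> (chart u)) has_derivative (\<lambda>h. - m * (\<Sum>i\<in>UNIV. force m u $ i * h $ i))) (at u)"
proof -
  let ?g = "\<lambda>u. - (1/2) * (m * (ln (sq13 u) + ln (sq14 u) + ln (sq23 u) + ln (sq24 u)) + m\<^sup>2 * ln (sq34 u))
     + (1/2) * ((1 + 4*m + m\<^sup>2) * (ln (impulse_poly m u) - ln (2 + 2*m)))"
  note pos = sq_pos[OF u]
  have I: "0 < impulse_poly m u" for u by (rule impulse_poly_pos)
  have eq: "hamiltonian \<Gamma> (chart v) = ?g v" if "v \<in> collision_free" for v
  proof -
    have e: "ln (inverse (sqrt (impulse_poly m v * inverse (2 + 2*m)))) = - (ln (impulse_poly m v) - ln (2 + 2*m)) / 2"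
    proof -
      have "ln (impulse_poly m v * inverse (2 + 2*m)) = ln (impulse_poly m v) - ln (2 + 2*m)"
        using I[of v] m_pos by (simp add: ln_mult ln_inverse)
      moreover have "ln (inverse (sqrt x)) = - ln x / 2" if "0 < x" for x
        using that by (simp add: ln_inverse ln_sqrt)
      moreover have "0 < impulse_poly m v * inverse (2 + 2*m)" using I[of v] m_pos by simp
      ultimately show ?thesis by metis
    qed
    then show ?thesis unfolding hamiltonian_chart[OF that] e by algebra
  qed
  have lnD: "((\<lambda>u. ln (s u)) has_derivative (\<lambda>h. inverse (s u) * s' u h)) (at u)"
    if "(s has_derivative s' u) (at u)" "0 < s u" for s :: "real^4 \<Rightarrow> real" and s'
    using has_derivative_ln[OF that(2,1)] by (simp add: divide_inverse mult.commute)
  note d = lnD[of sq13 sq13', OF has_derivative_sq(1) pos(1)]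
    lnD[of sq14 sq14', OF has_derivative_sq(2) pos(2)]
    lnD[of sq23 sq23', OF has_derivative_sq(3) pos(3)]
    lnD[of sq24 sq24', OF has_derivative_sq(4) pos(4)]
    lnD[of sq34 sq34', OF has_derivative_sq(5) pos(5)]
    lnD[of "impulse_poly m" "impulse_poly' m", OF has_derivative_impulse_poly I]
  have D: "(?g has_derivative (\<lambda>h. - (1/2) * (m * (inverse (sq13 u) * sq13' u h + inverse (sq14 u) * sq14' u h
       + inverse (sq23 u) * sq23' u h + inverse (sq24 u) * sq24' u h) + m\<^sup>2 * (inverse (sq34 u) * sq34' u h))
     + (1/2) * ((1 + 4*m + m\<^sup>2) * (inverse (impulse_poly m u) * impulse_poly' m u h)))) (at u)"
    by ((rule derivative_eq_intros d refl)+, simp add: fun_eq_iff)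
  have "- (1/2) * (m * (inverse (sq13 u) * sq13' u h + inverse (sq14 u) * sq14' u h
       + inverse (sq23 u) * sq23' u h + inverse (sq24 u) * sq24' u h) + m\<^sup>2 * (inverse (sq34 u) * sq34' u h))
     + (1/2) * ((1 + 4*m + m\<^sup>2) * (inverse (impulse_poly m u) * impulse_poly' m u h))
     = - m * (\<Sum>i\<in>UNIV. force m u $ i * h $ i)" for h
  proof -
    have i: "inverse (s u) = force_coeff m s u + multiplier m u" for s by (simp add: force_coeff_def)
    have l: "(1 + 4*m + m\<^sup>2) * (inverse (impulse_poly m u) * x) = multiplier m u * x" for x
      by (simp add: multiplier_def)
    show ?thesis
      unfolding l unfolding i sum_4 force_def vector_4_nth impulse_poly'_def sq'_defs by algebra
  qed
  then have "(?g has_derivative (\<lambda>h. - m * (\<Sum>i\<in>UNIV. force m u $ i * h $ i))) (at u)" using D by simp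
  then show ?thesis
    by (rule has_derivative_transform_within_open[OF _ open_collision_free u]) (simp add: eq)
qed

lemma force_nondegenerate:
  assumes "m < 1" and u: "u \<in> collision_free" and F: "force m u = 0" and F': "force' m u h = 0"
  shows "h = 0"
proof -
  note pos = sq_pos[OF u]
  have I: "0 < impulse_poly m u" by (rule impulse_poly_pos)
  have L: "0 < 1 + 4*m + m\<^sup>2" using m_pos by (simp add: add_pos_pos)
  have l: "0 < multiplier m u" unfolding multiplier_def using I L by simp
  have S: "s u * force_coeff m s u = 1 - multiplier m u * s u" if "0 < s u" for s
    using that by (simp add: force_coeff_def algebra_simps)
  have S': "s u * force_coeff' m s s' u h = - force_coeff m s u * s' u h - multiplier' m u h * s u - multiplier m u * s' u h"
    if "0 < s u" for s s'
  proof -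
    have "s u * (- (inverse (s u) * s' u h * inverse (s u)) - multiplier' m u h)
       = - ((s u * inverse (s u)) * (s' u h * inverse (s u))) - multiplier' m u h * s u" by (simp add: algebra_simps)
    then show ?thesis using that by (simp add: force_coeff'_def force_coeff_def algebra_simps)
  qed
  have J: "multiplier m u * impulse_poly m u = 1 + 4*m + m\<^sup>2" unfolding multiplier_def using I by simp
  have J': "multiplier' m u h * impulse_poly m u + multiplier m u * impulse_poly' m u h = 0"
  proof -
    have "impulse_poly m u * inverse (impulse_poly m u) = 1" using I by simp
    then show ?thesis unfolding multiplier'_def multiplier_def by algebra
  qed
  have "\<forall>i. force m u $ i = 0" "\<forall>i. force' m u h $ i = 0" using F F' by auto
  note E = this[unfolded forall_4 force_def force'_def vector_4_nth]
  have "h$1 = 0 \<and> h$2 = 0 \<and> h$3 = 0 \<and> h$4 = 0"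
  proof (rule critical_nondegenerate[OF m_pos assms(1) l pos sq_defs sq'_defs
      J[unfolded impulse_poly_def] J'[unfolded impulse_poly_def impulse_poly'_def]
      S[of sq13, OF pos(1)] S[of sq14, OF pos(2)] S[of sq23, OF pos(3)] S[of sq24, OF pos(4)] S[of sq34, OF pos(5)]
      S'[of sq13 sq13', OF pos(1)] S'[of sq14 sq14', OF pos(2)] S'[of sq23 sq23', OF pos(3)] S'[of sq24 sq24', OF pos(4)] S'[of sq34 sq34', OF pos(5)]])
  qed (use E in simp_all)
  then show ?thesis by (simp add: vec_eq_iff forall_4)
qed

lemma morse_reduced_hamiltonian:
  assumes "m < 1"
  shows "morse_on_quotient \<Gamma> (reduced_hamiltonian \<Gamma>)"
  unfolding morse_on_quotient_def
proof
  have comp: "(reduced_hamiltonian \<Gamma> \<circ> orbit \<circ> \<phi>) = (\<lambda>u. hamiltonian \<Gamma> (\<phi> u))" for \<phi> :: "real^4 \<Rightarrow> config"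
    by (simp add: fun_eq_iff reduced_hamiltonian_orbit)
  show "smooth_on_quotient \<Gamma> (reduced_hamiltonian \<Gamma>)"
    unfolding smooth_on_quotient_def quotient_param_def comp by (blast intro: smooth_on_hamiltonian_comp)
  show "\<forall>p. critical_point \<Gamma> (reduced_hamiltonian \<Gamma>) p \<longrightarrow> nondegenerate_at \<Gamma> (reduced_hamiltonian \<Gamma>) p"
  proof (intro allI impI)
    fix p assume crit: "critical_point \<Gamma> (reduced_hamiltonian \<Gamma>) p"
    then obtain u where u: "u \<in> collision_free" "orbit (chart u) = p"
      using chart_surj unfolding critical_point_def by blast
    let ?f = "\<lambda>u. hamiltonian \<Gamma> (chart u)"
    have "(?f has_derivative (\<lambda>_. 0)) (at u)"
      using crit quotient_param_chart u unfolding critical_point_def comp[symmetric] by blast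
    from has_derivative_unique[OF this has_derivative_hamiltonian_chart[OF u(1)]]
    have "- m * (\<Sum>i\<in>UNIV. force m u $ i * axis j 1 $ i) = 0" for j by metis
    then have "force m u $ j = 0" for j
      using m_pos by (simp add: axis_def if_distrib cong: if_cong)
    then have F: "force m u = 0" by (simp add: vec_eq_iff)
    \<comment> \<open>The formula is needed on the whole open set, not only at the critical point,
      because it is differentiated once more.\<close>
    have pd: "partial_deriv j ?f v = - m * force m v $ j" if "v \<in> collision_free" for v j
      unfolding partial_deriv_def frechet_derivative_at[OF has_derivative_hamiltonian_chart[OF that], symmetric]
      by (simp add: axis_def if_distrib cong: if_cong)
    have H: "hessian ?f u $ i $ j = - m * force' m u (axis i 1) $ j" for i j
    proof -
      have "((\<lambda>v. - m * force m v $ j) has_derivative (\<lambda>h. - m * force' m u h $ j)) (at u)"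
        by (intro has_derivative_mult_right has_derivative_force u)
      then have "(partial_deriv j ?f has_derivative (\<lambda>h. - m * force' m u h $ j)) (at u)"
        by (rule has_derivative_transform_within_open[OF _ open_collision_free u(1)]) (simp add: pd)
      from fun_cong[OF frechet_derivative_at[OF this], of "axis i 1"] show ?thesis
        unfolding hessian_def by (simp add: partial_deriv_def[of i])
    qed
    \<comment> \<open>The transpose appears because entry \<open>i\<close>, \<open>j\<close> of the
      Hessian differentiates component \<open>j\<close> in direction \<open>i\<close>, so that the
      transposed matrix maps \<open>h\<close> to \<open>- m\<close> times
      \<open>force' m u h\<close>.\<close>
    have ker: "h = 0" if "transpose (hessian ?f u) *v h = 0" for h
    proof -
      have "force' m u h $ j = 0" for j
      proof -
        have h: "h = (\<Sum>i\<in>UNIV. h $ i *\<^sub>R axis i 1)" using basis_expansion[of h] by (simp add: scalar_mult_eq_scaleR)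
        note L = linear_force'[OF u(1), of j]
        have "force' m u h $ j = force' m u (\<Sum>i\<in>UNIV. h $ i *\<^sub>R axis i 1) $ j"
          by (rule arg_cong[OF h, of "\<lambda>h. force' m u h $ j"])
        also have "\<dots> = (\<Sum>i\<in>UNIV. h $ i * force' m u (axis i 1) $ j)"
          unfolding linear_sum[OF L] linear_scale[OF L] by simp
        finally have "force' m u h $ j = (\<Sum>i\<in>UNIV. h $ i * force' m u (axis i 1) $ j)" .
        moreover have "(\<Sum>i\<in>UNIV. (hessian ?f u $ i $ j) * h $ i) = 0"
          using that by (simp add: vec_eq_iff matrix_vector_mult_def transpose_def)
        then have "m * (\<Sum>i\<in>UNIV. h $ i * force' m u (axis i 1) $ j) = 0"
          unfolding H sum_distrib_left by (simp add: sum_negf algebra_simps)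
        ultimately show ?thesis using m_pos by simp
      qed
      then have "force' m u h = 0" by (simp add: vec_eq_iff)
      then show "h = 0" using force_nondegenerate[OF assms u(1) F] by blast
    qed
    then have "\<exists>B. B ** transpose (hessian ?f u) = mat 1" by (simp add: matrix_left_invertible_ker)
    then have "det (transpose (hessian ?f u)) \<noteq> 0"
      by (metis invertible_def invertible_det_nz matrix_left_right_inverse)
    then have "det (hessian (reduced_hamiltonian \<Gamma> \<circ> orbit \<circ> chart) u) \<noteq> 0" unfolding comp by (simp add: det_transpose)
    then show "nondegenerate_at \<Gamma> (reduced_hamiltonian \<Gamma>) p"
      unfolding nondegenerate_at_def using quotient_param_chart u by blast
  qed
qed

end

theorem lemma4p7:
  fixes \<Gamma> :: "real^4" and m :: real
  assumes "\<Gamma> $ 1 = 1" and "\<Gamma> $ 2 = 1" and "\<Gamma> $ 3 = m" and "\<Gamma> $ 4 = m"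
    and "0 < m" and "m < 1"
  shows "morse_on_quotient \<Gamma> (reduced_hamiltonian \<Gamma>)"
proof -
  interpret two_pairs \<Gamma> m by unfold_locales (use assms in auto)
  show ?thesis using morse_reduced_hamiltonian assms(6) .
qed

end
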